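(* Let $\psi:\mathbb{R}\to\mathbb{R}$ be a smooth even function such that $0 \leq s\,\psi'(s) < \min\{\psi(s),s\}$ for all $s>0$ and $0 \leq s\,\psi''(s) \leq 1-\psi'(s)^2$ for all $s\geq 0$. Let $F:\Sigma\to S^3$ be a smooth embedding of a two-dimensional torus $\Sigma$ whose principal curvatures $\lambda_1\geq\lambda_2$ (with respect to some choice of unit normal vector field) satisfy $\lambda_1+\lambda_2=\psi(\lambda_1-\lambda_2)$ at every point of $\Sigma$. Then $F$ is rotationally symmetric in the following sense: there exists an anti-symmetric matrix $Q\in\mathfrak{so}(4)$ of rank $2$ such that $Q\,F(x)\in \mathrm{span}\{\frac{\partial F}{\partial x_1}(x),\frac{\partial F}{\partial x_2}(x)\}$ for all $x\in\Sigma$, where $(x_1,x_2)$ denote local coordinates on $\Sigma$ around $x$.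
   Context: $S^3\subset\mathbb{R}^4$ is the unit sphere with its round metric, and $F$ is regarded as an $\mathbb{R}^4$-valued map. $\nu$ is a unit normal vector field along $F$ (tangent to $S^3$, normal to the surface), the second fundamental form is $h_{ij}=\langle \frac{\partial \nu}{\partial x_i},\frac{\partial F}{\partial x_j}\rangle$, and the principal curvatures $\lambda_1\ge\lambda_2$ are the eigenvalues of $h$ with respect to the induced metric. The span in the conclusion is the tangent plane of the surface at $F(x)$, regarded as a linear subspace of $\mathbb{R}^4$. *)

theory Defs
  imports "HOL-Analysis.Analysis"
begin

primrec times_cont_differentiable ::
    "nat \<Rightarrow> ('a::real_normed_vector \<Rightarrow> 'b::real_normed_vector) \<Rightarrow> bool" where
  "times_cont_differentiable 0 f \<longleftrightarrow> continuous_on UNIV f"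
| "times_cont_differentiable (Suc k) f \<longleftrightarrow>
     (\<forall>x. f differentiable (at x)) \<and>
     (\<forall>v. times_cont_differentiable k (\<lambda>x. frechet_derivative f (at x) v))"

definition smooth :: "('a::real_normed_vector \<Rightarrow> 'b::real_normed_vector) \<Rightarrow> bool" where
  "smooth f \<longleftrightarrow> (\<forall>k. times_cont_differentiable k f)"

definition torus :: "(complex \<times> complex) set" where
  "torus = sphere 0 1 \<times> sphere 0 1"

text \<open>The smooth structure of the torus is the one for which the universal covering
  \<open>angular\<close> is a local diffeomorphism.  Near each point a local inverse of \<open>angular\<close> is
  a chart, so smoothness and partial derivatives of a map \<open>f\<close> on the torus are those of
  \<open>f \<circ> angular\<close>.  Values of \<open>f\<close> outside \<open>torus\<close> never enter.\<close>

definition angular :: "real ^ 2 \<Rightarrow> complex \<times> complex" where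
  "angular x = (cis (x $ 1), cis (x $ 2))"

definition torus_smooth :: "(complex \<times> complex \<Rightarrow> 'b::real_normed_vector) \<Rightarrow> bool" where
  "torus_smooth f \<longleftrightarrow> smooth (f \<circ> angular)"

definition pd :: "(complex \<times> complex \<Rightarrow> 'b::real_normed_vector) \<Rightarrow> 2 \<Rightarrow> real ^ 2 \<Rightarrow> 'b" where
  "pd f i x = frechet_derivative (f \<circ> angular) (at x) (axis i 1)"

definition smooth_embedding_S3 :: "(complex \<times> complex \<Rightarrow> real ^ 4) \<Rightarrow> bool" where
  "smooth_embedding_S3 F \<longleftrightarrow>
     F ` torus \<subseteq> sphere 0 1 \<and>
     torus_smooth F \<and>
     (\<forall>x. inj (frechet_derivative (F \<circ> angular) (at x))) \<and>
     (\<exists>G. homeomorphism torus (F ` torus) F G)"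

definition unit_normal_field ::
    "(complex \<times> complex \<Rightarrow> real ^ 4) \<Rightarrow> (complex \<times> complex \<Rightarrow> real ^ 4) \<Rightarrow> bool" where
  "unit_normal_field F \<nu> \<longleftrightarrow>
     torus_smooth \<nu> \<and>
     (\<forall>p\<in>torus. norm (\<nu> p) = 1 \<and> \<nu> p \<bullet> F p = 0) \<and>
     (\<forall>x i. \<nu> (angular x) \<bullet> pd F i x = 0)"

definition first_ff :: "(complex \<times> complex \<Rightarrow> real ^ 4) \<Rightarrow> real ^ 2 \<Rightarrow> real ^ 2 ^ 2" where
  "first_ff F x = (\<chi> i j. pd F i x \<bullet> pd F j x)"

definition second_ff ::
    "(complex \<times> complex \<Rightarrow> real ^ 4) \<Rightarrow> (complex \<times> complex \<Rightarrow> real ^ 4)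
      \<Rightarrow> real ^ 2 \<Rightarrow> real ^ 2 ^ 2" where
  "second_ff F \<nu> x = (\<chi> i j. pd \<nu> i x \<bullet> pd F j x)"

text \<open>Eigenvalues of the second fundamental form with respect to the induced metric.  For an
  immersion this pencil is diagonalizable, so the set is a singleton exactly when the point is
  umbilic; hence an equality with \<open>{a, b}\<close> also determines the multiplicities.\<close>

definition principal_curvatures ::
    "(complex \<times> complex \<Rightarrow> real ^ 4) \<Rightarrow> (complex \<times> complex \<Rightarrow> real ^ 4)
      \<Rightarrow> real ^ 2 \<Rightarrow> real set" where
  "principal_curvatures F \<nu> x =
     {t. \<exists>v. v \<noteq> 0 \<and> second_ff F \<nu> x *v v = t *\<^sub>R (first_ff F x *v v)}"

end

theory Submission
  imports Defs
begin

text \<open>Let \<open>u = \<lambda>\<^sub>1 - \<lambda>\<^sub>2\<close>. In a periodic orthonormal frame the trace-free part of the second fundamental form is a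
  map \<open>(a, b)\<close> into the plane. The Codazzi equations and the Weingarten relation give it a Jacobian of one sign up to
  terms of order \<open>a\<^sup>2 + b\<^sup>2\<close>; since the pullback of an area form of the plane integrates to zero over the torus, the
  logarithm of \<open>\<bar>(a, b)\<bar>\<close> has bounded Dirichlet energy. So \<open>(a, b)\<close> has no zero unless it vanishes identically,
  and then Gauss-Bonnet is violated: there are no umbilic points.

  For \<open>\<kappa> > 1\<close> put \<open>\<Phi> = (\<psi> u + \<kappa> u) / 2\<close>. If \<open>Z x y = \<Phi> x (1 - F x \<bullet> F y) + \<nu> x \<bullet> F y\<close> were negative somewhere,
  then for a larger \<open>\<kappa>\<close> it would be nonnegative with a zero at some \<open>x \<noteq> y\<close>. Geometrically a ball of curvature
  \<open>\<Phi> x\<close> touches the surface at both points, from the same side because the torus is embedded. The second derivative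
  test in the principal directions at \<open>x\<close> and their reflections at \<open>y\<close>, combined with the convexity of \<open>\<psi>\<close> and
  the Simons-type identity for \<open>u\<close>, gives a contradiction; strictness comes from \<open>s \<psi>' s < \<psi> s\<close>.

  Hence \<open>Z \<ge> 0\<close> for \<open>\<kappa> = 1\<close>, where \<open>\<Phi> = \<lambda>\<^sub>1\<close>. The Taylor expansion of \<open>Z x\<close> along the first principal direction \<open>e\<^sub>1\<close>
  then has a vanishing cubic term, that is \<open>e\<^sub>1 \<lambda>\<^sub>1 = 0\<close>. It follows that the plane spanned by \<open>e\<^sub>1\<close> and the curvature
  vector of the curvature line is the same at all points; \<open>Q\<close> is the infinitesimal rotation in this plane.\<close>


section \<open>Smooth maps and directional derivatives\<close>

text \<open>The inequality \<open>Z x y \<ge> 0\<close> says that \<open>F y\<close> lies in the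
  half space \<open>(\<nu> x - \<Phi> x *\<^sub>R F x) \<bullet> p \<ge> - \<Phi> x\<close>; the
  rest of the sphere is an open geodesic ball whose boundary passes through \<open>F x\<close>. A
  factor \<kappa> > 1 makes this ball more strongly curved than the surface in both principal
  directions, so pairs near the diagonal satisfy the inequality strictly and a contact obtained by
  compactness has two distinct points. At \<kappa> = 1 the comparison degenerates along
  \<open>e1\<close>; this case is reached only as a limit, and the degeneracy is what yields the
  final rigidity. Two kinds of frame occur because their virtues conflict. Integrals over the torus
  need a periodic frame, supplied by Gram-Schmidt from the coordinates. Second derivatives are
  manageable in principal directions, which form smooth vector fields on the covering plane but
  could change sign along a period. Umbilic points have to be excluded beforehand, since both the
  principal frame and the smoothness of \<Phi> rest on u > 0. In the second derivative test the two
  principal directions carry the weights 1 - \<psi>'(u) and 1 + \<psi>'(u), the ones that the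
  Codazzi equations put on the second derivatives of u.\<close>

declare times_cont_differentiable.simps(2) [simp del]

text \<open>The direction comes before the map so that \<open>dd v f\<close> is again a map, to
  which \<open>smooth\<close> and \<open>dd\<close> apply; higher derivatives are iterates with
  constant directions.\<close>

definition dd :: "'a::real_normed_vector \<Rightarrow> ('a \<Rightarrow> 'b::real_normed_vector) \<Rightarrow> 'a \<Rightarrow> 'b" where
  "dd v f x = frechet_derivative f (at x) v"

abbreviation tcd :: "nat \<Rightarrow> ('a::real_normed_vector \<Rightarrow> 'b::real_normed_vector) \<Rightarrow> bool" where
  "tcd \<equiv> times_cont_differentiable"

lemma tcd_Suc: "tcd (Suc k) f \<longleftrightarrow> (\<forall>x. f differentiable (at x)) \<and> (\<forall>v. tcd k (dd v f))"
  by (simp add: dd_def[abs_def] times_cont_differentiable.simps(2))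

lemma tcd_imp_continuous: "tcd k f \<Longrightarrow> continuous_on UNIV f"
  by (cases k) (auto simp: tcd_Suc continuous_on_eq_continuous_at differentiable_imp_continuous_within)

lemma tcd_SucD: "tcd (Suc k) f \<Longrightarrow> tcd k f"
proof (induction k arbitrary: f)
  case 0
  then show ?case using tcd_imp_continuous by fastforce
next
  case (Suc k)
  then show ?case by (metis tcd_Suc)
qed

lemma dd_eqI: "(f has_derivative f') (at x) \<Longrightarrow> dd v f x = f' v"
  unfolding dd_def by (metis frechet_derivative_at)

lemma differentiable_dd: "f differentiable (at x) \<Longrightarrow> (f has_derivative (\<lambda>v. dd v f x)) (at x)"
  unfolding dd_def using frechet_derivative_works[of f "at x"] by simp

lemma smooth_differentiable: "smooth f \<Longrightarrow> f differentiable (at x)"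
  unfolding smooth_def using tcd_Suc by blast

lemma smooth_dd: "smooth f \<Longrightarrow> smooth (dd v f)"
  unfolding smooth_def using tcd_Suc by blast

lemma smooth_has_dd: "smooth f \<Longrightarrow> (f has_derivative (\<lambda>v. dd v f x)) (at x)"
  by (intro differentiable_dd smooth_differentiable)

lemma smooth_continuous: "smooth f \<Longrightarrow> continuous_on S f"
  unfolding smooth_def by (meson tcd_imp_continuous continuous_on_subset subset_UNIV)

lemma smoothI: "(\<And>x. f differentiable (at x)) \<Longrightarrow> (\<And>v. smooth (dd v f)) \<Longrightarrow> smooth f"
  unfolding smooth_def
proof
  fix k
  assume "\<And>x. f differentiable (at x)" "\<And>v. \<forall>k. tcd k (dd v f)"
  then have "tcd (Suc k) f" by (simp add: tcd_Suc)
  then show "tcd k f" by (rule tcd_SucD)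
qed

lemma tcd_const: "tcd k (\<lambda>x. c)"
proof (induction k arbitrary: c)
  case (Suc k)
  have "dd v (\<lambda>x. c) = (\<lambda>x::'a. 0)" for v by (rule ext, rule dd_eqI) auto
  then show ?case using Suc by (auto simp: tcd_Suc)
qed simp

lemma tcd_bounded_linear:
  assumes L: "bounded_linear L"
  shows "tcd k f \<Longrightarrow> tcd k (\<lambda>x. L (f x))"
proof (induction k arbitrary: f)
  case 0
  then show ?case using L by (auto intro: bounded_linear.continuous_on)
next
  case (Suc k)
  have *: "((\<lambda>x. L (f x)) has_derivative (\<lambda>v. L (dd v f x))) (at x)" for x
    by (rule bounded_linear.has_derivative[OF L]) (use Suc.prems in \<open>auto simp: tcd_Suc intro!: differentiable_dd\<close>)
  have "dd v (\<lambda>x. L (f x)) = (\<lambda>x. L (dd v f x))" for v by (rule ext, rule dd_eqI[OF *])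
  moreover have "(\<lambda>x. L (f x)) differentiable (at x)" for x using * differentiableI by blast
  ultimately show ?case using Suc by (auto simp: tcd_Suc)
qed

lemma tcd_add: "tcd k f \<Longrightarrow> tcd k g \<Longrightarrow> tcd k (\<lambda>x. f x + g x)"
proof (induction k arbitrary: f g)
  case 0
  then show ?case by (auto intro: continuous_intros)
next
  case (Suc k)
  have *: "((\<lambda>x. f x + g x) has_derivative (\<lambda>v. dd v f x + dd v g x)) (at x)" for x
    by (rule has_derivative_add) (use Suc.prems in \<open>auto simp: tcd_Suc intro!: differentiable_dd\<close>)
  have "dd v (\<lambda>x. f x + g x) = (\<lambda>x. dd v f x + dd v g x)" for v by (rule ext, rule dd_eqI[OF *])
  moreover have "(\<lambda>x. f x + g x) differentiable (at x)" for x using * differentiableI by blast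
  ultimately show ?case using Suc by (auto simp: tcd_Suc)
qed

text \<open>One Leibniz induction serves products, scalings and inner products alike.\<close>

lemma tcd_bilinear:
  assumes B: "bounded_bilinear B"
  shows "tcd k f \<Longrightarrow> tcd k g \<Longrightarrow> tcd k (\<lambda>x. B (f x) (g x))"
proof (induction k arbitrary: f g)
  case 0
  then show ?case using B by (auto intro: bounded_bilinear.continuous_on)
next
  case (Suc k)
  have *: "((\<lambda>x. B (f x) (g x)) has_derivative (\<lambda>v. B (f x) (dd v g x) + B (dd v f x) (g x))) (at x)" for x
    by (rule bounded_bilinear.FDERIV[OF B]) (use Suc.prems in \<open>auto simp: tcd_Suc intro!: differentiable_dd\<close>)
  have "dd v (\<lambda>x. B (f x) (g x)) = (\<lambda>x. B (f x) (dd v g x) + B (dd v f x) (g x))" for v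
    by (rule ext, rule dd_eqI[OF *])
  moreover have "(\<lambda>x. B (f x) (g x)) differentiable (at x)" for x using * differentiableI by blast
  moreover have "tcd k f" "tcd k g" using Suc.prems tcd_SucD by auto
  ultimately show ?case using Suc
    by (auto simp: tcd_Suc intro!: tcd_add)
qed

text \<open>The derivative is a product of \<open>inverse (f x)\<close> and \<open>dd v f x\<close>,
  so the induction hypothesis for the same function closes the step.\<close>

lemma tcd_inverse:
  fixes f :: "'a::real_normed_vector \<Rightarrow> 'b::real_normed_field"
  assumes nz: "\<And>x. f x \<noteq> 0"
  shows "tcd k f \<Longrightarrow> tcd k (\<lambda>x. inverse (f x))"
proof (induction k)
  case 0
  then show ?case using nz by (auto intro: continuous_intros)
next
  case (Suc k)
  have *: "((\<lambda>x. inverse (f x)) has_derivative (\<lambda>v. - (inverse (f x) * dd v f x * inverse (f x)))) (at x)" for x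
    by (rule Deriv.has_derivative_inverse) (use nz Suc.prems in \<open>auto simp: tcd_Suc intro!: differentiable_dd\<close>)
  have "dd v (\<lambda>x. inverse (f x)) = (\<lambda>x. - (inverse (f x) * dd v f x * inverse (f x)))" for v
    by (rule ext, rule dd_eqI[OF *])
  moreover have "(\<lambda>x. inverse (f x)) differentiable (at x)" for x using * differentiableI by blast
  moreover have "tcd k (\<lambda>x. - (inverse (f x) * dd v f x * inverse (f x)))" for v
    using Suc.IH[OF tcd_SucD[OF Suc.prems]] Suc.prems[unfolded tcd_Suc]
    by (intro tcd_bounded_linear[OF bounded_linear_minus[OF bounded_linear_ident]]
      tcd_bilinear[OF bounded_bilinear_mult]) auto
  ultimately show ?case by (auto simp: tcd_Suc)
qed

lemma tcd_compose_real:
  fixes f :: "'a::real_normed_vector \<Rightarrow> real" and \<phi> :: "real \<Rightarrow> real"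
  shows "tcd k \<phi> \<Longrightarrow> tcd k f \<Longrightarrow> tcd k (\<lambda>x. \<phi> (f x))"
proof (induction k arbitrary: \<phi>)
  case 0
  then show ?case by (auto intro: continuous_on_compose2)
next
  case (Suc k)
  have l: "(\<phi> has_derivative (\<lambda>v. dd v \<phi> y)) (at y)" for y
    using Suc.prems by (auto simp: tcd_Suc intro!: differentiable_dd)
  have s: "dd v \<phi> y = v * dd 1 \<phi> y" for v y
    using linear_scale[OF has_derivative_linear[OF l[of y]], of v 1] by simp
  have l': "(\<phi> has_derivative (\<lambda>v. v * dd 1 \<phi> y)) (at y)" for y
    by (rule has_derivative_eq_rhs[OF l]) (rule ext, rule s)
  have *: "((\<lambda>x. \<phi> (f x)) has_derivative (\<lambda>v. dd v f x * dd 1 \<phi> (f x))) (at x)" for x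
    by (rule has_derivative_compose[OF _ l']) (use Suc.prems in \<open>auto simp: tcd_Suc intro!: differentiable_dd\<close>)
  have "dd v (\<lambda>x. \<phi> (f x)) = (\<lambda>x. dd v f x * dd 1 \<phi> (f x))" for v by (rule ext, rule dd_eqI[OF *])
  moreover have "(\<lambda>x. \<phi> (f x)) differentiable (at x)" for x using * differentiableI by blast
  moreover have "tcd k (\<lambda>x. dd v f x * dd 1 \<phi> (f x))" for v
    using Suc.IH[of "dd 1 \<phi>"] Suc.prems[unfolded tcd_Suc] tcd_SucD[OF Suc.prems(2)]
    by (intro tcd_bilinear[OF bounded_bilinear_mult]) auto
  ultimately show ?case by (auto simp: tcd_Suc)
qed

lemma tcd_sqrt:
  fixes f :: "'a::real_normed_vector \<Rightarrow> real"
  assumes pos: "\<And>x. f x > 0"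
  shows "tcd k f \<Longrightarrow> tcd k (\<lambda>x. sqrt (f x))"
proof (induction k)
  case 0
  then show ?case by (auto intro: continuous_intros)
next
  case (Suc k)
  have *: "((\<lambda>x. sqrt (f x)) has_derivative (\<lambda>v. dd v f x * (inverse (sqrt (f x)) / 2))) (at x)" for x
  proof -
    have "(f has_derivative (\<lambda>v. dd v f x)) (at x)"
      using Suc.prems by (auto simp: tcd_Suc intro!: differentiable_dd)
    from has_derivative_compose[OF this DERIV_real_sqrt[OF pos, unfolded has_field_derivative_def]]
    show ?thesis by (simp add: mult.commute)
  qed
  have "dd v (\<lambda>x. sqrt (f x)) = (\<lambda>x. dd v f x * (inverse (sqrt (f x)) / 2))" for v by (rule ext, rule dd_eqI[OF *])
  moreover have "(\<lambda>x. sqrt (f x)) differentiable (at x)" for x using * differentiableI by blast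
  moreover have "tcd k (\<lambda>x. dd v f x * (inverse (sqrt (f x)) / 2))" for v
    using Suc.IH[OF tcd_SucD[OF Suc.prems]] Suc.prems[unfolded tcd_Suc] pos[THEN less_imp_neq]
    by (intro tcd_bilinear[OF bounded_bilinear_mult] tcd_bounded_linear[OF bounded_linear_divide] tcd_inverse) auto
  ultimately show ?case by (auto simp: tcd_Suc)
qed

lemma dd_sin: "dd v sin x = v * cos x" and dd_cos: "dd v cos x = v * - sin x" for v x :: real
proof -
  show "dd v sin x = v * cos x"
    by (rule dd_eqI) (use DERIV_sin[of x] in \<open>simp add: has_field_derivative_def mult_commute_abs\<close>)
  have "(cos has_derivative (\<lambda>v. v * - sin x)) (at x)"
    using DERIV_cos[of x] unfolding has_field_derivative_def mult.commute[of "- sin x"] .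
  then show "dd v cos x = v * - sin x" by (rule dd_eqI)
qed

lemma tcd_sin_cos: "tcd k (sin :: real \<Rightarrow> real) \<and> tcd k (cos :: real \<Rightarrow> real)"
proof (induction k)
  case 0
  then show ?case by (auto intro: continuous_intros)
next
  case (Suc k)
  have d: "sin differentiable (at x)" "cos differentiable (at x)" for x :: real
    using DERIV_sin DERIV_cos has_field_derivative_def differentiableI by blast+
  have "tcd k (dd v sin)" "tcd k (dd v cos)" for v :: real
    unfolding dd_sin[abs_def] dd_cos[abs_def]
    using Suc by (auto intro!: tcd_bounded_linear[OF bounded_linear_mult_right] tcd_bounded_linear[OF bounded_linear_minus[OF bounded_linear_ident]])
  with d show ?case by (auto simp: tcd_Suc)
qed

lemma smooth_const: "smooth (\<lambda>x. c)" by (simp add: smooth_def tcd_const)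
lemma smooth_add: "smooth f \<Longrightarrow> smooth g \<Longrightarrow> smooth (\<lambda>x. f x + g x)" by (simp add: smooth_def tcd_add)
lemma smooth_bounded_linear: "bounded_linear L \<Longrightarrow> smooth f \<Longrightarrow> smooth (\<lambda>x. L (f x))"
  by (simp add: smooth_def tcd_bounded_linear)
lemma smooth_minus: "smooth f \<Longrightarrow> smooth (\<lambda>x. - f x)"
  by (rule smooth_bounded_linear[OF bounded_linear_minus[OF bounded_linear_ident]])
lemma smooth_diff: "smooth f \<Longrightarrow> smooth g \<Longrightarrow> smooth (\<lambda>x. f x - g x)"
  using smooth_add[OF _ smooth_minus, of f g] by simp
lemma smooth_bilinear: "bounded_bilinear B \<Longrightarrow> smooth f \<Longrightarrow> smooth g \<Longrightarrow> smooth (\<lambda>x. B (f x) (g x))"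
  by (simp add: smooth_def tcd_bilinear)
lemmas smooth_mult = smooth_bilinear[OF bounded_bilinear_mult]
lemmas smooth_scaleR = smooth_bilinear[OF bounded_bilinear_scaleR]
lemmas smooth_inner = smooth_bilinear[OF bounded_bilinear_inner]
lemma smooth_inverse:
  fixes f :: "'a::real_normed_vector \<Rightarrow> 'b::real_normed_field"
  shows "(\<And>x. f x \<noteq> 0) \<Longrightarrow> smooth f \<Longrightarrow> smooth (\<lambda>x. inverse (f x))"
  by (simp add: smooth_def tcd_inverse)
lemma smooth_divide:
  fixes f :: "'a::real_normed_vector \<Rightarrow> 'b::real_normed_field"
  shows "(\<And>x. g x \<noteq> 0) \<Longrightarrow> smooth f \<Longrightarrow> smooth g \<Longrightarrow> smooth (\<lambda>x. f x / g x)"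
  by (simp add: divide_inverse smooth_mult smooth_inverse)
lemma smooth_sqrt: "(\<And>x. f x > 0) \<Longrightarrow> smooth f \<Longrightarrow> smooth (\<lambda>x. sqrt (f x))"
  by (simp add: smooth_def tcd_sqrt)
lemma smooth_compose_real: "smooth \<phi> \<Longrightarrow> smooth f \<Longrightarrow> smooth (\<lambda>x. \<phi> (f x))"
  for f :: "'a::real_normed_vector \<Rightarrow> real" and \<phi> :: "real \<Rightarrow> real"
  by (simp add: smooth_def tcd_compose_real)
lemma smooth_sin: "smooth (sin :: real \<Rightarrow> real)" and smooth_cos: "smooth (cos :: real \<Rightarrow> real)"
  by (simp_all add: smooth_def tcd_sin_cos)

lemmas smooth_intros = smooth_const smooth_add smooth_diff smooth_minus smooth_mult smooth_scaleR smooth_inner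
  smooth_dd

section \<open>Calculus of directional derivatives\<close>

lemma dd_linear: "f differentiable (at x) \<Longrightarrow> linear (\<lambda>v. dd v f x)"
  using differentiable_dd has_derivative_linear by blast

lemma dd_vadd: "f differentiable (at x) \<Longrightarrow> dd (v + w) f x = dd v f x + dd w f x"
  using linear_add[OF dd_linear] by blast
lemma dd_vdiff: "f differentiable (at x) \<Longrightarrow> dd (v - w) f x = dd v f x - dd w f x"
  using linear_diff[OF dd_linear] by blast
lemma dd_vminus: "f differentiable (at x) \<Longrightarrow> dd (- v) f x = - dd v f x"
  using linear_neg[OF dd_linear] by blast
lemma dd_vscale: "f differentiable (at x) \<Longrightarrow> dd (c *\<^sub>R v) f x = c *\<^sub>R dd v f x"
  using linear_cmul[OF dd_linear] by blast

lemma dd_const: "dd v (\<lambda>x. c) x = 0" by (rule dd_eqI) auto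
lemma dd_add: "f differentiable (at x) \<Longrightarrow> g differentiable (at x) \<Longrightarrow> dd v (\<lambda>x. f x + g x) x = dd v f x + dd v g x"
  by (rule dd_eqI) (intro has_derivative_add differentiable_dd)
lemma dd_diff: "f differentiable (at x) \<Longrightarrow> g differentiable (at x) \<Longrightarrow> dd v (\<lambda>x. f x - g x) x = dd v f x - dd v g x"
  by (rule dd_eqI) (intro has_derivative_diff differentiable_dd)
lemma dd_minus: "f differentiable (at x) \<Longrightarrow> dd v (\<lambda>x. - f x) x = - dd v f x"
  by (rule dd_eqI) (intro has_derivative_minus differentiable_dd)
lemma dd_bilinear: assumes "bounded_bilinear B"
  shows "f differentiable (at x) \<Longrightarrow> g differentiable (at x) \<Longrightarrow>
    dd v (\<lambda>x. B (f x) (g x)) x = B (dd v f x) (g x) + B (f x) (dd v g x)"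
  by (subst add.commute, rule dd_eqI) (intro bounded_bilinear.FDERIV[OF assms] differentiable_dd)
lemmas dd_mult = dd_bilinear[OF bounded_bilinear_mult]
lemmas dd_scaleR = dd_bilinear[OF bounded_bilinear_scaleR]
lemmas dd_inner = dd_bilinear[OF bounded_bilinear_inner]
lemma dd_compose_real:
  fixes f :: "'a::real_normed_vector \<Rightarrow> real"
  assumes "(\<phi> has_real_derivative d) (at (f x))" "f differentiable (at x)"
  shows "dd v (\<lambda>x. \<phi> (f x)) x = d * dd v f x"
  by (rule dd_eqI)
    (rule has_derivative_compose[OF differentiable_dd[OF assms(2)] assms(1)[unfolded has_field_derivative_def]])

lemmas dd_simps = dd_const dd_add dd_diff dd_minus dd_mult dd_scaleR dd_inner smooth_differentiable smooth_intros

lemma smooth_line: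
  assumes "smooth f"
  shows "((\<lambda>t. f (x + t *\<^sub>R v)) has_vector_derivative dd v f (x + t *\<^sub>R v)) (at t within S)"
proof -
  have "((\<lambda>t. x + t *\<^sub>R v) has_derivative (\<lambda>s. s *\<^sub>R v)) (at t within S)" by (auto intro!: derivative_eq_intros)
  from has_derivative_compose[OF this smooth_has_dd[OF assms]]
  show ?thesis
    unfolding has_vector_derivative_def using dd_vscale[OF smooth_differentiable[OF assms]] by simp
qed

lemma smooth_line_mvt:
  fixes f :: "'a::real_normed_vector \<Rightarrow> real"
  assumes "smooth f" "h > 0"
  obtains s where "0 < s" "s < h" "f (x + h *\<^sub>R v) - f x = h * dd v f (x + s *\<^sub>R v)"
proof -
  have "\<exists>s>0. s < h \<and> f (x + h *\<^sub>R v) - f (x + 0 *\<^sub>R v) = (h - 0) * dd v f (x + s *\<^sub>R v)"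
    using assms(2) by (intro MVT2) (use smooth_line[OF assms(1)] in \<open>auto simp: has_real_derivative_iff_has_vector_derivative\<close>)
  then show thesis using that by auto
qed

lemma tcd_shift: "tcd k g \<Longrightarrow> tcd k (\<lambda>y. g (y + c))"
proof (induction k arbitrary: g)
  case 0
  then show ?case by (auto intro!: continuous_on_compose2[of UNIV g UNIV] continuous_intros)
next
  case (Suc k)
  have *: "((\<lambda>y. g (y + c)) has_derivative (\<lambda>v. dd v g (y + c))) (at y)" for y
    by (rule has_derivative_compose[of "\<lambda>y. y + c" "\<lambda>v. v"])
      (use Suc.prems in \<open>auto simp: tcd_Suc intro!: differentiable_dd derivative_eq_intros\<close>)
  have "dd v (\<lambda>y. g (y + c)) = (\<lambda>y. dd v g (y + c))" for v by (rule ext, rule dd_eqI[OF *])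
  moreover have "(\<lambda>y. g (y + c)) differentiable (at y)" for y using * differentiableI by blast
  ultimately show ?case using Suc by (auto simp: tcd_Suc)
qed

lemma smooth_shift: "smooth g \<Longrightarrow> smooth (\<lambda>y. g (y + c))"
  by (simp add: smooth_def tcd_shift)

lemma dd_shift: "smooth g \<Longrightarrow> dd v (\<lambda>y. g (y + c)) y = dd v g (y + c)"
  by (rule dd_eqI, rule has_derivative_compose[of "\<lambda>y. y + c" "\<lambda>v. v"])
    (auto intro!: smooth_has_dd derivative_eq_intros)

text \<open>The mean value theorem is applied to the increment in direction \<open>w\<close> and
  again to its derivative. The left side is symmetric in \<open>v\<close> and \<open>w\<close>, so
  reading it both ways compares the two mixed derivatives.\<close>

lemma second_difference:
  fixes f :: "'a::real_normed_vector \<Rightarrow> real"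
  assumes f: "smooth f" and h: "h > 0"
  obtains s t where "0 < s" "s < h" "0 < t" "t < h"
    "f (x + h *\<^sub>R v + h *\<^sub>R w) - f (x + h *\<^sub>R v) - f (x + h *\<^sub>R w) + f x
      = h * h * dd w (dd v f) (x + s *\<^sub>R v + t *\<^sub>R w)"
proof -
  have s: "smooth (\<lambda>y. f (y + h *\<^sub>R w))" by (rule smooth_shift[OF f])
  have dds: "dd v (\<lambda>y. f (y + h *\<^sub>R w)) y = dd v f (y + h *\<^sub>R w)" for y by (rule dd_shift[OF f])
  let ?p = "\<lambda>y. f (y + h *\<^sub>R w) - f y"
  have "smooth ?p" by (intro smooth_diff s f)
  from smooth_line_mvt[OF this h, of x v] obtain a where a: "0 < a" "a < h"
    "?p (x + h *\<^sub>R v) - ?p x = h * dd v ?p (x + a *\<^sub>R v)" by blast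
  have "dd v ?p (x + a *\<^sub>R v) = dd v f (x + a *\<^sub>R v + h *\<^sub>R w) - dd v f (x + a *\<^sub>R v)"
    using dds by (simp add: dd_diff smooth_differentiable s f)
  moreover from smooth_line_mvt[OF smooth_dd[OF f] h, of v "x + a *\<^sub>R v" w] obtain b where b: "0 < b" "b < h"
    "dd v f (x + a *\<^sub>R v + h *\<^sub>R w) - dd v f (x + a *\<^sub>R v) = h * dd w (dd v f) (x + a *\<^sub>R v + b *\<^sub>R w)" by blast
  ultimately show thesis using a b by (intro that[of a b]) (auto simp: algebra_simps)
qed

lemma dd_commute_real:
  fixes f :: "'a::real_normed_vector \<Rightarrow> real"
  assumes f: "smooth f"
  shows "dd w (dd v f) x = dd v (dd w f) x"
proof (rule ccontr)
  let ?A = "dd w (dd v f)" and ?B = "dd v (dd w f)"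
  assume ne: "?A x \<noteq> ?B x"
  define e where "e = \<bar>?A x - ?B x\<bar> / 2"
  have e: "e > 0" using ne by (simp add: e_def)
  have "isCont ?A x" "isCont ?B x"
    using f by (auto intro!: smooth_continuous[of _ UNIV, unfolded continuous_on_eq_continuous_at[OF open_UNIV], rule_format] smooth_dd)
  then obtain d1 d2 where d: "d1 > 0" "d2 > 0"
    "\<And>y. dist y x < d1 \<Longrightarrow> dist (?A y) (?A x) < e" "\<And>y. dist y x < d2 \<Longrightarrow> dist (?B y) (?B x) < e"
    using e unfolding continuous_at_eps_delta by metis
  define h where "h = min d1 d2 / (norm v + norm w + 1)"
  have nn: "norm v + norm w + 1 > 0" by (simp add: add_nonneg_pos)
  have h: "h > 0" using d nn by (simp add: h_def)
  have bd: "norm (s *\<^sub>R v + t *\<^sub>R w) < min d1 d2" if "0 < s" "s < h" "0 < t" "t < h" for s t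
  proof -
    have "norm (s *\<^sub>R v + t *\<^sub>R w) \<le> h * norm v + h * norm w"
      using that by (intro order_trans[OF norm_triangle_ineq] add_mono) (auto intro: mult_right_mono)
    also have "\<dots> < h * (norm v + norm w + 1)" using h by (simp add: algebra_simps)
    also have "\<dots> = min d1 d2" using nn by (simp add: h_def)
    finally show ?thesis .
  qed
  obtain s t where st: "0 < s" "s < h" "0 < t" "t < h"
    "f (x + h *\<^sub>R v + h *\<^sub>R w) - f (x + h *\<^sub>R v) - f (x + h *\<^sub>R w) + f x = h * h * ?A (x + s *\<^sub>R v + t *\<^sub>R w)"
    by (rule second_difference[OF f h])
  obtain s' t' where st': "0 < s'" "s' < h" "0 < t'" "t' < h"
    "f (x + h *\<^sub>R w + h *\<^sub>R v) - f (x + h *\<^sub>R w) - f (x + h *\<^sub>R v) + f x = h * h * ?B (x + s' *\<^sub>R w + t' *\<^sub>R v)"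
    by (rule second_difference[OF f h])
  have "h * h * ?A (x + s *\<^sub>R v + t *\<^sub>R w) = h * h * ?B (x + s' *\<^sub>R w + t' *\<^sub>R v)"
    using st(5) st'(5) by (simp add: algebra_simps)
  then have eq: "?A (x + s *\<^sub>R v + t *\<^sub>R w) = ?B (x + s' *\<^sub>R w + t' *\<^sub>R v)" using h by simp
  have "dist (?A (x + s *\<^sub>R v + t *\<^sub>R w)) (?A x) < e"
    using bd[OF st(1-4)] by (intro d) (auto simp: dist_norm add.assoc)
  moreover have "dist (?B (x + s' *\<^sub>R w + t' *\<^sub>R v)) (?B x) < e"
    using bd[OF st'(3,4,1,2)] by (intro d) (auto simp: dist_norm add_ac)
  ultimately show False unfolding eq e_def dist_real_def by (simp add: abs_if split: if_splits)
qed

lemma dd_inner_const: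
  assumes "smooth f"
  shows "dd v (\<lambda>x. f x \<bullet> c) = (\<lambda>x. dd v f x \<bullet> c)"
  using assms by (auto simp: dd_simps)

lemma dd_commute:
  fixes f :: "'a::real_normed_vector \<Rightarrow> 'b::real_inner"
  assumes f: "smooth f"
  shows "dd w (dd v f) x = dd v (dd w f) x"
proof (rule vector_eq_ldot[THEN iffD1, rule_format])
  fix c
  have "dd w (dd v (\<lambda>x. f x \<bullet> c)) x = dd v (dd w (\<lambda>x. f x \<bullet> c)) x"
    by (intro dd_commute_real smooth_intros f)
  then have "dd w (dd v f) x \<bullet> c = dd v (dd w f) x \<bullet> c"
    using f by (simp add: dd_inner_const smooth_dd)
  then show "c \<bullet> dd w (dd v f) x = c \<bullet> dd v (dd w f) x" by (simp add: inner_commute)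
qed

section \<open>Derivatives along vector fields\<close>

definition vd :: "('a::real_normed_vector \<Rightarrow> 'a) \<Rightarrow> ('a \<Rightarrow> 'b::real_normed_vector) \<Rightarrow> 'a \<Rightarrow> 'b" where
  "vd X f x = dd (X x) f x"

text \<open>\<open>smooth\<close> speaks of constant directions; the expansion in a basis reduces a
  varying direction to them.\<close>

lemma vd_expand:
  fixes X :: "'a::euclidean_space \<Rightarrow> 'a"
  assumes "smooth f"
  shows "vd X f = (\<lambda>x. \<Sum>b\<in>Basis. (X x \<bullet> b) *\<^sub>R dd b f x)"
proof
  fix x
  have l: "linear (\<lambda>v. dd v f x)" by (intro dd_linear smooth_differentiable assms)
  have "dd (X x) f x = dd (\<Sum>b\<in>Basis. (X x \<bullet> b) *\<^sub>R b) f x" by (simp add: euclidean_representation)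
  also have "\<dots> = (\<Sum>b\<in>Basis. (X x \<bullet> b) *\<^sub>R dd b f x)"
    by (simp add: linear_sum[OF l] linear_cmul[OF l])
  finally show "vd X f x = (\<Sum>b\<in>Basis. (X x \<bullet> b) *\<^sub>R dd b f x)" by (simp add: vd_def)
qed

lemma smooth_sum: "finite I \<Longrightarrow> (\<And>i. i \<in> I \<Longrightarrow> smooth (f i)) \<Longrightarrow> smooth (\<lambda>x. \<Sum>i\<in>I. f i x)"
  by (induction I rule: finite_induct) (auto intro: smooth_intros)

lemma smooth_vd:
  fixes X :: "'a::euclidean_space \<Rightarrow> 'a"
  assumes "smooth X" "smooth f"
  shows "smooth (vd X f)"
  unfolding vd_expand[OF assms(2)] by (intro smooth_sum smooth_intros assms) auto

lemma dd_sum: "finite I \<Longrightarrow> (\<And>i. i \<in> I \<Longrightarrow> smooth (f i)) \<Longrightarrow> dd v (\<lambda>x. \<Sum>i\<in>I. f i x) x = (\<Sum>i\<in>I. dd v (f i) x)"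
  by (induction I rule: finite_induct) (auto simp: dd_simps smooth_sum)

text \<open>With the direction frozen at \<open>X x\<close> the two derivatives commute; the second
  term records the change of the field itself.\<close>

lemma dd_vd:
  fixes X :: "'a::euclidean_space \<Rightarrow> 'a" and f :: "'a \<Rightarrow> 'b::real_inner"
  assumes X: "smooth X" and f: "smooth f"
  shows "dd v (vd X f) x = dd v (dd (X x) f) x + dd (dd v X x) f x"
proof -
  have e: "vd (\<lambda>x. V) h x = (\<Sum>b\<in>Basis. (V \<bullet> b) *\<^sub>R dd b h x)" if "smooth h" for V x and h :: "'a \<Rightarrow> 'b"
    unfolding vd_expand[OF that] ..
  have "dd v (vd X f) x = (\<Sum>b\<in>Basis. (dd v X x \<bullet> b) *\<^sub>R dd b f x) + (\<Sum>b\<in>Basis. (X x \<bullet> b) *\<^sub>R dd v (dd b f) x)"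
    unfolding vd_expand[OF f]
    by (subst dd_sum) (auto simp: dd_simps X f sum.distrib intro!: smooth_intros X f)
  also have "(\<Sum>b\<in>Basis. (X x \<bullet> b) *\<^sub>R dd v (dd b f) x) = (\<Sum>b\<in>Basis. (X x \<bullet> b) *\<^sub>R dd b (dd v f) x)"
    by (rule sum.cong) (auto simp: dd_commute[OF f])
  also have "\<dots> = dd (X x) (dd v f) x"
    using e[OF smooth_dd[OF f], of "X x" v x] by (simp add: vd_def)
  also have "\<dots> = dd v (dd (X x) f) x" by (rule dd_commute[OF f])
  also have "(\<Sum>b\<in>Basis. (dd v X x \<bullet> b) *\<^sub>R dd b f x) = dd (dd v X x) f x"
    using e[OF f, of "dd v X x" x] by (simp add: vd_def)
  finally show ?thesis by simp
qed

text \<open>The second derivatives cancel by symmetry. What survives is the derivative along the Lie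
  bracket of \<open>X\<close> and \<open>Y\<close>, written out in linear coordinates.\<close>

lemma vd_commutator:
  fixes X Y :: "'a::euclidean_space \<Rightarrow> 'a" and f :: "'a \<Rightarrow> 'b::real_inner"
  assumes "smooth X" "smooth Y" "smooth f"
  shows "vd X (vd Y f) x - vd Y (vd X f) x = dd (vd X Y x - vd Y X x) f x"
proof -
  have "vd X (vd Y f) x - vd Y (vd X f) x = dd (dd (X x) Y x) f x - dd (dd (Y x) X x) f x"
    unfolding vd_def[of X "vd Y f"] vd_def[of Y "vd X f"] dd_vd[OF assms(2,3)] dd_vd[OF assms(1,3)]
      dd_commute[OF assms(3), of "X x" "Y x" x] by simp
  also have "\<dots> = dd (vd X Y x - vd Y X x) f x"
    by (simp add: dd_vdiff smooth_differentiable[OF assms(3)] vd_def)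
  finally show ?thesis .
qed

lemma vd_const: "vd X (\<lambda>x. c) x = 0" by (simp add: vd_def dd_const)
lemma vd_add: "smooth f \<Longrightarrow> smooth g \<Longrightarrow> vd X (\<lambda>x. f x + g x) x = vd X f x + vd X g x"
  and vd_diff: "smooth f \<Longrightarrow> smooth g \<Longrightarrow> vd X (\<lambda>x. f x - g x) x = vd X f x - vd X g x"
  and vd_minus: "smooth f \<Longrightarrow> vd X (\<lambda>x. - f x) x = - vd X f x"
  by (simp_all add: vd_def dd_add dd_diff dd_minus smooth_differentiable)
lemma vd_bilinear: assumes "bounded_bilinear B"
  shows "smooth f \<Longrightarrow> smooth g \<Longrightarrow> vd X (\<lambda>x. B (f x) (g x)) x = B (vd X f x) (g x) + B (f x) (vd X g x)"
  by (simp add: vd_def dd_bilinear[OF assms] smooth_differentiable)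
lemmas vd_mult = vd_bilinear[OF bounded_bilinear_mult]
lemmas vd_scaleR = vd_bilinear[OF bounded_bilinear_scaleR]
lemmas vd_inner = vd_bilinear[OF bounded_bilinear_inner]
lemmas vd_simps = vd_const vd_add vd_diff vd_minus vd_mult vd_scaleR vd_inner smooth_const smooth_add smooth_diff
  smooth_minus smooth_mult smooth_scaleR smooth_inner

lemma smooth_DERIV: "smooth \<phi> \<Longrightarrow> (\<phi> has_real_derivative deriv \<phi> s) (at s)" for \<phi> :: "real \<Rightarrow> real"
  using smooth_differentiable[of \<phi> s] by (simp add: DERIV_deriv_iff_real_differentiable)

lemma smooth_deriv:
  fixes \<phi> :: "real \<Rightarrow> real"
  assumes "smooth \<phi>"
  shows "smooth (deriv \<phi>)"
proof -
  have "dd 1 \<phi> s = 1 * deriv \<phi> s" for s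
    by (rule dd_eqI) (use smooth_DERIV[OF assms, of s] in \<open>simp add: has_field_derivative_def mult_commute_abs\<close>)
  then have "deriv \<phi> = dd 1 \<phi>" by auto
  then show ?thesis using smooth_dd[OF assms] by simp
qed

text \<open>Four orthonormal vectors span the space by a dimension count, and the remainder
  \<open>r\<close> is orthogonal to all of them, hence to itself.\<close>

lemma orthonormal4_expand:
  fixes a b c d z :: "real ^ 4"
  assumes "norm a = 1" "norm b = 1" "norm c = 1" "norm d = 1"
    "a \<bullet> b = 0" "a \<bullet> c = 0" "a \<bullet> d = 0" "b \<bullet> c = 0" "b \<bullet> d = 0" "c \<bullet> d = 0"
  shows "z = (z \<bullet> a) *\<^sub>R a + (z \<bullet> b) *\<^sub>R b + (z \<bullet> c) *\<^sub>R c + (z \<bullet> d) *\<^sub>R d"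
proof -
  let ?S = "{a, b, c, d}"
  have nz: "a \<noteq> 0" "b \<noteq> 0" "c \<noteq> 0" "d \<noteq> 0" using assms(1-4) by auto
  have dist: "a \<noteq> b" "a \<noteq> c" "a \<noteq> d" "b \<noteq> c" "b \<noteq> d" "c \<noteq> d"
    using assms nz by auto
  have po: "pairwise orthogonal ?S"
    using assms(5-10) by (auto simp: pairwise_insert orthogonal_def inner_commute)
  then have ind: "independent ?S" by (rule pairwise_orthogonal_independent) (use nz in auto)
  have card: "card ?S = 4" using dist by simp
  have span: "span ?S = UNIV"
    using card_eq_dim[of ?S UNIV] ind card by (auto simp: dim_UNIV)
  define r where "r = z - ((z \<bullet> a) *\<^sub>R a + (z \<bullet> b) *\<^sub>R b + (z \<bullet> c) *\<^sub>R c + (z \<bullet> d) *\<^sub>R d)"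
  have n1: "a \<bullet> a = 1" "b \<bullet> b = 1" "c \<bullet> c = 1" "d \<bullet> d = 1" using assms(1-4) by (simp_all add: norm_eq_1)
  have "b \<bullet> a = 0" "c \<bullet> a = 0" "d \<bullet> a = 0" "c \<bullet> b = 0" "d \<bullet> b = 0" "d \<bullet> c = 0"
    using assms(5-10) by (simp_all add: inner_commute)
  then have "orthogonal r y" if "y \<in> ?S" for y
    using that n1 assms(5-10) unfolding r_def orthogonal_def by (auto simp: inner_diff_left inner_add_left)
  then have "orthogonal r r"
    using orthogonal_to_span[of r ?S r] unfolding span by blast
  then show ?thesis by (simp add: orthogonal_def r_def)
qed

section \<open>Orthonormal frames on a surface in the sphere\<close>

text \<open>Differentiating a constant inner product moves the derivative from one factor to the
  other with a sign. The structure equations of the frame are read off from this.\<close>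

lemma dd_inner_eq_0:
  assumes "smooth p" "smooth q" "\<And>x. p x \<bullet> q x = c"
  shows "dd v p x \<bullet> q x = - (p x \<bullet> dd v q x)"
proof -
  have "dd v (\<lambda>x. p x \<bullet> q x) x = 0" using assms(3) by (simp add: dd_const)
  then show ?thesis using assms(1,2) by (simp add: dd_inner smooth_differentiable)
qed

text \<open>The vector fields \<open>X, Y\<close> on the parameter plane are chosen so that their images \<open>e1, e2\<close> are orthonormal.
  In this frame \<open>h11, h12, h22\<close> is the second fundamental form, and \<open>g, k\<close> is the connection form.\<close>

locale sphere_frame =
  fixes f n :: "real ^ 2 \<Rightarrow> real ^ 4" and X Y :: "real ^ 2 \<Rightarrow> real ^ 2"
  assumes sm: "smooth f" "smooth n" "smooth X" "smooth Y"
    and ff: "\<And>x. f x \<bullet> f x = 1" and nn: "\<And>x. n x \<bullet> n x = 1" and nf: "\<And>x. n x \<bullet> f x = 0"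
    and ndf: "\<And>v x. n x \<bullet> dd v f x = 0"
    and e11: "\<And>x. vd X f x \<bullet> vd X f x = 1" and e22: "\<And>x. vd Y f x \<bullet> vd Y f x = 1"
    and e12: "\<And>x. vd X f x \<bullet> vd Y f x = 0"
    and inj: "\<And>v x. dd v f x = 0 \<Longrightarrow> v = 0"
begin

abbreviation "e1 \<equiv> vd X f"
abbreviation "e2 \<equiv> vd Y f"
definition "h11 x = vd X n x \<bullet> e1 x"
definition "h12 x = vd X n x \<bullet> e2 x"
definition "h22 x = vd Y n x \<bullet> e2 x"
definition "g x = vd X e1 x \<bullet> e2 x"
definition "k x = vd Y e1 x \<bullet> e2 x"

lemma sme: "smooth e1" "smooth e2" by (intro smooth_vd sm)+
lemma smh: "smooth h11" "smooth h12" "smooth h22" "smooth g" "smooth k"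
  unfolding h11_def[abs_def] h12_def[abs_def] h22_def[abs_def] g_def[abs_def] k_def[abs_def]
  by (intro smooth_inner smooth_vd sm)+

lemma fdf: "f x \<bullet> dd v f x = 0"
  using dd_inner_eq_0[OF sm(1) sm(1), of 1 v x] ff by (simp add: inner_commute)

lemma ndn: "n x \<bullet> dd v n x = 0"
  using dd_inner_eq_0[OF sm(2) sm(2), of 1 v x] nn by (simp add: inner_commute)

lemma fdn: "f x \<bullet> dd v n x = 0"
  using dd_inner_eq_0[OF sm(2) sm(1), of 0 v x] nf ndf by (simp add: inner_commute)

lemma ne: "n x \<bullet> e1 x = 0" "n x \<bullet> e2 x = 0" "f x \<bullet> e1 x = 0" "f x \<bullet> e2 x = 0"
  by (simp_all add: vd_def ndf fdf)

lemmas ortho = ff nn nf e11 e22 e12 ne nf[simplified inner_commute[of "n _"]] e12[simplified inner_commute[of "vd X f _"]]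
  ne[simplified inner_commute[of "n _"]]  ne[simplified inner_commute[of "f _"]]

lemma expand: "z = (z \<bullet> f x) *\<^sub>R f x + (z \<bullet> e1 x) *\<^sub>R e1 x + (z \<bullet> e2 x) *\<^sub>R e2 x + (z \<bullet> n x) *\<^sub>R n x"
  by (rule orthonormal4_expand) (simp_all add: norm_eq_1 ortho)

lemma dd_swap:
  "dd v e1 x \<bullet> f x = - (e1 x \<bullet> dd v f x)" "dd v e2 x \<bullet> f x = - (e2 x \<bullet> dd v f x)"
  "dd v e1 x \<bullet> n x = - (e1 x \<bullet> dd v n x)" "dd v e2 x \<bullet> n x = - (e2 x \<bullet> dd v n x)"
  "dd v e1 x \<bullet> e1 x = 0" "dd v e2 x \<bullet> e2 x = 0" "dd v e2 x \<bullet> e1 x = - (dd v e1 x \<bullet> e2 x)"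
  using dd_inner_eq_0[OF sme(1) sm(1), of 0 v x] dd_inner_eq_0[OF sme(2) sm(1), of 0 v x]
    dd_inner_eq_0[OF sme(1) sm(2), of 0 v x] dd_inner_eq_0[OF sme(2) sm(2), of 0 v x]
    dd_inner_eq_0[OF sme(1) sme(1), of 1 v x] dd_inner_eq_0[OF sme(2) sme(2), of 1 v x]
    dd_inner_eq_0[OF sme(2) sme(1), of 0 v x]
  by (simp_all add: ortho inner_commute)

text \<open>The bracket of \<open>X\<close> and \<open>Y\<close> is a direction in the parameter
  plane, so its image under the differential of \<open>f\<close> is orthogonal to
  \<open>n\<close>.\<close>

lemma h12_sym: "vd Y n x \<bullet> e1 x = h12 x"
proof -
  have "(vd X e2 x - vd Y e1 x) \<bullet> n x = 0"
    using vd_commutator[OF sm(3,4,1), of x] ndf by (simp add: inner_commute)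
  then show ?thesis
    using dd_swap(4)[of "X x" x] dd_swap(3)[of "Y x" x] by (simp add: h12_def vd_def inner_diff_left inner_diff_right inner_commute)
qed

lemma D1n: "vd X n x = h11 x *\<^sub>R e1 x + h12 x *\<^sub>R e2 x"
  using expand[of "vd X n x" x] fdn[of x "X x"] ndn[of x "X x"]
  by (simp add: h11_def h12_def inner_commute vd_def[of X n])

lemma D2n: "vd Y n x = h12 x *\<^sub>R e1 x + h22 x *\<^sub>R e2 x"
  using expand[of "vd Y n x" x] fdn[of x "Y x"] ndn[of x "Y x"] h12_sym[of x]
  by (simp add: h22_def inner_commute vd_def[of Y n])

lemma D1e1: "vd X e1 x = - f x - h11 x *\<^sub>R n x + g x *\<^sub>R e2 x"
  by (subst expand[of "vd X e1 x" x])
   (use dd_swap[of "X x" x] in \<open>simp add: g_def h11_def inner_commute ortho vd_def[symmetric]\<close>)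

lemma D2e1: "vd Y e1 x = - h12 x *\<^sub>R n x + k x *\<^sub>R e2 x"
  by (subst expand[of "vd Y e1 x" x])
   (use dd_swap[of "Y x" x] h12_sym[of x] in \<open>simp add: k_def inner_commute ortho vd_def[symmetric]\<close>)

lemma D1e2: "vd X e2 x = - h12 x *\<^sub>R n x - g x *\<^sub>R e1 x"
  by (subst expand[of "vd X e2 x" x])
   (use dd_swap[of "X x" x] in \<open>simp add: g_def h12_def inner_commute ortho vd_def[symmetric]\<close>)

lemma D2e2: "vd Y e2 x = - f x - h22 x *\<^sub>R n x - k x *\<^sub>R e1 x"
  by (subst expand[of "vd Y e2 x" x])
   (use dd_swap[of "Y x" x] in \<open>simp add: k_def h22_def inner_commute ortho vd_def[symmetric]\<close>)

text \<open>Injectivity of the differential pulls the expansion in \<open>e1\<close>,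
  \<open>e2\<close> back to the parameter plane, so that all derivatives are determined by those
  along \<open>X\<close> and \<open>Y\<close>.\<close>

lemma decomp: "v = (dd v f x \<bullet> e1 x) *\<^sub>R X x + (dd v f x \<bullet> e2 x) *\<^sub>R Y x"
proof -
  let ?u = "(dd v f x \<bullet> e1 x) *\<^sub>R X x + (dd v f x \<bullet> e2 x) *\<^sub>R Y x"
  have d: "f differentiable (at x)" by (intro smooth_differentiable sm)
  have "dd (v - ?u) f x = dd v f x - ((dd v f x \<bullet> e1 x) *\<^sub>R e1 x + (dd v f x \<bullet> e2 x) *\<^sub>R e2 x)"
    by (simp add: dd_vdiff dd_vadd dd_vscale d vd_def)
  also have "\<dots> = 0"
    using expand[of "dd v f x" x] fdf[of x v] ndf[of x v] by (simp add: inner_commute)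
  finally show ?thesis using inj by fastforce
qed

lemma dd_decomp:
  assumes "p differentiable (at x)"
  shows "dd v p x = (dd v f x \<bullet> e1 x) *\<^sub>R vd X p x + (dd v f x \<bullet> e2 x) *\<^sub>R vd Y p x"
  by (subst decomp[of v x]) (simp add: vd_def dd_vadd dd_vscale assms)

text \<open>The bracket is identified by its image under the differential of \<open>f\<close>, the
  difference of \<open>vd X e2\<close> and \<open>vd Y e1\<close>: the normal parts cancel and the
  connection coefficients remain.\<close>

lemma commutator:
  assumes p: "smooth (p :: real ^ 2 \<Rightarrow> 'b::real_inner)"
  shows "vd X (vd Y p) x - vd Y (vd X p) x = - g x *\<^sub>R vd X p x - k x *\<^sub>R vd Y p x"
proof -
  let ?v = "vd X Y x - vd Y X x"
  have "dd ?v f x = vd X e2 x - vd Y e1 x" using vd_commutator[OF sm(3,4,1), of x] by simp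
  then have v: "dd ?v f x = - g x *\<^sub>R e1 x - k x *\<^sub>R e2 x" by (simp add: D1e2 D2e1)
  have "vd X (vd Y p) x - vd Y (vd X p) x = dd ?v p x" by (rule vd_commutator[OF sm(3,4) p])
  also have "\<dots> = (dd ?v f x \<bullet> e1 x) *\<^sub>R vd X p x + (dd ?v f x \<bullet> e2 x) *\<^sub>R vd Y p x"
    by (rule dd_decomp[OF smooth_differentiable[OF p]])
  finally show ?thesis unfolding v by (simp add: inner_diff_left ortho)
qed

text \<open>Both equations are tangential components of one vector identity, the commutator rule for
  \<open>n\<close>.\<close>

lemma codazzi:
  "vd Y h11 x - vd X h12 x = g x * (h11 x - h22 x) + 2 * k x * h12 x"
  "vd X h22 x - vd Y h12 x = k x * (h11 x - h22 x) - 2 * g x * h12 x"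
proof -
  have n1: "vd X n = (\<lambda>x. h11 x *\<^sub>R e1 x + h12 x *\<^sub>R e2 x)" and n2: "vd Y n = (\<lambda>x. h12 x *\<^sub>R e1 x + h22 x *\<^sub>R e2 x)"
    using D1n D2n by auto
  have a: "vd X (vd Y n) x = vd X h12 x *\<^sub>R e1 x + h12 x *\<^sub>R vd X e1 x + vd X h22 x *\<^sub>R e2 x + h22 x *\<^sub>R vd X e2 x"
    unfolding n2 by (simp add: vd_simps sm sme smh)
  have b: "vd Y (vd X n) x = vd Y h11 x *\<^sub>R e1 x + h11 x *\<^sub>R vd Y e1 x + vd Y h12 x *\<^sub>R e2 x + h12 x *\<^sub>R vd Y e2 x"
    unfolding n1 by (simp add: vd_simps sm sme smh)
  have c: "vd X (vd Y n) x - vd Y (vd X n) x = - g x *\<^sub>R vd X n x - k x *\<^sub>R vd Y n x" by (rule commutator[OF sm(2)])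
  have "(vd X (vd Y n) x - vd Y (vd X n) x) \<bullet> e1 x = (- g x *\<^sub>R vd X n x - k x *\<^sub>R vd Y n x) \<bullet> e1 x" using c by simp
  then show "vd Y h11 x - vd X h12 x = g x * (h11 x - h22 x) + 2 * k x * h12 x"
    unfolding a b by (simp add: D1n D2n D1e1 D1e2 D2e1 D2e2 inner_simps ortho algebra_simps)
  have "(vd X (vd Y n) x - vd Y (vd X n) x) \<bullet> e2 x = (- g x *\<^sub>R vd X n x - k x *\<^sub>R vd Y n x) \<bullet> e2 x" using c by simp
  then show "vd X h22 x - vd Y h12 x = k x * (h11 x - h22 x) - 2 * g x * h12 x"
    unfolding a b by (simp add: D1n D2n D1e1 D1e2 D2e1 D2e2 inner_simps ortho algebra_simps)
qed

text \<open>This is the \<open>e2\<close> component of the commutator rule for \<open>e1\<close>;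
  the constant 1 is the curvature of the ambient sphere.\<close>

lemma gauss: "vd Y g x - vd X k x = 1 + h11 x * h22 x - (h12 x)\<^sup>2 + (g x)\<^sup>2 + (k x)\<^sup>2"
proof -
  have n1: "vd X e1 = (\<lambda>x. - f x - h11 x *\<^sub>R n x + g x *\<^sub>R e2 x)" and n2: "vd Y e1 = (\<lambda>x. k x *\<^sub>R e2 x - h12 x *\<^sub>R n x)"
    using D1e1 D2e1 by auto
  have a: "vd X (vd Y e1) x = - vd X h12 x *\<^sub>R n x - h12 x *\<^sub>R vd X n x + vd X k x *\<^sub>R e2 x + k x *\<^sub>R vd X e2 x"
    unfolding n2 by (simp add: vd_simps sm sme smh)
  have b: "vd Y (vd X e1) x = - e2 x - vd Y h11 x *\<^sub>R n x - h11 x *\<^sub>R vd Y n x + vd Y g x *\<^sub>R e2 x + g x *\<^sub>R vd Y e2 x"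
    unfolding n1 by (simp add: vd_simps sm sme smh)
  have c: "vd X (vd Y e1) x - vd Y (vd X e1) x = - g x *\<^sub>R vd X e1 x - k x *\<^sub>R vd Y e1 x" by (rule commutator[OF sme(1)])
  have "(vd X (vd Y e1) x - vd Y (vd X e1) x) \<bullet> e2 x = (- g x *\<^sub>R vd X e1 x - k x *\<^sub>R vd Y e1 x) \<bullet> e2 x" using c by simp
  then show ?thesis
    unfolding a b by (simp add: D1n D2n D1e1 D1e2 D2e1 D2e2 inner_simps ortho power2_eq_square algebra_simps)
qed

end

section \<open>Zeros of solutions of a Beltrami-type inequality\<close>

lemma dd_arctan: "dd v arctan x = v * inverse (1 + x * x)" for v x :: real
proof -
  have "(arctan has_derivative (\<lambda>v. v * inverse (1 + x * x))) (at x)"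
    using DERIV_arctan[of x] unfolding has_field_derivative_def by (simp add: power2_eq_square mult_commute_abs)
  then show ?thesis by (rule dd_eqI)
qed

lemma smooth_id_real: "smooth (\<lambda>x::real. x)"
proof (rule smoothI)
  fix v :: real
  have "dd v (\<lambda>x::real. x) = (\<lambda>x. v)" by (rule ext, rule dd_eqI) auto
  then show "smooth (dd v (\<lambda>x::real. x))" by (simp add: smooth_const)
qed simp

lemma smooth_arctan: "smooth (arctan :: real \<Rightarrow> real)"
proof (rule smoothI)
  show "arctan differentiable (at x)" for x :: real
    using DERIV_arctan[of x] has_field_derivative_def differentiableI by blast
  have nz: "1 + x * x \<noteq> 0" for x :: real using add_pos_nonneg[of 1 "x * x"] by simp
  show "smooth (dd v arctan)" for v :: real
    unfolding dd_arctan[abs_def] by (intro smooth_intros smooth_inverse nz smooth_id_real)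
qed

section \<open>Integrals over squares of the parameter plane\<close>

abbreviation p1 :: "real ^ 2" where "p1 \<equiv> axis 1 1"
abbreviation p2 :: "real ^ 2" where "p2 \<equiv> axis 2 1"
abbreviation pt :: "real \<Rightarrow> real \<Rightarrow> real ^ 2" where "pt s t \<equiv> s *\<^sub>R p1 + t *\<^sub>R p2"

text \<open>The half-width is variable because a square made of many periods is needed to contain a
  fan of rays from the origin; exact terms still integrate to zero over it.\<close>

definition boxint :: "real \<Rightarrow> (real ^ 2 \<Rightarrow> real) \<Rightarrow> real" where
  "boxint L \<phi> = integral {-L..L} (\<lambda>s. integral {-L..L} (\<lambda>t. \<phi> (pt s t)))"

lemma inner_integral_cont:
  assumes "continuous_on UNIV (\<phi> :: real ^ 2 \<Rightarrow> real)"
  shows "continuous_on S (\<lambda>s. integral {c..d} (\<lambda>t. \<phi> (pt s t)))"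
    "(\<lambda>t. \<phi> (pt s t)) integrable_on {c..d}"
proof -
  have "continuous_on (S \<times> cbox c d) (\<lambda>(s, t). \<phi> (pt s t))"
    unfolding case_prod_unfold by (intro continuous_on_compose2[OF assms] continuous_intros) auto
  then show "continuous_on S (\<lambda>s. integral {c..d} (\<lambda>t. \<phi> (pt s t)))"
    using integral_continuous_on_param[of S c d "\<lambda>s t. \<phi> (pt s t)"] by simp
  show "(\<lambda>t. \<phi> (pt s t)) integrable_on {c..d}"
    by (intro integrable_continuous_interval continuous_on_compose2[OF assms] continuous_intros) auto
qed

lemma boxint_add:
  assumes "continuous_on UNIV \<phi>" "continuous_on UNIV \<theta>"
  shows "boxint L (\<lambda>x. c * \<phi> x + d * \<theta> x) = c * boxint L \<phi> + d * boxint L \<theta>"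
proof -
  have "integral {-L..L} (\<lambda>t. c * \<phi> (pt s t) + d * \<theta> (pt s t))
      = c * integral {-L..L} (\<lambda>t. \<phi> (pt s t)) + d * integral {-L..L} (\<lambda>t. \<theta> (pt s t))" for s
    by (subst integral_add) (auto intro!: integrable_on_cmult_left inner_integral_cont assms continuous_on_mult_left)
  then show ?thesis unfolding boxint_def
    by (simp, subst integral_add)
      (auto intro!: integrable_on_cmult_left integrable_continuous_interval inner_integral_cont assms continuous_on_mult_left)
qed

lemma boxint_mono:
  assumes "continuous_on UNIV \<phi>" "continuous_on UNIV \<theta>" "\<And>x. \<phi> x \<le> \<theta> x"
  shows "boxint L \<phi> \<le> boxint L \<theta>"
  unfolding boxint_def
  by (intro integral_le integrable_continuous_interval inner_integral_cont assms)

lemma boxint_swap: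
  assumes "continuous_on UNIV \<phi>"
  shows "boxint L \<phi> = integral {-L..L} (\<lambda>t. integral {-L..L} (\<lambda>s. \<phi> (pt s t)))"
proof -
  have "continuous_on (cbox (-L, -L) (L, L)) (\<lambda>(s, t). \<phi> (pt s t))"
    unfolding case_prod_unfold by (intro continuous_on_compose2[OF assms] continuous_intros) auto
  from integral_swap_continuous[OF this] show ?thesis by (simp add: boxint_def)
qed

text \<open>Each derivative is integrated in its own variable, where the boundary values agree by
  periodicity; for the first one the order of integration is exchanged.\<close>

lemma boxint_exact:
  assumes u: "smooth u" and v: "smooth v" and L: "L \<ge> 0"
    and pu: "\<And>x. u (x + (2 * L) *\<^sub>R p1) = u x" and pv: "\<And>x. v (x + (2 * L) *\<^sub>R p2) = v x"
  shows "boxint L (\<lambda>x. dd p1 u x - dd p2 v x) = 0"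
proof -
  have c: "continuous_on UNIV (dd p1 u)" "continuous_on UNIV (dd p2 v)"
    by (intro smooth_continuous smooth_dd u v)+
  have "((\<lambda>s. dd p1 u (pt s t)) has_integral (u (pt L t) - u (pt (-L) t))) {-L..L}" for t
  proof (rule fundamental_theorem_of_calculus)
    show "((\<lambda>s. u (pt s t)) has_vector_derivative dd p1 u (pt s t)) (at s within {- L..L})" for s
      using smooth_line[OF u, of "t *\<^sub>R p2" p1 s] by (simp add: add.commute)
  qed (use L in auto)
  moreover have "u (pt L t) = u (pt (-L) t)" for t
  proof -
    have "pt (-L) t + (2 * L) *\<^sub>R p1 = pt L t" by (simp add: vec_eq_iff forall_2 axis_def)
    then show ?thesis by (metis pu)
  qed
  ultimately have "integral {-L..L} (\<lambda>s. dd p1 u (pt s t)) = 0" for t by (simp add: integral_unique)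
  then have 1: "boxint L (dd p1 u) = 0" unfolding boxint_swap[OF c(1)] by simp
  have "((\<lambda>t. dd p2 v (pt s t)) has_integral (v (pt s L) - v (pt s (-L)))) {-L..L}" for s
  proof (rule fundamental_theorem_of_calculus)
    show "((\<lambda>t. v (pt s t)) has_vector_derivative dd p2 v (pt s t)) (at t within {- L..L})" for t
      using smooth_line[OF v, of "s *\<^sub>R p1" p2 t] by simp
  qed (use L in auto)
  moreover have "v (pt s L) = v (pt s (-L))" for s
  proof -
    have "pt s (-L) + (2 * L) *\<^sub>R p2 = pt s L" by (simp add: vec_eq_iff forall_2 axis_def)
    then show ?thesis by (metis pv)
  qed
  ultimately have "integral {-L..L} (\<lambda>t. dd p2 v (pt s t)) = 0" for s by (simp add: integral_unique)
  then have 2: "boxint L (dd p2 v) = 0" unfolding boxint_def by simp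
  show ?thesis using boxint_add[OF c, of L 1 "-1"] 1 2 by simp
qed

text \<open>Since \<open>1 / (a\<^sup>2 + b\<^sup>2 + e)\<close> times the area form of the plane is exact, so is its pullback
  under the map \<open>(a, b)\<close>.\<close>

lemma boxint_jacobian:
  assumes a: "smooth a" and b: "smooth b" and e: "e > 0" and L: "L \<ge> 0"
    and per: "\<And>x. a (x + (2 * L) *\<^sub>R p1) = a x" "\<And>x. b (x + (2 * L) *\<^sub>R p1) = b x"
      "\<And>x. a (x + (2 * L) *\<^sub>R p2) = a x" "\<And>x. b (x + (2 * L) *\<^sub>R p2) = b x"
  shows "boxint L (\<lambda>x. (dd p1 a x * dd p2 b x - dd p2 a x * dd p1 b x) / ((a x)\<^sup>2 + (b x)\<^sup>2 + e)) = 0"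
proof -
  define c where "c x = inverse (sqrt (b x * b x + e))" for x
  have pos: "b x * b x + e > 0" for x using e by (simp add: add_nonneg_pos)
  have sq: "sqrt (b x * b x + e) \<noteq> 0" for x using pos[of x] by simp
  have ss: "smooth (\<lambda>x. sqrt (b x * b x + e))" by (intro smooth_sqrt pos smooth_intros b)
  have sc: "smooth c" unfolding c_def[abs_def] by (intro smooth_inverse ss sq)
  \<comment> \<open>For fixed \<open>b\<close> this is the primitive of
    \<open>1 / (a\<^sup>2 + b\<^sup>2 + e)\<close> in the variable \<open>a\<close>, so the area
    form is the exterior derivative of \<open>P\<close> db.\<close>
  define P where "P x = arctan (a x * c x) * c x" for x
  have sP: "smooth P" unfolding P_def[abs_def] by (intro smooth_mult smooth_compose_real[OF smooth_arctan] a sc)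
  define r where "r x = - (c x * c x * c x * b x)" for x
  have dc: "dd w c x = r x * dd w b x" for w x
  proof -
    have "DERIV (\<lambda>y. inverse (sqrt (y * y + e))) (b x) :> r x"
      using pos[of x] unfolding r_def c_def
      by (auto intro!: derivative_eq_intros simp: field_simps power2_eq_square)
    from dd_compose_real[OF this smooth_differentiable[OF b]] show ?thesis unfolding c_def[abs_def] .
  qed
  \<comment> \<open>\<open>R\<close> is the partial derivative of \<open>P\<close> in the variable
    \<open>b\<close>. In the Jacobian it multiplies db wedge db and cancels.\<close>
  define R where "R x = a x * r x * c x / (1 + (a x * c x)\<^sup>2) + arctan (a x * c x) * r x" for x
  have dP: "dd w P x = dd w a x / ((a x)\<^sup>2 + (b x)\<^sup>2 + e) + R x * dd w b x" for w x
  proof -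
    have "dd w (\<lambda>x. arctan (a x * c x)) x = inverse (1 + (a x * c x)\<^sup>2) * dd w (\<lambda>x. a x * c x) x"
      by (intro dd_compose_real DERIV_arctan smooth_differentiable smooth_mult a sc)
    then have "dd w P x = inverse (1 + (a x * c x)\<^sup>2) * (dd w a x * c x + a x * dd w c x) * c x + arctan (a x * c x) * dd w c x"
      unfolding P_def[abs_def] using a sc
      by (simp add: dd_mult smooth_differentiable smooth_mult smooth_compose_real[OF smooth_arctan])
    also have "\<dots> = dd w a x * (c x * c x / (1 + (a x * c x)\<^sup>2)) + R x * dd w b x"
      unfolding dc R_def by (simp add: divide_inverse distrib_left distrib_right ac_simps)
    also have "c x * c x / (1 + (a x * c x)\<^sup>2) = 1 / ((a x)\<^sup>2 + (b x)\<^sup>2 + e)"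
    proof -
      have c2: "c x * c x = 1 / (b x * b x + e)" using pos[of x] by (simp add: c_def field_simps)
      then have "(a x * c x)\<^sup>2 = (a x)\<^sup>2 / (b x * b x + e)" by (metis (no_types, lifting) power2_eq_square mult.assoc mult.left_commute times_divide_eq_right mult.right_neutral power_mult_distrib)
      then show ?thesis unfolding c2 using pos[of x] e
        by (simp add: field_simps power2_eq_square)
    qed
    finally show ?thesis by simp
  qed
  let ?u = "\<lambda>x. P x * dd p2 b x" and ?v = "\<lambda>x. P x * dd p1 b x"
  have ddper: "dd w b (x + z) = dd w b x" if "\<And>x. b (x + z) = b x" for w x z
    using dd_shift[OF b, of w z x] that by simp
  have Pper: "P (x + z) = P x" if "a (x + z) = a x" "b (x + z) = b x" for x z
    using that by (simp add: P_def c_def)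
  have "boxint L (\<lambda>x. dd p1 ?u x - dd p2 ?v x) = 0"
  proof (rule boxint_exact[OF _ _ L])
    show "smooth ?u" "smooth ?v" by (intro smooth_mult sP smooth_dd b)+
  qed (simp_all add: per Pper ddper)
  moreover have "dd p1 ?u x - dd p2 ?v x = (dd p1 a x * dd p2 b x - dd p2 a x * dd p1 b x) / ((a x)\<^sup>2 + (b x)\<^sup>2 + e)" for x
    using dd_commute[OF b, of p1 p2 x]
    by (simp add: dd_mult sP b smooth_dd smooth_differentiable dP algebra_simps diff_divide_distrib)
  ultimately show ?thesis by simp
qed

section \<open>Logarithmic growth along a fan of rays\<close>

definition lat :: "int \<Rightarrow> int \<Rightarrow> real ^ 2" where
  "lat i j = pt (2 * pi * of_int i) (2 * pi * of_int j)"

lemma pt_components: "x = pt (x $ 1) (x $ 2)"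
  by (simp add: vec_eq_iff forall_2 axis_def)

text \<open>In the coordinates slope \<open>s\<close> and abscissa \<open>t\<close> the area element
  is \<open>t\<close> ds dt, which is why the density \<open>g\<close> enters with the factor
  \<open>t\<close>. After integration over the slopes the ray integrals amount to at most
  \<open>K * boxint L g\<close>, while \<open>1 / (2 * t)\<close> contributes a logarithm with the
  factor 1/2.\<close>

lemma fan_estimate:
  fixes g :: "real ^ 2 \<Rightarrow> real"
  assumes g: "continuous_on UNIV g" "\<And>x. g x \<ge> 0"
    and r: "0 < r" "r \<le> T" and sl: "s0 \<le> s1" and L: "T \<le> L" "T * \<bar>s0\<bar> \<le> L" "T * \<bar>s1\<bar> \<le> L"
    and K: "K \<ge> 0"
    and lo: "\<And>s. s \<in> {s0..s1} \<Longrightarrow> c \<le> integral {r..T} (\<lambda>t. K * t * g (pt t (t * s)) + 1 / (2 * t))"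
  shows "(s1 - s0) * c \<le> K * boxint L g + (s1 - s0) / 2 * (ln T - ln r)"
proof -
  define \<phi> where "\<phi> = (\<lambda>s t. K * t * g (pt t (t * s)) + 1 / (2 * t))"
  have gc: "continuous_on A (\<lambda>z. g (h z))" if "continuous_on A h" for A :: "'z::topological_space set" and h
    using continuous_on_compose2[OF g(1) that] by simp
  have cont: "continuous_on (cbox (s0, r) (s1, T)) (\<lambda>(s, t). \<phi> s t)"
    unfolding case_prod_unfold \<phi>_def using r by (intro continuous_intros gc) auto
  have "continuous_on ({s0..s1} \<times> cbox r T) (\<lambda>(s, t). \<phi> s t)"
    using cont by (simp add: cbox_Pair_eq)
  from integral_continuous_on_param[OF this] have ci: "continuous_on {s0..s1} (\<lambda>s. integral {r..T} (\<phi> s))" by simp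
  have "continuous_on (cbox r T \<times> cbox s0 s1) (\<lambda>(t, s). \<phi> s t)"
    unfolding case_prod_unfold \<phi>_def using r by (intro continuous_intros gc) auto
  from integral_continuous_on_param[OF this] have ci2: "continuous_on {r..T} (\<lambda>t. integral {s0..s1} (\<lambda>s. \<phi> s t))" by simp
  have "(s1 - s0) * c = integral {s0..s1} (\<lambda>s. c)" using sl by simp
  also have "\<dots> \<le> integral {s0..s1} (\<lambda>s. integral {r..T} (\<phi> s))"
    using lo by (intro integral_le integrable_continuous_interval ci) (auto simp: \<phi>_def)
  also have "\<dots> = integral {r..T} (\<lambda>t. integral {s0..s1} (\<lambda>s. \<phi> s t))"
    using integral_swap_continuous[OF cont] by simp
  also have "\<dots> \<le> integral {r..T} (\<lambda>t. K * integral {-L..L} (\<lambda>y. g (pt t y)) + (s1 - s0) / 2 * (1 / t))"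
  proof (intro integral_le integrable_continuous_interval ci2)
    show "continuous_on {r..T} (\<lambda>t. K * integral {- L..L} (\<lambda>y. g (pt t y)) + (s1 - s0) / 2 * (1 / t))"
      using r by (intro continuous_intros inner_integral_cont g) auto
    fix t assume t: "t \<in> {r..T}"
    then have t0: "t > 0" using r by auto
    have "((\<lambda>y. g (pt t y)) has_integral integral {t * s0..t * s1} (\<lambda>y. g (pt t y))) {t * s0..t * s1}"
      by (intro integrable_integral inner_integral_cont g)
    \<comment> \<open>The substitution \<open>y = t * s\<close> consumes the factor \<open>t\<close>
      of the area element.\<close>
    from has_integral_stretch_real[OF this, of t] t0
    have "((\<lambda>s. g (pt t (t * s))) has_integral integral {t * s0..t * s1} (\<lambda>y. g (pt t y)) / t) ((\<lambda>x. x / t) ` {t * s0..t * s1})"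
      by simp
    moreover have "(\<lambda>x. x / t) ` {t * s0..t * s1} = {s0..s1}"
    proof -
      have "(\<lambda>x. x / t) ` {t * s0..t * s1} = (\<lambda>x. (1 / t) * x) ` {t * s0..t * s1}" by simp
      also have "\<dots> = {s0..s1}" using t0 sl by (subst image_mult_atLeastAtMost) auto
      finally show ?thesis .
    qed
    ultimately have i: "((\<lambda>s. g (pt t (t * s))) has_integral integral {t * s0..t * s1} (\<lambda>y. g (pt t y)) / t) {s0..s1}" by simp
    have "((\<lambda>s. \<phi> s t) has_integral (K * t * (integral {t * s0..t * s1} (\<lambda>y. g (pt t y)) / t) + (s1 - s0) * (1 / (2 * t)))) {s0..s1}"
      unfolding \<phi>_def using sl has_integral_const_real[of "1 / (2 * t)" s0 s1] by (intro has_integral_add has_integral_mult_right i) auto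
    then have "integral {s0..s1} (\<lambda>s. \<phi> s t) = K * integral {t * s0..t * s1} (\<lambda>y. g (pt t y)) + (s1 - s0) * (1 / (2 * t))"
      using t0 by (simp add: integral_unique)
    moreover have "integral {t * s0..t * s1} (\<lambda>y. g (pt t y)) \<le> integral {-L..L} (\<lambda>y. g (pt t y))"
    proof (rule integral_subset_le)
      have "\<bar>t * s0\<bar> \<le> L" "\<bar>t * s1\<bar> \<le> L"
        using t t0 L(2,3) mult_right_mono[of t T "\<bar>s0\<bar>"] mult_right_mono[of t T "\<bar>s1\<bar>"] by (auto simp: abs_mult)
      then show "{t * s0..t * s1} \<subseteq> {-L..L}" by auto
    qed (auto intro!: inner_integral_cont g)
    ultimately show "integral {s0..s1} (\<lambda>s. \<phi> s t) \<le> K * integral {-L..L} (\<lambda>y. g (pt t y)) + (s1 - s0) / 2 * (1 / t)"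
      using mult_left_mono[OF _ K, of "integral {t * s0..t * s1} (\<lambda>y. g (pt t y))" "integral {-L..L} (\<lambda>y. g (pt t y))"] by simp
  qed
  also have "\<dots> = K * integral {r..T} (\<lambda>t. integral {-L..L} (\<lambda>y. g (pt t y))) + (s1 - s0) / 2 * (ln T - ln r)"
  proof -
    have "((\<lambda>t. 1 / t) has_integral (ln T - ln r)) {r..T}"
      using r by (intro fundamental_theorem_of_calculus)
        (auto intro!: derivative_eq_intros simp: has_real_derivative_iff_has_vector_derivative[symmetric] divide_inverse)
    then have "((\<lambda>t. K * integral {-L..L} (\<lambda>y. g (pt t y)) + (s1 - s0) / 2 * (1 / t)) has_integral
      (K * integral {r..T} (\<lambda>t. integral {-L..L} (\<lambda>y. g (pt t y))) + (s1 - s0) / 2 * (ln T - ln r))) {r..T}"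
      by (intro has_integral_add has_integral_mult_right integrable_integral integrable_continuous_interval inner_integral_cont g)
    then show ?thesis by (rule integral_unique)
  qed
  also have "\<dots> \<le> K * boxint L g + (s1 - s0) / 2 * (ln T - ln r)"
  proof -
    have "integral {r..T} (\<lambda>t. integral {-L..L} (\<lambda>y. g (pt t y))) \<le> boxint L g"
      unfolding boxint_def using r L
      by (intro integral_subset_le integrable_continuous_interval inner_integral_cont g ballI integral_nonneg) (auto intro!: g inner_integral_cont)
    then show ?thesis using K by (simp add: mult_left_mono)
  qed
  finally show ?thesis .
qed

text \<open>The left side is the derivative of half the logarithm of
  \<open>A\<^sup>2 + B\<^sup>2 + e\<close> along a ray. Cauchy-Schwarz bounds its square by the
  energy density, and the arithmetic-geometric mean with weight \<open>t\<close> splits off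
  \<open>1 / (2 * t)\<close>. This produces only half of the logarithmic growth that a zero
  enforces.\<close>

lemma quotient_bound:
  fixes A B A' B' t e :: real
  assumes "t > 0" "e > 0" "A'\<^sup>2 + B'\<^sup>2 \<le> S * G"
  shows "(A * A' + B * B') / (A\<^sup>2 + B\<^sup>2 + e) \<le> S / 2 * t * (G / (A\<^sup>2 + B\<^sup>2 + e)) + 1 / (2 * t)"
proof -
  define W where "W = A\<^sup>2 + B\<^sup>2 + e"
  have W: "W > 0" using assms(2) by (simp add: W_def add_nonneg_pos)
  define q where "q = (A * A' + B * B') / W"
  have "(A * A' + B * B')\<^sup>2 \<le> (A\<^sup>2 + B\<^sup>2) * (A'\<^sup>2 + B'\<^sup>2)"
    using zero_le_power2[of "A * B' - B * A'"] by (simp add: power2_eq_square algebra_simps)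
  also have "\<dots> \<le> W * (S * G)"
    using assms by (intro mult_mono) (auto simp: W_def add_nonneg_nonneg)
  finally have "q\<^sup>2 \<le> S * G / W"
    using W by (simp add: q_def power_divide power2_eq_square divide_simps mult_ac)
  then have 1: "t / 2 * q\<^sup>2 \<le> t / 2 * (S * G / W)" using assms(1) by (intro mult_left_mono) auto
  have "0 \<le> (t * q - 1)\<^sup>2 / (2 * t)" using assms(1) by simp
  also have "\<dots> = t / 2 * q\<^sup>2 - q + 1 / (2 * t)" using assms(1) by (simp add: power2_eq_square field_simps)
  finally have "q \<le> t / 2 * (S * G / W) + 1 / (2 * t)" using 1 by linarith
  moreover have "t / 2 * (S * G / W) = S / 2 * t * (G / W)" by simp
  ultimately show ?thesis by (simp only: q_def W_def)
qed

text \<open>If \<open>(a, b)\<close> vanished at the origin but not identically, the logarithm of its norm would have finite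
  Dirichlet energy and yet tend to \<open>-\<infinity>\<close> at least as fast as \<open>ln \<bar>x\<bar>\<close>, which is impossible in
  two dimensions.\<close>

lemma zero_free_at_0:
  fixes a b :: "real ^ 2 \<Rightarrow> real"
  assumes a: "smooth a" and b: "smooth b"
    and per: "\<And>i j x. a (x + lat i j) = a x" "\<And>i j x. b (x + lat i j) = b x"
    and c: "c > 0" and C: "C \<ge> 0"
    and ineq: "\<And>x. dd p1 a x * dd p2 b x - dd p2 a x * dd p1 b x
       \<ge> c * ((dd p1 a x)\<^sup>2 + (dd p2 a x)\<^sup>2 + (dd p1 b x)\<^sup>2 + (dd p2 b x)\<^sup>2) - C * ((a x)\<^sup>2 + (b x)\<^sup>2)"
    and z0: "a 0 = 0" "b 0 = 0"
  shows "a z = 0 \<and> b z = 0"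
proof (rule ccontr)
  assume nz: "\<not> (a z = 0 \<and> b z = 0)"
  define W where "W x = (a x)\<^sup>2 + (b x)\<^sup>2" for x
  define G where "G x = (dd p1 a x)\<^sup>2 + (dd p2 a x)\<^sup>2 + (dd p1 b x)\<^sup>2 + (dd p2 b x)\<^sup>2" for x
  have ca: "continuous_on S a" "continuous_on S b" "continuous_on S (dd w a)" "continuous_on S (dd w b)" for S w
    by (intro smooth_continuous smooth_dd a b)+
  have comp: "continuous_on S (\<lambda>x. a (h x))" "continuous_on S (\<lambda>x. b (h x))"
    "continuous_on S (\<lambda>x. dd w a (h x))" "continuous_on S (\<lambda>x. dd w b (h x))" if "continuous_on S h"
    for S :: "'z::topological_space set" and h w
    by (rule continuous_on_compose2[OF ca(1)[of UNIV] that] continuous_on_compose2[OF ca(2)[of UNIV] that]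
        continuous_on_compose2[OF ca(3)[of UNIV] that] continuous_on_compose2[OF ca(4)[of UNIV] that], simp)+
  have cW: "continuous_on S W" and cG: "continuous_on S G" for S
    unfolding W_def[abs_def] G_def[abs_def] by (intro continuous_intros ca)+
  have W0: "W x \<ge> 0" and G0: "G x \<ge> 0" for x by (simp_all add: W_def G_def)
  \<comment> \<open>By periodicity the point with a nonzero value may be moved into the right half
    plane, where a ray of positive abscissa reaches it.\<close>
  obtain i :: int where i: "2 * pi * real_of_int i > - z $ 1"
    using reals_Archimedean3[of "2 * pi"] ex_less_of_int[of "- z $ 1 / (2 * pi)"] by (auto simp: field_simps)
  define z1 where "z1 = z + lat i 0"
  define T where "T = z1 $ 1"
  have T: "T > 0" using i by (simp add: T_def z1_def lat_def axis_def)
  define m where "m = W z1 / 2"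
  have m: "m > 0" using nz by (auto simp: m_def W_def z1_def per sum_power2_gt_zero_iff)
  define \<sigma> where "\<sigma> = z1 $ 2 / T"
  have z1: "z1 = pt T (T * \<sigma>)" using T pt_components[of z1] by (simp add: \<sigma>_def T_def)
  \<comment> \<open>A single ray carries no area. By continuity a whole interval of slopes leads at
    abscissa \<open>T\<close> to points with \<open>W\<close> at least \<open>m\<close>.\<close>
  have "isCont (\<lambda>s. W (pt T (T * s))) \<sigma>"
    using continuous_on_compose2[OF cW[of UNIV], of UNIV "\<lambda>s. pt T (T * s)"]
    by (auto intro!: continuous_intros simp: continuous_on_eq_continuous_at)
  then obtain \<delta>0 where d0: "\<delta>0 > 0" "\<And>s. dist s \<sigma> < \<delta>0 \<Longrightarrow> dist (W (pt T (T * s))) (W (pt T (T * \<sigma>))) < m"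
    using m unfolding continuous_at_eps_delta by blast
  define \<delta> where "\<delta> = \<delta>0 / 2"
  have d: "\<delta> > 0" using d0 by (simp add: \<delta>_def)
  let ?s0 = "\<sigma> - \<delta>" and ?s1 = "\<sigma> + \<delta>"
  have Wm: "W (pt T (T * s)) \<ge> m" if "s \<in> {?s0..?s1}" for s
  proof -
    have "dist (W (pt T (T * s))) (W z1) < m"
      unfolding z1 by (rule d0(2)) (use that d in \<open>auto simp: dist_real_def \<delta>_def abs_if\<close>)
    then show ?thesis by (auto simp: dist_real_def m_def abs_if field_simps split: if_splits)
  qed
  define S where "S = 1 + (\<bar>\<sigma>\<bar> + \<delta>)\<^sup>2"
  have S: "1 + s\<^sup>2 \<le> S" if "s \<in> {?s0..?s1}" for s
    unfolding S_def by (intro add_left_mono power2_le_iff_abs_le[THEN iffD2]) (use that d in auto)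
  \<comment> \<open>The square consists of whole periods and is large enough to contain the
    fan.\<close>
  obtain k :: nat where k: "real k * (2 * pi) > max T (T * (\<bar>\<sigma>\<bar> + \<delta>))"
    using reals_Archimedean3[of "2 * pi", rule_format, of "max T (T * (\<bar>\<sigma>\<bar> + \<delta>))"] pi_gt_zero by auto
  define L where "L = real k * (2 * pi)"
  have L: "T \<le> L" "T * \<bar>?s0\<bar> \<le> L" "T * \<bar>?s1\<bar> \<le> L" "0 \<le> L"
  proof -
    have "T * \<bar>?s0\<bar> \<le> T * (\<bar>\<sigma>\<bar> + \<delta>)" "T * \<bar>?s1\<bar> \<le> T * (\<bar>\<sigma>\<bar> + \<delta>)"
      using T d by (auto intro!: mult_left_mono)
    moreover have "T < L" "T * (\<bar>\<sigma>\<bar> + \<delta>) < L" using k by (simp_all add: L_def)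
    ultimately show "T \<le> L" "T * \<bar>?s0\<bar> \<le> L" "T * \<bar>?s1\<bar> \<le> L" "0 \<le> L" using T by linarith+
  qed
  have lat: "(2 * L) *\<^sub>R p1 = lat (2 * int k) 0" "(2 * L) *\<^sub>R p2 = lat 0 (2 * int k)"
    by (simp_all add: lat_def L_def mult_ac)
  \<comment> \<open>An energy bound independent of the regularization \<open>e\<close>: the Jacobian
    quotient integrates to zero, and \<open>W / (W + e)\<close> is at most 1.\<close>
  have bnd: "boxint L (\<lambda>x. G x / (W x + e)) \<le> C * (2 * L)\<^sup>2 / c" if e: "e > 0" for e
  proof -
    have pos: "W x + e > 0" for x using e W0[of x] by simp
    have ne: "W x + e \<noteq> 0" for x using pos[of x] by simp
    have cJ: "continuous_on UNIV (\<lambda>x. (dd p1 a x * dd p2 b x - dd p2 a x * dd p1 b x) / (W x + e))"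
      using ne by (intro continuous_intros ca cW) auto
    have c1: "continuous_on UNIV (\<lambda>x. G x / (W x + e))" using ne by (intro continuous_intros cG cW) auto
    have "boxint L (\<lambda>x. c * (G x / (W x + e)) + (- C) * 1)
       \<le> boxint L (\<lambda>x. (dd p1 a x * dd p2 b x - dd p2 a x * dd p1 b x) / (W x + e))"
    proof (rule boxint_mono)
      show "continuous_on UNIV (\<lambda>x. c * (G x / (W x + e)) + - C * 1)"
        using ne by (intro continuous_intros cG cW) auto
      fix x
      have "c * G x - C * (W x + e) \<le> c * G x - C * W x" using C e by (simp add: algebra_simps)
      also have "\<dots> \<le> dd p1 a x * dd p2 b x - dd p2 a x * dd p1 b x" using ineq[of x] by (simp add: G_def W_def)
      finally have "(c * G x - C * (W x + e)) / (W x + e) \<le> (dd p1 a x * dd p2 b x - dd p2 a x * dd p1 b x) / (W x + e)"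
        using pos[of x] by (intro divide_right_mono) auto
      then show "c * (G x / (W x + e)) + - C * 1 \<le> (dd p1 a x * dd p2 b x - dd p2 a x * dd p1 b x) / (W x + e)"
        using ne[of x] by (simp add: diff_divide_distrib)
    qed (rule cJ)
    also have "\<dots> = 0"
      using boxint_jacobian[OF a b e L(4)] by (simp add: lat per W_def add.assoc)
    also have "boxint L (\<lambda>x. c * (G x / (W x + e)) + (- C) * 1) = c * boxint L (\<lambda>x. G x / (W x + e)) + (- C) * boxint L (\<lambda>x. 1)"
      by (rule boxint_add[OF c1]) simp
    also have "boxint L (\<lambda>x. 1) = (2 * L)\<^sup>2" using L by (simp add: boxint_def power2_eq_square)
    finally show ?thesis using c by (simp add: field_simps)
  qed
  \<comment> \<open>The components are the derivatives of \<open>a\<close> and \<open>b\<close>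
    along the ray of slope \<open>s\<close>. Their bound on the compact fan shows that
    \<open>W\<close> is of order \<open>r\<^sup>2\<close> at abscissa \<open>r\<close>.\<close>
  define H where "H = (\<lambda>z. (dd p1 a (pt (fst z) (fst z * snd z)) + snd z * dd p2 a (pt (fst z) (fst z * snd z)),
    dd p1 b (pt (fst z) (fst z * snd z)) + snd z * dd p2 b (pt (fst z) (fst z * snd z))))"
  have "compact (H ` ({0..T} \<times> {?s0..?s1}))"
    unfolding H_def by (intro compact_continuous_image continuous_intros comp compact_Times compact_Icc)
  then obtain B where "\<forall>y \<in> H ` ({0..T} \<times> {?s0..?s1}). norm y \<le> B"
    using compact_imp_bounded bounded_iff by blast
  then have B: "norm (H (t, s)) \<le> B" if "t \<in> {0..T}" "s \<in> {?s0..?s1}" for t s using that by blast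
  have ddv: "dd (pt 1 s) \<phi> x = dd p1 \<phi> x + s * dd p2 \<phi> x" if "smooth \<phi>" for \<phi> :: "real ^ 2 \<Rightarrow> real" and s x
    using smooth_differentiable[OF that, of x] by (simp add: dd_vadd dd_vscale)
  have line: "t *\<^sub>R pt 1 s = pt t (t * s)" for t s by (simp add: scaleR_add_right)
  have Wr: "W (pt r (r * s)) \<le> 2 * B\<^sup>2 * r\<^sup>2" if r: "0 < r" "r \<le> T" and s: "s \<in> {?s0..?s1}" for r s
  proof -
    have *: "(\<phi> (pt r (r * s)))\<^sup>2 \<le> r\<^sup>2 * B\<^sup>2" if sp: "smooth \<phi>" and p0: "\<phi> 0 = 0"
      and bd: "\<And>t. t \<in> {0..T} \<Longrightarrow> \<bar>dd p1 \<phi> (pt t (t * s)) + s * dd p2 \<phi> (pt t (t * s))\<bar> \<le> B" for \<phi> :: "real ^ 2 \<Rightarrow> real"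
    proof -
      obtain t where t: "0 < t" "t < r" "\<phi> (0 + r *\<^sub>R pt 1 s) - \<phi> 0 = r * dd (pt 1 s) \<phi> (0 + t *\<^sub>R pt 1 s)"
        by (rule smooth_line_mvt[OF sp r(1)])
      then have "\<phi> (pt r (r * s)) = r * (dd p1 \<phi> (pt t (t * s)) + s * dd p2 \<phi> (pt t (t * s)))"
        unfolding line ddv[OF sp] add_0 p0 by simp
      moreover have "\<bar>dd p1 \<phi> (pt t (t * s)) + s * dd p2 \<phi> (pt t (t * s))\<bar> \<le> B" using t r by (intro bd) auto
      then have "(dd p1 \<phi> (pt t (t * s)) + s * dd p2 \<phi> (pt t (t * s)))\<^sup>2 \<le> B\<^sup>2" by (simp add: abs_le_square_iff[symmetric])
      ultimately show ?thesis by (simp add: power_mult_distrib mult_left_mono)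
    qed
    have "(a (pt r (r * s)))\<^sup>2 \<le> r\<^sup>2 * B\<^sup>2" "(b (pt r (r * s)))\<^sup>2 \<le> r\<^sup>2 * B\<^sup>2"
      using order_trans[OF norm_fst_le B[OF _ s, unfolded H_def]] order_trans[OF norm_snd_le B[OF _ s, unfolded H_def]]
      by (intro * a b z0; simp)+
    then show ?thesis by (simp add: W_def mult.commute[of _ "r\<^sup>2"])
  qed
  define M where "M = C * (2 * L)\<^sup>2 / c"
  have key: "\<delta> * (- ln r) \<le> S / 2 * M + \<delta> * ln T - \<delta> * ln m + \<delta> * ln (2 * B\<^sup>2 + 1)" if r: "0 < r" "r \<le> T" for r
  proof -
    \<comment> \<open>Coupling the regularization to the inner abscissa keeps
      \<open>ln (W + e)\<close> there below \<open>2 * ln r\<close> plus a constant. Each ray then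
      sees a growth of at least \<open>- ln r\<close> up to a constant, of which the fan estimate
      allows only half.\<close>
    define e where "e = r\<^sup>2"
    have e: "e > 0" using r by (simp add: e_def)
    have pos: "W x + e > 0" for x using e W0[of x] by simp
    have ne: "W x + e \<noteq> 0" for x using pos[of x] by simp
    define cr where "cr = (ln m - ln (2 * B\<^sup>2 + 1)) / 2 - ln r"
    have "(?s1 - ?s0) * cr \<le> S / 2 * boxint L (\<lambda>x. G x / (W x + e)) + (?s1 - ?s0) / 2 * (ln T - ln r)"
    proof (rule fan_estimate[OF _ _ r _ L(1-3)])
      show "continuous_on UNIV (\<lambda>x. G x / (W x + e))" using ne by (intro continuous_intros cG cW) auto
      show "0 \<le> G x / (W x + e)" for x using G0 pos[of x] by simp
      show "?s0 \<le> ?s1" using d by simp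
      show "0 \<le> S / 2" by (simp add: S_def)
      fix s assume s: "s \<in> {?s0..?s1}"
      define q where "q t = (a (pt t (t * s)) * dd (pt 1 s) a (pt t (t * s)) + b (pt t (t * s)) * dd (pt 1 s) b (pt t (t * s)))
          / ((a (pt t (t * s)))\<^sup>2 + (b (pt t (t * s)))\<^sup>2 + e)" for t
      have hi: "(q has_integral (ln (W (pt T (T * s)) + e) / 2 - ln (W (pt r (r * s)) + e) / 2)) {r..T}"
      proof (rule fundamental_theorem_of_calculus[OF r(2)])
        fix t assume "t \<in> {r..T}"
        have l: "((\<lambda>t. a (pt t (t * s))) has_vector_derivative dd (pt 1 s) a (pt t (t * s))) (at t within {r..T})"
          "((\<lambda>t. b (pt t (t * s))) has_vector_derivative dd (pt 1 s) b (pt t (t * s))) (at t within {r..T})"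
          using smooth_line[OF a, of 0 "pt 1 s" t] smooth_line[OF b, of 0 "pt 1 s" t] unfolding line by simp_all
        show "((\<lambda>t. ln (W (pt t (t * s)) + e) / 2) has_vector_derivative q t) (at t within {r..T})"
          using l pos[of "pt t (t * s)"] unfolding W_def q_def has_real_derivative_iff_has_vector_derivative[symmetric]
          by (auto intro!: derivative_eq_intros simp: power2_eq_square field_simps)
      qed
      have "cr \<le> ln (W (pt T (T * s)) + e) / 2 - ln (W (pt r (r * s)) + e) / 2"
      proof -
        have "ln m \<le> ln (W (pt T (T * s)) + e)" using Wm[OF s] m e by simp
        moreover have "ln (W (pt r (r * s)) + e) \<le> ln ((2 * B\<^sup>2 + 1) * r\<^sup>2)"
          using Wr[OF r s] pos[of "pt r (r * s)"] by (intro ln_mono) (auto simp: e_def algebra_simps)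
        moreover have "ln ((2 * B\<^sup>2 + 1) * r\<^sup>2) = ln (2 * B\<^sup>2 + 1) + 2 * ln r"
          using r add_nonneg_pos[of "2 * B\<^sup>2" 1] by (subst ln_mult) (auto simp: ln_realpow)
        ultimately show ?thesis by (simp add: cr_def field_simps)
      qed
      also have "\<dots> = integral {r..T} q" using hi by (simp add: integral_unique)
      also have "\<dots> \<le> integral {r..T} (\<lambda>t. S / 2 * t * (G (pt t (t * s)) / (W (pt t (t * s)) + e)) + 1 / (2 * t))"
      proof (rule integral_le)
        show "q integrable_on {r..T}" using hi by blast
        show "(\<lambda>t. S / 2 * t * (G (pt t (t * s)) / (W (pt t (t * s)) + e)) + 1 / (2 * t)) integrable_on {r..T}"
          using r ne unfolding G_def W_def by (intro integrable_continuous_interval continuous_intros comp) auto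
        fix t assume t: "t \<in> {r..T}"
        have cs: "(u + s * w)\<^sup>2 \<le> (1 + s\<^sup>2) * (u\<^sup>2 + w\<^sup>2)" for u w
          using zero_le_power2[of "w - s * u"] by (simp add: power2_eq_square algebra_simps)
        have "(dd (pt 1 s) a (pt t (t * s)))\<^sup>2 + (dd (pt 1 s) b (pt t (t * s)))\<^sup>2 \<le> (1 + s\<^sup>2) * G (pt t (t * s))"
          unfolding ddv[OF a] ddv[OF b]
          using add_mono[OF cs[of "dd p1 a (pt t (t * s))" "dd p2 a (pt t (t * s))"] cs[of "dd p1 b (pt t (t * s))" "dd p2 b (pt t (t * s))"]]
          by (simp add: G_def algebra_simps)
        also have "\<dots> \<le> S * G (pt t (t * s))" using S[OF s] G0 by (intro mult_right_mono) auto
        finally show "q t \<le> S / 2 * t * (G (pt t (t * s)) / (W (pt t (t * s)) + e)) + 1 / (2 * t)"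
          using quotient_bound[of t e] t r e unfolding q_def W_def by simp
      qed
      finally show "cr \<le> integral {r..T} (\<lambda>t. S / 2 * t * (G (pt t (t * s)) / (W (pt t (t * s)) + e)) + 1 / (2 * t))" .
    qed
    moreover have "S / 2 * boxint L (\<lambda>x. G x / (W x + e)) \<le> S / 2 * M"
      unfolding M_def by (intro mult_left_mono bnd e) (simp add: S_def)
    moreover have "?s1 - ?s0 = 2 * \<delta>" by simp
    ultimately show ?thesis by (simp add: cr_def algebra_simps)
  qed
  \<comment> \<open>A bound for \<open>- ln r\<close> that is uniform in \<open>r\<close>, refuted
    by \<open>exp (- Q - 1)\<close>.\<close>
  define Q where "Q = (S / 2 * M + \<delta> * ln T - \<delta> * ln m + \<delta> * ln (2 * B\<^sup>2 + 1)) / \<delta>"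
  have "- ln r \<le> Q" if "0 < r" "r \<le> T" for r
    using key[OF that] d unfolding Q_def by (simp add: field_simps)
  from this[of "min T (exp (- Q - 1))"] have "- ln (min T (exp (- Q - 1))) \<le> Q" using T by simp
  moreover have "ln (min T (exp (- Q - 1))) \<le> ln (exp (- Q - 1))" using T by (intro ln_mono) auto
  ultimately show False by simp
qed

lemma zero_free:
  fixes a b :: "real ^ 2 \<Rightarrow> real"
  assumes a: "smooth a" and b: "smooth b"
    and per: "\<And>i j x. a (x + lat i j) = a x" "\<And>i j x. b (x + lat i j) = b x"
    and c: "c > 0" and C: "C \<ge> 0"
    and ineq: "\<And>x. dd p1 a x * dd p2 b x - dd p2 a x * dd p1 b x
       \<ge> c * ((dd p1 a x)\<^sup>2 + (dd p2 a x)\<^sup>2 + (dd p1 b x)\<^sup>2 + (dd p2 b x)\<^sup>2) - C * ((a x)\<^sup>2 + (b x)\<^sup>2)"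
    and z0: "a z0 = 0" "b z0 = 0"
  shows "a z = 0 \<and> b z = 0"
proof -
  have "a (z - z0 + z0) = 0 \<and> b (z - z0 + z0) = 0"
  proof (rule zero_free_at_0[where a = "\<lambda>x. a (x + z0)" and b = "\<lambda>x. b (x + z0)" and c = c and C = C])
    show "a (x + lat i j + z0) = a (x + z0)" "b (x + lat i j + z0) = b (x + z0)" for x i j
      using per(1)[of "x + z0" i j] per(2)[of "x + z0" i j] by (simp_all add: add_ac)
  qed (use c C z0 ineq in \<open>auto simp: smooth_shift a b dd_shift\<close>)
  then show ?thesis by simp
qed

section \<open>Absence of umbilic points\<close>

lemma lattice_reduce: "\<exists>i j. x + lat i j \<in> cbox 0 (pt (2 * pi) (2 * pi))"
proof -
  have "\<exists>i::int. 0 \<le> t + 2 * pi * real_of_int i \<and> t + 2 * pi * real_of_int i \<le> 2 * pi" for t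
  proof
    let ?i = "- \<lfloor>t / (2 * pi)\<rfloor>"
    have "real_of_int \<lfloor>t / (2 * pi)\<rfloor> * (2 * pi) \<le> t" "t < (real_of_int \<lfloor>t / (2 * pi)\<rfloor> + 1) * (2 * pi)"
      by (intro floor_divide_lower floor_divide_upper; simp)+
    then show "0 \<le> t + 2 * pi * real_of_int ?i \<and> t + 2 * pi * real_of_int ?i \<le> 2 * pi"
      by (simp add: algebra_simps)
  qed
  from this[of "x $ 1"] this[of "x $ 2"] obtain i j :: int where
    "0 \<le> x $ 1 + 2 * pi * real_of_int i \<and> x $ 1 + 2 * pi * real_of_int i \<le> 2 * pi"
    "0 \<le> x $ 2 + 2 * pi * real_of_int j \<and> x $ 2 + 2 * pi * real_of_int j \<le> 2 * pi" by blast
  then have "x + lat i j \<in> cbox 0 (pt (2 * pi) (2 * pi))"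
    by (simp add: mem_box_cart forall_2 lat_def axis_def)
  then show ?thesis by blast
qed

lemma periodic_attains_max:
  fixes \<phi> :: "real ^ 2 \<Rightarrow> real"
  assumes c: "continuous_on UNIV \<phi>" and per: "\<And>i j x. \<phi> (x + lat i j) = \<phi> x"
  obtains z where "\<And>x. \<phi> x \<le> \<phi> z"
proof -
  have "\<exists>z\<in>cbox 0 (pt (2 * pi) (2 * pi)). \<forall>x\<in>cbox 0 (pt (2 * pi) (2 * pi)). \<phi> x \<le> \<phi> z"
    using lattice_reduce[of 0] by (intro continuous_attains_sup continuous_on_subset[OF c]) auto
  then obtain z where z: "\<And>x. x \<in> cbox 0 (pt (2 * pi) (2 * pi)) \<Longrightarrow> \<phi> x \<le> \<phi> z" by blast
  have "\<phi> x \<le> \<phi> z" for x using lattice_reduce[of x] z per by metis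
  then show thesis by (rule that)
qed

lemma periodic_pos_bounds:
  fixes \<phi> :: "real ^ 2 \<Rightarrow> real"
  assumes c: "continuous_on UNIV \<phi>" and per: "\<And>i j x. \<phi> (x + lat i j) = \<phi> x" and pos: "\<And>x. \<phi> x > 0"
  obtains m where "m > 0" "\<And>x. m \<le> \<phi> x"
proof -
  obtain z where "\<And>x. - \<phi> x \<le> - \<phi> z"
    by (rule periodic_attains_max[of "\<lambda>x. - \<phi> x"]) (use c per in \<open>auto intro: continuous_intros\<close>)
  then show thesis using pos by (intro that[of "\<phi> z"]) auto
qed

text \<open>\<open>f\<close> and \<open>n\<close> are the lifts of an immersed torus and its unit normal to the universal covering.\<close>

locale torus_surface =
  fixes f n :: "real ^ 2 \<Rightarrow> real ^ 4"
  assumes smf: "smooth f" and smn: "smooth n"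
    and ff: "\<And>x. f x \<bullet> f x = 1" and nn: "\<And>x. n x \<bullet> n x = 1" and nf: "\<And>x. n x \<bullet> f x = 0"
    and ndf: "\<And>v x. n x \<bullet> dd v f x = 0"
    and inj: "\<And>v x. dd v f x = 0 \<Longrightarrow> v = 0"
    and perf: "\<And>i j x. f (x + lat i j) = f x" and pern: "\<And>i j x. n (x + lat i j) = n x"
begin

lemma p_ne: "p1 \<noteq> 0" "c *\<^sub>R p1 \<noteq> p2" "p2 - c *\<^sub>R p1 \<noteq> 0"
  by (auto simp: vec_eq_iff forall_2 axis_def)

text \<open>The fields \<open>gX\<close> and \<open>gY\<close> are chosen so that their images under
  the differential are the Gram-Schmidt orthonormalization of the two coordinate derivatives. The
  frame inherits their periodicity, and \<open>rr x * qq x\<close> is the area density of the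
  induced metric.\<close>

definition "rr x = sqrt (dd p1 f x \<bullet> dd p1 f x)"
definition "gX x = inverse (rr x) *\<^sub>R p1"
definition "pp x = dd p2 f x \<bullet> vd gX f x"
definition "qq x = sqrt ((dd p2 f x - pp x *\<^sub>R vd gX f x) \<bullet> (dd p2 f x - pp x *\<^sub>R vd gX f x))"
definition "gY x = inverse (qq x) *\<^sub>R (p2 - pp x *\<^sub>R gX x)"

lemma rr_pos: "dd p1 f x \<bullet> dd p1 f x > 0" "rr x > 0" and smooth_rr: "smooth rr" "smooth gX"
proof -
  show 1: "dd p1 f x \<bullet> dd p1 f x > 0" for x using inj[of p1 x] p_ne by auto
  then show 2: "rr x > 0" for x by (simp add: rr_def)
  show 3: "smooth rr" unfolding rr_def[abs_def] by (intro smooth_sqrt 1 smooth_intros smf)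
  have "rr x \<noteq> 0" for x using 2[of x] by simp
  then show "smooth gX" unfolding gX_def[abs_def] by (intro smooth_intros smooth_inverse 3)
qed

lemma df: "f differentiable (at x)" by (intro smooth_differentiable smf)

lemma vd_gX: "\<phi> differentiable (at x) \<Longrightarrow> vd gX \<phi> x = inverse (rr x) *\<^sub>R dd p1 \<phi> x"
  by (simp add: vd_def gX_def dd_vscale)

lemma qq_pos: "(dd p2 f x - pp x *\<^sub>R vd gX f x) \<bullet> (dd p2 f x - pp x *\<^sub>R vd gX f x) > 0" "qq x > 0"
  and smooth_pp: "smooth pp" "smooth qq" "smooth gY"
proof -
  have e: "dd p2 f x - pp x *\<^sub>R vd gX f x = dd (p2 - (pp x * inverse (rr x)) *\<^sub>R p1) f x" for x
    by (simp add: vd_gX df dd_vdiff dd_vscale)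
  show 1: "(dd p2 f x - pp x *\<^sub>R vd gX f x) \<bullet> (dd p2 f x - pp x *\<^sub>R vd gX f x) > 0" for x
    unfolding e using inj p_ne(3) by (metis inner_gt_zero_iff)
  then show 2: "qq x > 0" for x by (simp add: qq_def)
  have sv: "smooth (vd gX f)" by (intro smooth_vd smooth_rr smf)
  show 3: "smooth pp" unfolding pp_def[abs_def] by (intro smooth_intros sv smf)
  show 4: "smooth qq" unfolding qq_def[abs_def] by (intro smooth_sqrt 1 smooth_intros sv smf 3)
  have "qq x \<noteq> 0" for x using 2[of x] by simp
  then show "smooth gY" unfolding gY_def[abs_def] by (intro smooth_intros smooth_inverse 3 4 smooth_rr)
qed

lemma vd_gY: "\<phi> differentiable (at x) \<Longrightarrow> vd gY \<phi> x = inverse (qq x) *\<^sub>R (dd p2 \<phi> x - pp x *\<^sub>R vd gX \<phi> x)"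
  by (simp add: vd_def gY_def dd_vscale dd_vdiff)

lemma frame_norms: "vd gX f x \<bullet> vd gX f x = 1" "vd gY f x \<bullet> vd gY f x = 1" "vd gX f x \<bullet> vd gY f x = 0"
proof -
  have sc: "(inverse r *\<^sub>R w) \<bullet> (inverse r *\<^sub>R w) = 1" if "r > 0" "r * r = w \<bullet> w" for r and w :: "real ^ 4"
    using that(1) by (simp add: that(2)[symmetric] field_simps)
  have "rr x * rr x = dd p1 f x \<bullet> dd p1 f x" using rr_pos(1)[of x] by (simp add: rr_def)
  then show 1: "vd gX f x \<bullet> vd gX f x = 1" unfolding vd_gX[OF df] by (intro sc rr_pos)
  have "qq x * qq x = (dd p2 f x - pp x *\<^sub>R vd gX f x) \<bullet> (dd p2 f x - pp x *\<^sub>R vd gX f x)" using qq_pos(1)[of x] by (simp add: qq_def)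
  then show "vd gY f x \<bullet> vd gY f x = 1" unfolding vd_gY[OF df] by (intro sc qq_pos)
  have "vd gX f x \<bullet> (dd p2 f x - pp x *\<^sub>R vd gX f x) = 0"
    using 1 by (simp add: inner_diff_right pp_def inner_commute)
  then show "vd gX f x \<bullet> vd gY f x = 0" by (simp add: vd_gY[OF df])
qed

sublocale gs: sphere_frame f n gX gY
  by unfold_locales (fact smf smn smooth_rr smooth_pp ff nn nf ndf frame_norms inj)+

lemma dd_per: "smooth \<phi> \<Longrightarrow> (\<And>i j x. \<phi> (x + lat i j) = \<phi> x) \<Longrightarrow> dd v \<phi> (x + lat i j) = dd v \<phi> x"
  using dd_shift[of \<phi> v "lat i j" x] by simp

lemma per_rr: "rr (x + lat i j) = rr x" "gX (x + lat i j) = gX x"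
  by (simp_all add: gX_def rr_def dd_per smf perf)
lemma vd_per: "smooth \<phi> \<Longrightarrow> (\<And>i j x. X (x + lat i j) = X x) \<Longrightarrow> (\<And>i j x. \<phi> (x + lat i j) = \<phi> x) \<Longrightarrow> vd X \<phi> (x + lat i j) = vd X \<phi> x"
  by (simp add: vd_def dd_per)
lemma per_pp: "pp (x + lat i j) = pp x" "qq (x + lat i j) = qq x" "gY (x + lat i j) = gY x"
  by (simp_all add: gY_def pp_def qq_def dd_per smf perf vd_per per_rr)
lemma per_h: "gs.h11 (x + lat i j) = gs.h11 x" "gs.h12 (x + lat i j) = gs.h12 x" "gs.h22 (x + lat i j) = gs.h22 x"
  "gs.g (x + lat i j) = gs.g x" "gs.k (x + lat i j) = gs.k x"
  by (simp_all add: gs.h11_def gs.h12_def gs.h22_def gs.g_def gs.k_def vd_per smf perf smn pern per_rr per_pp gs.sme)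

lemma dd_p1: "\<phi> differentiable (at x) \<Longrightarrow> dd p1 \<phi> x = rr x *\<^sub>R vd gX \<phi> x"
  using rr_pos(2)[of x] by (simp add: vd_gX)
lemma dd_p2: "\<phi> differentiable (at x) \<Longrightarrow> dd p2 \<phi> x = pp x *\<^sub>R vd gX \<phi> x + qq x *\<^sub>R vd gY \<phi> x"
  using qq_pos(2)[of x] by (simp add: vd_gY)

text \<open>Gauss-Bonnet: in terms of a periodic frame the curvature form is exact, hence it cannot be positive everywhere.\<close>

lemma not_totally_umbilic:
  assumes um: "\<And>x. gs.h11 x = c" "\<And>x. gs.h22 x = c" "\<And>x. gs.h12 x = 0"
  shows False
proof -
  let ?E1 = "vd gX f" and ?E2 = "vd gY f"
  let ?w = "\<lambda>v x. dd v ?E1 x \<bullet> ?E2 x"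
  have dn: "dd v n x = c *\<^sub>R dd v f x" for v x
  proof -
    let ?A = "dd v f x \<bullet> ?E1 x" and ?B = "dd v f x \<bullet> ?E2 x"
    have "dd v n x = ?A *\<^sub>R (c *\<^sub>R ?E1 x) + ?B *\<^sub>R (c *\<^sub>R ?E2 x)"
      unfolding gs.dd_decomp[OF smooth_differentiable[OF smn], of v x] gs.D1n gs.D2n um by simp
    also have "\<dots> = c *\<^sub>R (?A *\<^sub>R ?E1 x + ?B *\<^sub>R ?E2 x)" by (simp add: scaleR_add_right mult.commute)
    also have "?A *\<^sub>R ?E1 x + ?B *\<^sub>R ?E2 x = dd v f x" by (rule gs.dd_decomp[OF df, symmetric])
    finally show ?thesis .
  qed
  \<comment> \<open>The derivative of each frame vector has no component along itself, so only the
    components along \<open>f\<close> and \<open>n\<close> meet. They contribute 1 and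
    \<open>c\<^sup>2\<close> to the Gauss curvature.\<close>
  have dE: "dd v ?E1 x \<bullet> dd u ?E2 x = (1 + c\<^sup>2) * ((dd v f x \<bullet> ?E1 x) * (dd u f x \<bullet> ?E2 x))" for u v x
  proof -
    have "dd v ?E1 x \<bullet> dd u ?E2 x = (dd u ?E2 x \<bullet> f x) * (dd v ?E1 x \<bullet> f x) + (dd u ?E2 x \<bullet> n x) * (dd v ?E1 x \<bullet> n x)"
      by (subst gs.expand[of "dd u ?E2 x" x]) (simp add: inner_add_right gs.dd_swap(5,6))
    then show ?thesis unfolding gs.dd_swap(1-4) dn by (simp add: power2_eq_square algebra_simps inner_commute)
  qed
  have "boxint pi (\<lambda>x. dd p1 (?w p2) x - dd p2 (?w p1) x) = 0"
  proof (rule boxint_exact)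
    have "?w p2 (x + lat i j) = ?w p2 x" "?w p1 (x + lat i j) = ?w p1 x" for x i j
      by (simp_all add: dd_per vd_per gs.sme smf perf per_rr per_pp)
    from this(1)[of _ 1 0] this(2)[of _ 0 1] show "?w p2 (x + (2 * pi) *\<^sub>R p1) = ?w p2 x" "?w p1 (x + (2 * pi) *\<^sub>R p2) = ?w p1 x" for x
      by (simp_all add: lat_def)
  qed (intro smooth_intros gs.sme | simp)+
  moreover have "dd p1 (?w p2) x - dd p2 (?w p1) x = - ((1 + c\<^sup>2) * (rr x * qq x))" for x
  proof -
    have "dd p1 (?w p2) x - dd p2 (?w p1) x = dd p2 ?E1 x \<bullet> dd p1 ?E2 x - dd p1 ?E1 x \<bullet> dd p2 ?E2 x"
      using dd_commute[OF gs.sme(1), of p1 p2 x]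
      by (simp add: dd_inner smooth_differentiable smooth_dd gs.sme)
    also have "\<dots> = - ((1 + c\<^sup>2) * (rr x * qq x))"
      unfolding dE dd_p1[OF df] dd_p2[OF df] by (simp add: inner_simps gs.ortho algebra_simps)
    finally show ?thesis .
  qed
  ultimately have 0: "boxint pi (\<lambda>x. - ((1 + c\<^sup>2) * (rr x * qq x))) = 0" by simp
  have cont: "continuous_on UNIV rr" "continuous_on UNIV qq" by (intro smooth_continuous smooth_rr smooth_pp)+
  \<comment> \<open>The area density is bounded below on the torus, so the exact curvature form
    would have a strictly negative integral.\<close>
  obtain m where m: "m > 0" "\<And>x. m \<le> rr x * qq x"
    by (rule periodic_pos_bounds[of "\<lambda>x. rr x * qq x"]) (auto intro!: continuous_intros cont simp: per_rr per_pp rr_pos qq_pos)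
  have "boxint pi (\<lambda>x. - ((1 + c\<^sup>2) * (rr x * qq x))) \<le> boxint pi (\<lambda>x. - m)"
  proof (rule boxint_mono)
    fix x
    have "m \<le> 1 * (rr x * qq x)" using m by simp
    also have "\<dots> \<le> (1 + c\<^sup>2) * (rr x * qq x)" using rr_pos(2)[of x] qq_pos(2)[of x] by (intro mult_right_mono) auto
    finally show "- ((1 + c\<^sup>2) * (rr x * qq x)) \<le> - m" by simp
  qed (intro continuous_intros cont)+
  also have "\<dots> < 0" using m(1) by (simp add: boxint_def)
  finally show False using 0 by simp
qed

end

text \<open>The relation is stated through the trace of the second fundamental form and the root of
  its discriminant in an arbitrary frame. This makes sense at umbilic points, where principal
  directions are not determined.\<close>

locale weingarten = torus_surface +
  fixes \<psi> :: "real \<Rightarrow> real"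
  assumes psi_smooth: "smooth \<psi>"
    and psi_even: "\<And>s. \<psi> (- s) = \<psi> s"
    and psi1: "\<And>s. s > 0 \<Longrightarrow> 0 \<le> s * deriv \<psi> s \<and> s * deriv \<psi> s < min (\<psi> s) s"
    and psi2: "\<And>s. s \<ge> 0 \<Longrightarrow> 0 \<le> s * deriv (deriv \<psi>) s \<and> s * deriv (deriv \<psi>) s \<le> 1 - (deriv \<psi> s)\<^sup>2"
    and weing: "\<And>x. gs.h11 x + gs.h22 x = \<psi> (sqrt ((gs.h11 x - gs.h22 x)\<^sup>2 + (2 * gs.h12 x)\<^sup>2))"
begin

lemmas psi_deriv = smooth_DERIV[OF psi_smooth]
lemmas smooth_deriv_psi = smooth_deriv[OF psi_smooth]

lemma psi'_bounds: "s > 0 \<Longrightarrow> 0 \<le> deriv \<psi> s" "s > 0 \<Longrightarrow> deriv \<psi> s < 1" "s > 0 \<Longrightarrow> s * deriv \<psi> s < \<psi> s"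
  using psi1[of s] by (auto simp: zero_le_mult_iff)

lemma psi'_0: "deriv \<psi> 0 = 0"
proof -
  have "((\<lambda>s. \<psi> (- s)) has_real_derivative deriv \<psi> (- 0) * (- 1)) (at 0)"
    by (rule DERIV_chain2[OF psi_deriv]) (auto intro!: derivative_eq_intros)
  then have "(\<psi> has_real_derivative - deriv \<psi> 0) (at 0)" by (simp add: psi_even)
  then have "- deriv \<psi> 0 = deriv \<psi> 0" by (rule DERIV_unique) (rule psi_deriv)
  then show ?thesis by simp
qed

lemma psi_mono: "0 \<le> s \<Longrightarrow> s \<le> t \<Longrightarrow> \<psi> s \<le> \<psi> t"
proof (erule DERIV_nonneg_imp_nondecreasing)
  fix x assume "0 \<le> s" "s \<le> x"
  then have "0 \<le> deriv \<psi> x" using psi'_bounds(1)[of x] psi'_0 by (cases "x = 0") auto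
  then show "\<exists>y. (\<psi> has_real_derivative y) (at x) \<and> 0 \<le> y" using psi_deriv by blast
qed

definition "aa x = gs.h11 x - gs.h22 x"
definition "bb x = 2 * gs.h12 x"
definition "uu x = sqrt ((aa x)\<^sup>2 + (bb x)\<^sup>2)"
definition "HH x = gs.h11 x + gs.h22 x"

lemma HH: "HH x = \<psi> (uu x)" by (simp add: HH_def weing uu_def aa_def bb_def)

lemma smooth_ab: "smooth aa" "smooth bb" "smooth HH"
  unfolding aa_def[abs_def] bb_def[abs_def] HH_def[abs_def] by (intro smooth_intros gs.smh)+

text \<open>\<open>uu\<close> need not be differentiable at umbilic points, so the chain rule and
  Cauchy-Schwarz cover only the others. At an umbilic point \<open>HH\<close> has a global minimum,
  because \<psi> is nondecreasing on nonnegative arguments, and its differential vanishes.\<close>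

lemma dd_HH: 
  assumes q: "\<bar>deriv \<psi> (uu x)\<bar> \<le> q"
  shows "(dd v HH x)\<^sup>2 \<le> q\<^sup>2 * ((dd v aa x)\<^sup>2 + (dd v bb x)\<^sup>2)"
proof (cases "uu x = 0")
  case True
  have "HH x \<le> HH y" for y unfolding HH True by (rule psi_mono) (auto simp: uu_def)
  then have "(\<lambda>v. dd v HH x) = (\<lambda>v. 0)"
    by (intro has_derivative_local_min[OF smooth_has_dd[OF smooth_ab(3)]]) auto
  then show ?thesis using q by (metis zero_le_mult_iff zero_le_power2 sum_power2_ge_zero zero_power2)
next
  case False
  then have u: "uu x > 0" by (simp add: uu_def less_le)
  then have pos: "(aa x)\<^sup>2 + (bb x)\<^sup>2 > 0" by (simp add: uu_def)
  have d: "aa differentiable (at x)" "bb differentiable (at x)" by (intro smooth_differentiable smooth_ab)+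
  have "DERIV (\<lambda>t. \<psi> (sqrt t)) ((aa x)\<^sup>2 + (bb x)\<^sup>2) :> deriv \<psi> (uu x) * (inverse (uu x) / 2)"
    unfolding uu_def by (rule DERIV_chain2[OF psi_deriv DERIV_real_sqrt[OF pos]])
  from dd_compose_real[where f = "\<lambda>y. (aa y)\<^sup>2 + (bb y)\<^sup>2", OF this, of v] have "dd v (\<lambda>y. \<psi> (sqrt ((aa y)\<^sup>2 + (bb y)\<^sup>2))) x
     = deriv \<psi> (uu x) * (inverse (uu x) / 2) * dd v (\<lambda>y. (aa y)\<^sup>2 + (bb y)\<^sup>2) x"
    using d by (simp add: power2_eq_square)
  also have "dd v (\<lambda>y. (aa y)\<^sup>2 + (bb y)\<^sup>2) x = 2 * (aa x * dd v aa x + bb x * dd v bb x)"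
    using d unfolding power2_eq_square by (simp add: dd_add dd_mult)
  also have "(\<lambda>y. \<psi> (sqrt ((aa y)\<^sup>2 + (bb y)\<^sup>2))) = HH" by (rule ext) (simp add: HH uu_def)
  finally have e: "dd v HH x = deriv \<psi> (uu x) * ((aa x * dd v aa x + bb x * dd v bb x) / uu x)"
    using u by (simp add: field_simps)
  have u2: "(uu x)\<^sup>2 = (aa x)\<^sup>2 + (bb x)\<^sup>2" by (simp add: uu_def)
  have "(aa x * dd v aa x + bb x * dd v bb x)\<^sup>2 \<le> (uu x)\<^sup>2 * ((dd v aa x)\<^sup>2 + (dd v bb x)\<^sup>2)"
    using zero_le_power2[of "aa x * dd v bb x - bb x * dd v aa x"] unfolding u2 by (simp add: power2_eq_square algebra_simps)
  then have "((aa x * dd v aa x + bb x * dd v bb x) / uu x)\<^sup>2 \<le> (dd v aa x)\<^sup>2 + (dd v bb x)\<^sup>2"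
    using u by (simp add: power_divide divide_simps mult_ac)
  moreover have "(deriv \<psi> (uu x))\<^sup>2 \<le> q\<^sup>2" using q by (metis abs_ge_zero abs_le_square_iff abs_of_nonneg order_trans)
  ultimately show ?thesis unfolding e power_mult_distrib by (intro mult_mono) auto
qed

text \<open>If \<open>t1\<close>, \<open>t2\<close>, \<open>r1\<close>, \<open>r2\<close> vanish,
  the relations are Cauchy-Riemann equations and the Jacobian is half the squared gradient. In
  general twice the Jacobian is the squared gradient minus the defect
  \<open>(b1 - a2)\<^sup>2 + (a1 + b2)\<^sup>2\<close>, and the defect is at most the fraction
  \<open>q\<close> of the squared gradient, up to the terms with \<open>r1\<close>,
  \<open>r2\<close>.\<close>

lemma beltrami_estimate:
  fixes a1 a2 b1 b2 t1 t2 r1 r2 q :: real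
  assumes q: "0 < q" "q < 1" and t: "t1\<^sup>2 \<le> q\<^sup>2 * (a1\<^sup>2 + b1\<^sup>2)" "t2\<^sup>2 \<le> q\<^sup>2 * (a2\<^sup>2 + b2\<^sup>2)"
    and e: "t2 + a2 - b1 = r1" "t1 - a1 - b2 = r2"
  shows "a2 * b1 - a1 * b2 \<ge> (1 - q) / 2 * (a1\<^sup>2 + a2\<^sup>2 + b1\<^sup>2 + b2\<^sup>2) - (r1\<^sup>2 + r2\<^sup>2) / (2 * (1 - q))"
proof -
  \<comment> \<open>The weights \<open>q\<close> and \<open>1 - q\<close> are chosen so that
    \<open>t\<^sup>2 / q\<close>, bounded with the factor \<open>q\<^sup>2\<close>, keeps a factor
    below 1.\<close>
  have y: "(t - r)\<^sup>2 \<le> t\<^sup>2 / q + r\<^sup>2 / (1 - q)" for t r :: real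
  proof -
    have "0 \<le> ((1 - q) * t + q * r)\<^sup>2 / (q * (1 - q))" using q by (intro divide_nonneg_pos) auto
    also have "\<dots> = t\<^sup>2 / q + r\<^sup>2 / (1 - q) - (t - r)\<^sup>2" using q by (simp add: field_simps power2_eq_square)
    finally show ?thesis by simp
  qed
  have s: "t1\<^sup>2 / q \<le> q * (a1\<^sup>2 + b1\<^sup>2)" "t2\<^sup>2 / q \<le> q * (a2\<^sup>2 + b2\<^sup>2)"
    using t q by (simp_all add: divide_le_eq power2_eq_square mult_ac)
  have "(b1 - a2)\<^sup>2 + (a1 + b2)\<^sup>2 = (t2 - r1)\<^sup>2 + (t1 - r2)\<^sup>2" using e by (auto simp: power2_eq_square)
  also have "\<dots> \<le> q * (a1\<^sup>2 + a2\<^sup>2 + b1\<^sup>2 + b2\<^sup>2) + (r1\<^sup>2 + r2\<^sup>2) / (1 - q)"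
    using add_mono[OF y[of t2 r1] y[of t1 r2]] s by (simp add: add_divide_distrib distrib_left)
  finally have "(b1 - a2)\<^sup>2 + (a1 + b2)\<^sup>2 \<le> q * (a1\<^sup>2 + a2\<^sup>2 + b1\<^sup>2 + b2\<^sup>2) + (r1\<^sup>2 + r2\<^sup>2) / (1 - q)" .
  moreover have "2 * (a2 * b1 - a1 * b2) = (a1\<^sup>2 + a2\<^sup>2 + b1\<^sup>2 + b2\<^sup>2) - ((b1 - a2)\<^sup>2 + (a1 + b2)\<^sup>2)"
    by (simp add: power2_eq_square algebra_simps)
  moreover have "(1 - q) / 2 * S - R / (2 * (1 - q)) \<le> J" if "D \<le> q * S + R / (1 - q)" "2 * J = S - D" for D S R J :: real
  proof -
    define X where "X = R / (1 - q)"
    have e: "R / (2 * (1 - q)) = X / 2" "(1 - q) / 2 * S = S / 2 - q * S / 2" by (simp_all add: X_def field_simps)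
    show ?thesis unfolding e using that unfolding X_def[symmetric] by linarith
  qed
  ultimately show ?thesis by blast
qed

lemma no_umbilics: "uu x > 0"
proof (rule ccontr)
  assume "\<not> uu x > 0"
  then have x0: "aa x = 0" "bb x = 0" by (auto simp: uu_def sum_power2_gt_zero_iff)
  have cont: "continuous_on S rr" "continuous_on S pp" "continuous_on S qq" "continuous_on S gs.g" "continuous_on S gs.k"
    "continuous_on S aa" "continuous_on S bb" for S
    by (intro smooth_continuous smooth_rr smooth_pp gs.smh smooth_ab)+
  have per: "aa (x + lat i j) = aa x" "bb (x + lat i j) = bb x" for x i j by (simp_all add: aa_def bb_def per_h)
  have peru: "uu (x + lat i j) = uu x" for x i j by (simp add: uu_def per)
  have cu: "continuous_on S uu" for S unfolding uu_def[abs_def] by (intro continuous_intros cont)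
  have psib: "\<bar>deriv \<psi> (uu x)\<bar> < 1" for x
    using psi'_bounds(1,2)[of "uu x"] psi'_0 by (cases "uu x = 0") (auto simp: uu_def abs_if less_le)
  obtain z where z: "\<And>x. \<bar>deriv \<psi> (uu x)\<bar> \<le> \<bar>deriv \<psi> (uu z)\<bar>"
    by (rule periodic_attains_max[of "\<lambda>x. \<bar>deriv \<psi> (uu x)\<bar>"])
      (auto simp: peru intro!: continuous_intros continuous_on_compose2[OF smooth_continuous[OF smooth_deriv_psi, of UNIV]] cu)
  \<comment> \<open>The maximum over the torus turns \<open>deriv \<psi> < 1\<close> into a uniform
    bound; 1 / 2 keeps \<open>q\<close> positive for the division.\<close>
  define q where "q = max (1 / 2) \<bar>deriv \<psi> (uu z)\<bar>"
  have q: "0 < q" "q < 1" "\<And>x. \<bar>deriv \<psi> (uu x)\<bar> \<le> q" using psib[of z] by (simp_all add: q_def z max.coboundedI2)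
  obtain m where m: "m > 0" "\<And>x. m \<le> rr x * qq x"
    by (rule periodic_pos_bounds[of "\<lambda>x. rr x * qq x"]) (auto intro!: continuous_intros cont simp: per_rr per_pp rr_pos qq_pos)
  obtain z1 where z1: "\<And>x. (rr x)\<^sup>2 + 2 * (pp x)\<^sup>2 + 2 * (qq x)\<^sup>2 \<le> (rr z1)\<^sup>2 + 2 * (pp z1)\<^sup>2 + 2 * (qq z1)\<^sup>2"
    by (rule periodic_attains_max[of "\<lambda>x. (rr x)\<^sup>2 + 2 * (pp x)\<^sup>2 + 2 * (qq x)\<^sup>2"]) (auto intro!: continuous_intros cont simp: per_rr per_pp)
  define M where "M = (rr z1)\<^sup>2 + 2 * (pp z1)\<^sup>2 + 2 * (qq z1)\<^sup>2"
  have M: "M > 0" using rr_pos(2)[of z1] by (simp add: M_def add_pos_nonneg)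
  obtain z2 where z2: "\<And>x. rr x * qq x * ((gs.g x)\<^sup>2 + (gs.k x)\<^sup>2) \<le> rr z2 * qq z2 * ((gs.g z2)\<^sup>2 + (gs.k z2)\<^sup>2)"
    by (rule periodic_attains_max[of "\<lambda>x. rr x * qq x * ((gs.g x)\<^sup>2 + (gs.k x)\<^sup>2)"]) (auto intro!: continuous_intros cont simp: per_rr per_pp per_h)
  define N where "N = rr z2 * qq z2 * ((gs.g z2)\<^sup>2 + (gs.k z2)\<^sup>2)"
  have N: "N \<ge> 0" using rr_pos(2)[of z2] qq_pos(2)[of z2] by (simp add: N_def)
  \<comment> \<open>Passing from frame to coordinate derivatives multiplies the Jacobian by
    \<open>rr x * qq x\<close>, which is at least \<open>m\<close>, and the squared gradient by at
    most \<open>M\<close>. The constant \<open>N\<close> collects the connection terms of the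
    Codazzi equations.\<close>
  define c where "c = m * ((1 - q) / 2) / M"
  define C where "C = 2 * N / (1 - q)"
  have cC: "c > 0" "C \<ge> 0" using m q M N by (auto simp: c_def C_def)
  have zf: "bb y = 0 \<and> aa y = 0" for y
  \<comment> \<open>The order (\<open>bb\<close>, \<open>aa\<close>) is the one in which the
    Jacobian is nonnegative up to the terms without derivatives.\<close>
  proof (rule zero_free[OF smooth_ab(2,1) per(2,1) cC _ x0(2,1)])
    fix x
    define a1 a2 b1 b2 where "a1 = vd gX aa x" and "a2 = vd gY aa x" and "b1 = vd gX bb x" and "b2 = vd gY bb x"
    define S where "S = a1\<^sup>2 + a2\<^sup>2 + b1\<^sup>2 + b2\<^sup>2"
    have S: "S \<ge> 0" by (simp add: S_def)
    let ?g = "gs.g x" and ?k = "gs.k x"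
    have h: "vd X gs.h11 x = (vd X HH x + vd X aa x) / 2" "vd X gs.h22 x = (vd X HH x - vd X aa x) / 2" "vd X gs.h12 x = vd X bb x / 2" for X
      unfolding HH_def[abs_def] aa_def[abs_def] bb_def[abs_def] using gs.smh by (simp_all add: vd_simps)
    have cod: "vd gY HH x + a2 - b1 = 2 * (?g * aa x + ?k * bb x)" "vd gX HH x - a1 - b2 = 2 * (?k * aa x - ?g * bb x)"
      using gs.codazzi[of x] unfolding h by (simp_all add: a1_def a2_def b1_def b2_def aa_def bb_def field_simps)
    have est: "a2 * b1 - a1 * b2 \<ge> (1 - q) / 2 * S - ((2 * (?g * aa x + ?k * bb x))\<^sup>2 + (2 * (?k * aa x - ?g * bb x))\<^sup>2) / (2 * (1 - q))"
      unfolding S_def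
      by (rule beltrami_estimate[OF q(1,2) _ _ cod])
        (simp_all add: a1_def a2_def b1_def b2_def vd_def dd_HH[OF q(3)])
    have R: "(2 * (?g * aa x + ?k * bb x))\<^sup>2 + (2 * (?k * aa x - ?g * bb x))\<^sup>2 = 4 * ((?g\<^sup>2 + ?k\<^sup>2) * ((aa x)\<^sup>2 + (bb x)\<^sup>2))"
      by (simp add: power2_eq_square algebra_simps)
    have rq: "rr x * qq x > 0" using rr_pos(2) qq_pos(2) by simp
    have D: "aa differentiable (at x)" "bb differentiable (at x)" by (intro smooth_differentiable smooth_ab)+
    have d: "dd p1 aa x = rr x * a1" "dd p1 bb x = rr x * b1" "dd p2 aa x = pp x * a1 + qq x * a2" "dd p2 bb x = pp x * b1 + qq x * b2"
      using dd_p1[OF D(1)] dd_p1[OF D(2)] dd_p2[OF D(1)] dd_p2[OF D(2)] by (simp_all add: a1_def a2_def b1_def b2_def)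
    have J: "dd p1 bb x * dd p2 aa x - dd p2 bb x * dd p1 aa x = rr x * qq x * (a2 * b1 - a1 * b2)"
      unfolding d by (simp add: algebra_simps)
    have sq: "(pp x * u + qq x * w)\<^sup>2 \<le> 2 * (pp x)\<^sup>2 * u\<^sup>2 + 2 * (qq x)\<^sup>2 * w\<^sup>2" for u w
      using zero_le_power2[of "pp x * u - qq x * w"] by (simp add: power2_eq_square algebra_simps)
    have "(dd p1 bb x)\<^sup>2 + (dd p2 bb x)\<^sup>2 + (dd p1 aa x)\<^sup>2 + (dd p2 aa x)\<^sup>2
        \<le> (rr x)\<^sup>2 * (a1\<^sup>2 + b1\<^sup>2) + 2 * (pp x)\<^sup>2 * (a1\<^sup>2 + b1\<^sup>2) + 2 * (qq x)\<^sup>2 * (a2\<^sup>2 + b2\<^sup>2)"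
      unfolding d using add_mono[OF sq[of a1 a2] sq[of b1 b2]] by (simp add: power_mult_distrib algebra_simps)
    also have "\<dots> \<le> (rr x)\<^sup>2 * S + 2 * (pp x)\<^sup>2 * S + 2 * (qq x)\<^sup>2 * S"
      by (intro add_mono mult_left_mono) (auto simp: S_def)
    also have "\<dots> = ((rr x)\<^sup>2 + 2 * (pp x)\<^sup>2 + 2 * (qq x)\<^sup>2) * S" by (simp add: algebra_simps)
    also have "\<dots> \<le> M * S" unfolding M_def by (intro mult_right_mono z1 S)
    finally have G: "(dd p1 bb x)\<^sup>2 + (dd p2 bb x)\<^sup>2 + (dd p1 aa x)\<^sup>2 + (dd p2 aa x)\<^sup>2 \<le> M * S" .
    have "c * ((dd p1 bb x)\<^sup>2 + (dd p2 bb x)\<^sup>2 + (dd p1 aa x)\<^sup>2 + (dd p2 aa x)\<^sup>2) \<le> c * (M * S)"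
      using cC by (intro mult_left_mono G) auto
    also have "\<dots> = m * ((1 - q) / 2 * S)" using M by (simp add: c_def)
    also have "\<dots> \<le> rr x * qq x * ((1 - q) / 2 * S)" using q S by (intro mult_right_mono m) auto
    finally have 1: "c * ((dd p1 bb x)\<^sup>2 + (dd p2 bb x)\<^sup>2 + (dd p1 aa x)\<^sup>2 + (dd p2 aa x)\<^sup>2) \<le> rr x * qq x * ((1 - q) / 2 * S)" .
    have "rr x * qq x * (4 * ((?g\<^sup>2 + ?k\<^sup>2) * ((aa x)\<^sup>2 + (bb x)\<^sup>2)) / (2 * (1 - q)))
        = (rr x * qq x * (?g\<^sup>2 + ?k\<^sup>2)) * (2 / (1 - q) * ((aa x)\<^sup>2 + (bb x)\<^sup>2))"
      using q by (simp add: field_simps)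
    also have "\<dots> \<le> N * (2 / (1 - q) * ((aa x)\<^sup>2 + (bb x)\<^sup>2))"
      unfolding N_def using q by (intro mult_right_mono z2) auto
    finally have 2: "rr x * qq x * (4 * ((?g\<^sup>2 + ?k\<^sup>2) * ((aa x)\<^sup>2 + (bb x)\<^sup>2)) / (2 * (1 - q))) \<le> C * ((bb x)\<^sup>2 + (aa x)\<^sup>2)"
      by (simp add: C_def add.commute mult_ac)
    have "rr x * qq x * ((1 - q) / 2 * S - 4 * ((?g\<^sup>2 + ?k\<^sup>2) * ((aa x)\<^sup>2 + (bb x)\<^sup>2)) / (2 * (1 - q))) \<le> rr x * qq x * (a2 * b1 - a1 * b2)"
      using est unfolding R using rq by (intro mult_left_mono) auto
    then show "c * ((dd p1 bb x)\<^sup>2 + (dd p2 bb x)\<^sup>2 + (dd p1 aa x)\<^sup>2 + (dd p2 aa x)\<^sup>2) - C * ((bb x)\<^sup>2 + (aa x)\<^sup>2)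
        \<le> dd p1 bb x * dd p2 aa x - dd p2 bb x * dd p1 aa x"
      unfolding J right_diff_distrib[of "rr x * qq x"] using 1 2 by linarith
  qed
  then have "uu y = 0" for y by (simp add: uu_def)
  then have "gs.h11 y + gs.h22 y = \<psi> 0" "gs.h11 y - gs.h22 y = 0" "2 * gs.h12 y = 0" for y
    using HH[of y] zf[of y] by (simp_all add: HH_def aa_def bb_def)
  then have "gs.h11 y = \<psi> 0 / 2" "gs.h22 y = \<psi> 0 / 2" "gs.h12 y = 0" for y
    by (smt (verit) field_sum_of_halves)+
  then show False by (rule not_totally_umbilic)
qed

end

section \<open>Principal frames\<close>

text \<open>The plane is contractible, so the nonvanishing map \<open>w\<close> has a continuous
  logarithm \<open>l\<close>. Near \<open>x\<close> it agrees with
  \<open>l x + Ln (w y / w x)\<close>; hence its derivative is \<open>dd v w x / w x\<close>, which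
  is smooth, and the angle is the imaginary part.\<close>

lemma smooth_angle:
  fixes a b :: "real ^ 2 \<Rightarrow> real"
  assumes a: "smooth a" and b: "smooth b" and pos: "\<And>x. (a x)\<^sup>2 + (b x)\<^sup>2 > 0"
  obtains \<theta> where "smooth \<theta>" "\<And>x. a x = sqrt ((a x)\<^sup>2 + (b x)\<^sup>2) * cos (\<theta> x)"
    "\<And>x. b x = sqrt ((a x)\<^sup>2 + (b x)\<^sup>2) * sin (\<theta> x)"
proof -
  define w where "w x = complex_of_real (a x) + \<i> * complex_of_real (b x)" for x
  have sw: "smooth w" unfolding w_def[abs_def]
    by (intro smooth_intros smooth_bounded_linear[OF bounded_linear_of_real] a b)
  have w0: "w x \<noteq> 0" for x using pos[of x] by (auto simp: w_def complex_eq_iff)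
  obtain l where l: "continuous_on UNIV l" "\<And>x. w x = exp (l x)"
    by (rule continuous_logarithm_on_contractible[of UNIV w])
      (use w0 in \<open>auto intro: smooth_continuous sw convex_imp_contractible\<close>)
  have dl: "(l has_derivative (\<lambda>v. dd v w x / w x)) (at x)" for x
  proof -
    have d1: "((\<lambda>y. w y / w x) has_derivative (\<lambda>v. dd v w x / w x)) (at x)"
      using has_derivative_mult_right[OF smooth_has_dd[OF sw], of "inverse (w x)" x] by (simp add: field_simps)
    have "(Ln has_field_derivative 1) (at (w x / w x))"
      using has_field_derivative_Ln[of 1] w0 by simp
    then have "(Ln has_derivative (\<lambda>v. v)) (at (w x / w x))" by (simp add: has_field_derivative_def w0 lambda_one)
    from has_derivative_compose[OF d1 this]
    have d2: "((\<lambda>y. l x + Ln (w y / w x)) has_derivative (\<lambda>v. dd v w x / w x)) (at x)"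
      by (auto intro!: derivative_eq_intros)
    have "isCont l x" using l(1) by (simp add: continuous_on_eq_continuous_at)
    then obtain d where d: "d > 0" "\<And>y. dist y x < d \<Longrightarrow> dist (l y) (l x) < pi"
      unfolding continuous_at_eps_delta using pi_gt_zero by blast
    have eq: "l x + Ln (w y / w x) = l y" if "dist y x < d" for y
    proof -
      have "w y / w x = exp (l y - l x)" by (simp add: l(2) exp_diff)
      moreover have "\<bar>Im (l y - l x)\<bar> < pi"
        using d(2)[OF that] abs_Im_le_cmod[of "l y - l x"] by (simp add: dist_norm)
      then have "Ln (exp (l y - l x)) = l y - l x" by (intro Ln_exp) auto
      ultimately show ?thesis by simp
    qed
    then show ?thesis
      by (intro has_derivative_transform_within[OF d2 d(1)]) auto
  qed
  define \<theta> where "\<theta> x = Im (l x)" for x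
  have d\<theta>: "(\<theta> has_derivative (\<lambda>v. Im (dd v w x / w x))) (at x)" for x
    unfolding \<theta>_def[abs_def] by (rule bounded_linear.has_derivative[OF bounded_linear_Im dl])
  have "smooth \<theta>"
  proof (rule smoothI)
    show "\<theta> differentiable (at x)" for x using d\<theta> differentiableI by blast
    have "dd v \<theta> = (\<lambda>x. Im (dd v w x / w x))" for v by (rule ext, rule dd_eqI[OF d\<theta>])
    then show "smooth (dd v \<theta>)" for v
      by (simp only:) (intro smooth_bounded_linear[OF bounded_linear_Im] smooth_divide w0 smooth_dd sw)
  qed
  moreover have "cmod (w x) = sqrt ((a x)\<^sup>2 + (b x)\<^sup>2)" "a x = Re (w x)" "b x = Im (w x)" for x
    by (simp_all add: w_def cmod_def)
  moreover have "cmod (w x) = exp (Re (l x))" for x by (simp add: l(2))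
  ultimately show thesis by (intro that[of \<theta>]) (auto simp: \<theta>_def l(2) Re_exp Im_exp)
qed

lemma (in sphere_frame) rotate_frame:
  assumes th: "smooth \<theta>"
  defines "X' \<equiv> (\<lambda>x. cos (\<theta> x) *\<^sub>R X x + sin (\<theta> x) *\<^sub>R Y x)" and "Y' \<equiv> (\<lambda>x. cos (\<theta> x) *\<^sub>R Y x - sin (\<theta> x) *\<^sub>R X x)"
  shows "sphere_frame f n X' Y'"
    and "sphere_frame.h11 f n X' x = (cos (\<theta> x))\<^sup>2 * h11 x + 2 * sin (\<theta> x) * cos (\<theta> x) * h12 x + (sin (\<theta> x))\<^sup>2 * h22 x"
    and "sphere_frame.h22 f n Y' x = (sin (\<theta> x))\<^sup>2 * h11 x - 2 * sin (\<theta> x) * cos (\<theta> x) * h12 x + (cos (\<theta> x))\<^sup>2 * h22 x"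
    and "sphere_frame.h12 f n X' Y' x = sin (\<theta> x) * cos (\<theta> x) * (h22 x - h11 x) + ((cos (\<theta> x))\<^sup>2 - (sin (\<theta> x))\<^sup>2) * h12 x"
proof -
  have sX: "smooth X'" "smooth Y'"
    unfolding X'_def Y'_def by (intro smooth_intros smooth_compose_real[OF smooth_sin] smooth_compose_real[OF smooth_cos] th sm)+
  have v: "vd X' p x = cos (\<theta> x) *\<^sub>R vd X p x + sin (\<theta> x) *\<^sub>R vd Y p x"
    "vd Y' p x = cos (\<theta> x) *\<^sub>R vd Y p x - sin (\<theta> x) *\<^sub>R vd X p x" if "p differentiable (at x)" for p :: "real ^ 2 \<Rightarrow> real ^ 4" and x
    by (simp_all add: vd_def X'_def Y'_def dd_vadd dd_vdiff dd_vscale that)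
  have d: "f differentiable (at x)" "n differentiable (at x)" for x by (intro smooth_differentiable sm)+
  have t: "sin (\<theta> x) * sin (\<theta> x) = 1 - cos (\<theta> x) * cos (\<theta> x)" for x
    using sin_cos_squared_add[of "\<theta> x"] by (simp add: power2_eq_square)
  show I: "sphere_frame f n X' Y'"
  proof
    show "vd X' f x \<bullet> vd X' f x = 1" "vd Y' f x \<bullet> vd Y' f x = 1" "vd X' f x \<bullet> vd Y' f x = 0" for x
      by (simp_all add: v d inner_simps ortho t)
  qed (fact sm sX ff nn nf ndf inj)+
  note hd = sphere_frame.h11_def[OF I] sphere_frame.h22_def[OF I] sphere_frame.h12_def[OF I]
  show "sphere_frame.h11 f n X' x = (cos (\<theta> x))\<^sup>2 * h11 x + 2 * sin (\<theta> x) * cos (\<theta> x) * h12 x + (sin (\<theta> x))\<^sup>2 * h22 x"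
    "sphere_frame.h22 f n Y' x = (sin (\<theta> x))\<^sup>2 * h11 x - 2 * sin (\<theta> x) * cos (\<theta> x) * h12 x + (cos (\<theta> x))\<^sup>2 * h22 x"
    "sphere_frame.h12 f n X' Y' x = sin (\<theta> x) * cos (\<theta> x) * (h22 x - h11 x) + ((cos (\<theta> x))\<^sup>2 - (sin (\<theta> x))\<^sup>2) * h12 x"
    by (simp_all add: hd v d D1n D2n inner_simps ortho power2_eq_square algebra_simps)
qed

text \<open>Periodicity of \<open>X\<close> and \<open>Y\<close> is not demanded: both could change
  sign along a period, and all arguments in this frame are pointwise or on the plane. The conditions
  on \<psi> concern positive arguments, the only values that \<open>h11 x - h22 x\<close>
  takes.\<close>

locale principal_frame = sphere_frame +
  fixes \<psi> :: "real \<Rightarrow> real"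
  assumes psi_smooth: "smooth \<psi>"
    and psi'_nonneg: "\<And>s. s > 0 \<Longrightarrow> 0 \<le> deriv \<psi> s"
    and psi'_less_1: "\<And>s. s > 0 \<Longrightarrow> deriv \<psi> s < 1"
    and psi'_less_psi: "\<And>s. s > 0 \<Longrightarrow> s * deriv \<psi> s < \<psi> s"
    and psi''_nonneg: "\<And>s. s > 0 \<Longrightarrow> 0 \<le> deriv (deriv \<psi>) s"
    and psi''_le: "\<And>s. s > 0 \<Longrightarrow> s * deriv (deriv \<psi>) s \<le> 1 - (deriv \<psi> s)\<^sup>2"
    and h12_0: "\<And>x. h12 x = 0" and u_pos: "\<And>x. h11 x - h22 x > 0"
    and weing: "\<And>x. h11 x + h22 x = \<psi> (h11 x - h22 x)"

lemma (in weingarten) principal_frame_exists: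
  obtains X Y where "principal_frame f n X Y \<psi>" "\<And>x. sphere_frame.h11 f n X x - sphere_frame.h22 f n Y x = uu x"
proof -
  have "(aa x)\<^sup>2 + (bb x)\<^sup>2 > 0" for x using no_umbilics[of x] by (simp add: uu_def)
  then obtain \<theta> where th: "smooth \<theta>" "\<And>x. aa x = uu x * cos (\<theta> x)" "\<And>x. bb x = uu x * sin (\<theta> x)"
    unfolding uu_def by (rule smooth_angle[OF smooth_ab(1,2)]) blast
  \<comment> \<open>The trace-free part turns by twice the angle by which the frame is rotated, so
    half of its argument diagonalizes it.\<close>
  define \<alpha> where "\<alpha> x = \<theta> x / 2" for x
  have sa: "smooth \<alpha>" unfolding \<alpha>_def[abs_def] by (intro smooth_bounded_linear[OF bounded_linear_divide] th)
  have "\<theta> x = 2 * \<alpha> x" for x by (simp add: \<alpha>_def)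
  then have ab: "gs.h11 x - gs.h22 x = uu x * ((cos (\<alpha> x))\<^sup>2 - (sin (\<alpha> x))\<^sup>2)" "2 * gs.h12 x = uu x * (2 * sin (\<alpha> x) * cos (\<alpha> x))" for x
    using th(2)[of x] th(3)[of x] by (simp_all add: cos_double sin_double aa_def bb_def)
  note R = gs.rotate_frame[OF sa]
  let ?X = "\<lambda>x. cos (\<alpha> x) *\<^sub>R gX x + sin (\<alpha> x) *\<^sub>R gY x" and ?Y = "\<lambda>x. cos (\<alpha> x) *\<^sub>R gY x - sin (\<alpha> x) *\<^sub>R gX x"
  have sc: "(sin (\<alpha> x))\<^sup>2 = 1 - (cos (\<alpha> x))\<^sup>2" for x using sin_squared_eq by blast
  have sum: "sphere_frame.h11 f n ?X x + sphere_frame.h22 f n ?Y x = HH x" for x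
    unfolding R(2,3) HH_def sc by (simp add: algebra_simps)
  have diff: "sphere_frame.h11 f n ?X x - sphere_frame.h22 f n ?Y x = uu x" for x
  proof -
    have e: "(c\<^sup>2 - s\<^sup>2) * (U * (c\<^sup>2 - s\<^sup>2)) + (2 * s * c) * (U * (2 * s * c)) = U * (c\<^sup>2 + s\<^sup>2)\<^sup>2" for c s U :: real
      by (simp add: power2_eq_square algebra_simps)
    have "sphere_frame.h11 f n ?X x - sphere_frame.h22 f n ?Y x
       = ((cos (\<alpha> x))\<^sup>2 - (sin (\<alpha> x))\<^sup>2) * (gs.h11 x - gs.h22 x) + (2 * sin (\<alpha> x) * cos (\<alpha> x)) * (2 * gs.h12 x)"
      unfolding R(2,3) by (simp add: algebra_simps)
    also have "\<dots> = uu x * (((cos (\<alpha> x))\<^sup>2 + (sin (\<alpha> x))\<^sup>2)\<^sup>2)" unfolding ab e ..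
    finally show ?thesis by simp
  qed
  have h12: "sphere_frame.h12 f n ?X ?Y x = 0" for x
  proof -
    have "2 * sphere_frame.h12 f n ?X ?Y x = - (2 * sin (\<alpha> x) * cos (\<alpha> x)) * (gs.h11 x - gs.h22 x)
       + ((cos (\<alpha> x))\<^sup>2 - (sin (\<alpha> x))\<^sup>2) * (2 * gs.h12 x)"
      unfolding R(4) by (simp add: algebra_simps)
    also have "\<dots> = 0" unfolding ab by (simp add: algebra_simps)
    finally show ?thesis by simp
  qed
  have "principal_frame f n ?X ?Y \<psi>"
    unfolding principal_frame_def
  proof (intro conjI R(1), unfold_locales)
    show "0 \<le> deriv (deriv \<psi>) s" "s * deriv (deriv \<psi>) s \<le> 1 - (deriv \<psi> s)\<^sup>2" if "s > 0" for s
      using psi2[of s] that by (auto simp: zero_le_mult_iff)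
  qed (use psi_smooth psi'_bounds h12 diff sum HH no_umbilics in auto)
  then show thesis using diff by (rule that)
qed

section \<open>The Simons-type identity\<close>

lemma second_derivative_at_min:
  fixes z z' :: "real \<Rightarrow> real"
  assumes d1: "\<And>t. (z has_real_derivative z' t) (at t)" and d2: "(z' has_real_derivative d) (at 0)"
    and min: "\<And>t. z 0 \<le> z t"
  shows "z' 0 = 0" "d \<ge> 0"
proof -
  show 0: "z' 0 = 0"
    by (rule DERIV_local_min[OF d1, of 1 0]) (use min in auto)
  show "d \<ge> 0"
  proof (rule ccontr)
    assume "\<not> d \<ge> 0"
    then obtain e where e: "e > 0" "\<And>h. 0 < h \<Longrightarrow> h < e \<Longrightarrow> z' (0 + h) < z' 0"
      using DERIV_neg_dec_right[OF d2] by auto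
    have "\<exists>t>0. t < e / 2 \<and> z (e / 2) - z 0 = (e / 2 - 0) * z' t"
      using e(1) by (intro MVT2 d1) auto
    then obtain t where t: "0 < t" "t < e / 2" "z (e / 2) - z 0 = (e / 2) * z' t" by auto
    then have "z' t < 0" using e(2)[of t] 0 e(1) by auto
    then have "(e / 2) * z' t < 0" using e(1) by (intro mult_pos_neg) auto
    then show False using t(3) min[of "e / 2"] by linarith
  qed
qed

text \<open>The algebra behind the maximum principle: with \<open>u\<close> the difference of the principal curvatures, \<open>P\<close> and
  \<open>P2\<close> the first two derivatives of \<open>\<psi>\<close> at \<open>u\<close> and \<open>\<Phi> = (\<psi> + \<kappa> u) / 2\<close>, the Simons-type identity for \<open>u\<close>
  makes \<open>\<Phi>\<close> a strict supersolution.\<close>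

lemma strict_supersolution:
  fixes u P P2 psi \<kappa> u1 u2 u11 u22 g k :: real
  assumes u: "u > 0" and P: "0 \<le> P" "P < 1" and P2: "0 \<le> P2" "u * P2 \<le> 1 - P\<^sup>2" and psi: "u * P < psi" and kap: "\<kappa> > 1"
    and g: "g = (1 + P) * u2 / (2 * u)" and k: "k = - (1 - P) * u1 / (2 * u)"
    and l: "l1 = (psi + u) / 2" "l2 = (psi - u) / 2" and Phi: "\<Phi> = (psi + \<kappa> * u) / 2"
    and simons: "(1 - P) * u11 + (1 + P) * u22 = 2 * u * (1 + l1 * l2 + g\<^sup>2 + k\<^sup>2) + P2 * (u1\<^sup>2 - u2\<^sup>2) + 2 * g * u2 - 2 * k * u1"
    and Phii: "Phi1 = (P + \<kappa>) / 2 * u1" "Phi2 = (P + \<kappa>) / 2 * u2"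
      "Phi11 = (P + \<kappa>) / 2 * u11 + P2 / 2 * u1\<^sup>2" "Phi22 = (P + \<kappa>) / 2 * u22 + P2 / 2 * u2\<^sup>2"
  shows "(1 - P) * (Phi11 - g * Phi2) + (1 + P) * (Phi22 + k * Phi1)
    < (1 - P) * (\<Phi> - l1) * (1 + l1 * \<Phi>) + (1 + P) * (\<Phi> - l2) * (1 + l2 * \<Phi>)
      + 2 * ((1 - P) * Phi1\<^sup>2 / (\<Phi> - l1) + (1 + P) * Phi2\<^sup>2 / (\<Phi> - l2))"
proof -
  define K where "K = 1 + l1 * l2"
  define A B where "A = (1 - P)\<^sup>2 / u" and "B = (1 + P)\<^sup>2 / u"
  have d: "\<Phi> - l1 = (\<kappa> - 1) * u / 2" "\<Phi> - l2 = (\<kappa> + 1) * u / 2" unfolding l Phi by (simp_all add: field_simps)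
  have "(1 - P) * (Phi11 - g * Phi2) + (1 + P) * (Phi22 + k * Phi1)
    = (P + \<kappa>) / 2 * ((1 - P) * u11 + (1 + P) * u22 - (1 - P) * g * u2 + (1 + P) * k * u1) + P2 / 2 * ((1 - P) * u1\<^sup>2 + (1 + P) * u2\<^sup>2)"
    unfolding Phii by (simp add: field_simps)
  also have "\<dots> = (P + \<kappa>) / 2 * (2 * u * K + (2 * u * g\<^sup>2 + 2 * g * u2 - (1 - P) * g * u2) + (2 * u * k\<^sup>2 - 2 * k * u1 + (1 + P) * k * u1) + P2 * (u1\<^sup>2 - u2\<^sup>2))
      + P2 / 2 * ((1 - P) * u1\<^sup>2 + (1 + P) * u2\<^sup>2)"
    unfolding simons K_def by (simp add: algebra_simps)
  also have "2 * u * g\<^sup>2 + 2 * g * u2 - (1 - P) * g * u2 = B * u2\<^sup>2"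
    unfolding g B_def using u by (simp add: field_simps power2_eq_square)
  also have "2 * u * k\<^sup>2 - 2 * k * u1 + (1 + P) * k * u1 = A * u1\<^sup>2"
    unfolding k A_def using u by (simp add: field_simps power2_eq_square)
  finally have lhs: "(1 - P) * (Phi11 - g * Phi2) + (1 + P) * (Phi22 + k * Phi1)
    = (P + \<kappa>) * u * K + u1\<^sup>2 * ((P + \<kappa>) / 2 * A + (\<kappa> + 1) / 2 * P2)
      + u2\<^sup>2 * ((P + \<kappa>) / 2 * B - (\<kappa> - 1) / 2 * P2)"
    by (simp add: field_simps)
  \<comment> \<open>In the coefficient of \<open>u1\<^sup>2\<close> the second derivative of \<psi>
    enters with a positive sign; here the upper bound \<open>u * P2 \<le> 1 - P\<^sup>2\<close> is
    used.\<close>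
  have A1: "(P + \<kappa>) / 2 * ((1 - P)\<^sup>2 / u) + (\<kappa> + 1) / 2 * P2 \<le> (P + \<kappa>)\<^sup>2 * (1 - P) / ((\<kappa> - 1) * u)"
  proof -
    have "(\<kappa> + 1) / 2 * (u * P2) \<le> (\<kappa> + 1) / 2 * (1 - P\<^sup>2)" using kap by (intro mult_left_mono P2) auto
    then have "(P + \<kappa>) / 2 * (1 - P)\<^sup>2 + (\<kappa> + 1) / 2 * (u * P2) \<le> (1 - P) * ((2 * \<kappa> + 1 + 2 * P - P\<^sup>2) / 2)"
      by (simp add: field_simps power2_eq_square)
    also have "\<dots> \<le> (1 - P) * ((P + \<kappa>)\<^sup>2 / (\<kappa> - 1))"
    proof (rule mult_left_mono)
      have "0 \<le> 2 * \<kappa> * P + P\<^sup>2 + \<kappa> * P\<^sup>2 + \<kappa> + 1 + 2 * P" using P kap by (intro add_nonneg_nonneg mult_nonneg_nonneg) auto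
      then have "(2 * \<kappa> + 1 + 2 * P - P\<^sup>2) * (\<kappa> - 1) \<le> 2 * (P + \<kappa>)\<^sup>2" by (simp add: power2_eq_square algebra_simps)
      then show "(2 * \<kappa> + 1 + 2 * P - P\<^sup>2) / 2 \<le> (P + \<kappa>)\<^sup>2 / (\<kappa> - 1)" using kap by (simp add: field_simps)
    qed (use P in simp)
    finally have "((P + \<kappa>) / 2 * (1 - P)\<^sup>2 + (\<kappa> + 1) / 2 * (u * P2)) / u \<le> (1 - P) * ((P + \<kappa>)\<^sup>2 / (\<kappa> - 1)) / u"
      using u by (intro divide_right_mono) auto
    moreover have e1: "((P + \<kappa>) / 2 * (1 - P)\<^sup>2 + (\<kappa> + 1) / 2 * (u * P2)) / u = (P + \<kappa>) / 2 * ((1 - P)\<^sup>2 / u) + (\<kappa> + 1) / 2 * P2"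
      using u by (simp add: add_divide_distrib)
    moreover have e2: "(1 - P) * ((P + \<kappa>)\<^sup>2 / (\<kappa> - 1)) / u = (P + \<kappa>)\<^sup>2 * (1 - P) / ((\<kappa> - 1) * u)"
      by (simp add: mult_ac)
    ultimately show ?thesis by (simp only: e1 e2)
  qed
  \<comment> \<open>In the coefficient of \<open>u2\<^sup>2\<close> the second derivative of \<psi>
    has the favourable sign, and the rest amounts to
    \<open>0 \<le> (\<kappa> - 1) * (1 - P)\<close>.\<close>
  have A2: "(P + \<kappa>) / 2 * ((1 + P)\<^sup>2 / u) - (\<kappa> - 1) / 2 * P2 \<le> (P + \<kappa>)\<^sup>2 * (1 + P) / ((\<kappa> + 1) * u)"
  proof -
    have "0 \<le> (\<kappa> - 1) / 2 * P2" using kap P2 by simp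
    moreover have "(P + \<kappa>) / 2 * ((1 + P)\<^sup>2 / u) \<le> (P + \<kappa>)\<^sup>2 * (1 + P) / ((\<kappa> + 1) * u)"
    proof -
      have "0 \<le> (\<kappa> - 1) * (1 - P)" using kap P by simp
      then have "(1 + P) * (\<kappa> + 1) \<le> 2 * (P + \<kappa>)" by (simp add: algebra_simps)
      then have "(P + \<kappa>) * (1 + P) * ((1 + P) * (\<kappa> + 1)) \<le> (P + \<kappa>) * (1 + P) * (2 * (P + \<kappa>))"
        using P kap by (intro mult_left_mono) auto
      then show ?thesis using u kap by (simp add: divide_simps power2_eq_square mult_ac)
    qed
    ultimately show ?thesis by linarith
  qed
  \<comment> \<open>The terms without derivatives leave this remainder. It is positive because
    \<open>\<kappa> > 1\<close> and \<open>u * P < psi\<close>, and it makes the inequality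
    strict.\<close>
  have zero: "(1 - P) * (\<Phi> - l1) * (1 + l1 * \<Phi>) + (1 + P) * (\<Phi> - l2) * (1 + l2 * \<Phi>) - (P + \<kappa>) * u * K
      = u\<^sup>2 / 4 * ((\<kappa>\<^sup>2 - 1) * (psi - u * P))"
    unfolding d K_def unfolding l Phi by (simp add: field_simps power2_eq_square)
  have e: "2 * (a * (q / 2 * x)\<^sup>2 / (w / 2)) = x\<^sup>2 * (q\<^sup>2 * a / w)" for a q x w :: real
    by (cases "w = 0") (simp_all add: power2_eq_square field_simps)
  have "0 < u\<^sup>2 / 4 * ((\<kappa>\<^sup>2 - 1) * (psi - u * P))"
    using u kap psi by (intro mult_pos_pos) (auto simp: power2_eq_square less_1_mult)
  moreover have "2 * ((1 - P) * Phi1\<^sup>2 / (\<Phi> - l1)) = u1\<^sup>2 * ((P + \<kappa>)\<^sup>2 * (1 - P) / ((\<kappa> - 1) * u))"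
    "2 * ((1 + P) * Phi2\<^sup>2 / (\<Phi> - l2)) = u2\<^sup>2 * ((P + \<kappa>)\<^sup>2 * (1 + P) / ((\<kappa> + 1) * u))"
    unfolding d Phii e by simp_all
  moreover have "u1\<^sup>2 * ((P + \<kappa>) / 2 * ((1 - P)\<^sup>2 / u) + (\<kappa> + 1) / 2 * P2) \<le> u1\<^sup>2 * ((P + \<kappa>)\<^sup>2 * (1 - P) / ((\<kappa> - 1) * u))"
    "u2\<^sup>2 * ((P + \<kappa>) / 2 * ((1 + P)\<^sup>2 / u) - (\<kappa> - 1) / 2 * P2) \<le> u2\<^sup>2 * ((P + \<kappa>)\<^sup>2 * (1 + P) / ((\<kappa> + 1) * u))"
    by (intro mult_left_mono A1 A2; simp)+
  ultimately show ?thesis unfolding lhs A_def B_def using zero by argo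
qed

context principal_frame
begin

definition "u x = h11 x - h22 x"

lemma smooth_u: "smooth u" unfolding u_def[abs_def] by (intro smooth_intros smh)

lemmas psi_deriv = smooth_DERIV[OF psi_smooth]
lemmas smooth_deriv_psi = smooth_deriv[OF psi_smooth]
lemmas psi_deriv2 = smooth_DERIV[OF smooth_deriv_psi]

abbreviation "PP x \<equiv> deriv \<psi> (u x)"
abbreviation "PP2 x \<equiv> deriv (deriv \<psi>) (u x)"

lemma u_pos': "u x > 0" using u_pos by (simp add: u_def)

lemma du: "u differentiable (at x)" by (intro smooth_differentiable smooth_u)

lemma smooth_psi_u: "smooth (\<lambda>x. \<psi> (u x))" "smooth PP"
  by (rule smooth_compose_real[OF psi_smooth smooth_u], rule smooth_compose_real[OF smooth_deriv_psi smooth_u])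

lemma vd_psi: "vd V (\<lambda>x. \<psi> (u x)) x = PP x * vd V u x" "vd V PP x = PP2 x * vd V u x"
  unfolding vd_def by (rule dd_compose_real[OF psi_deriv du], rule dd_compose_real[OF psi_deriv2 du])

lemma h_eq: "h11 x = (\<psi> (u x) + u x) / 2" "h22 x = (\<psi> (u x) - u x) / 2"
  using weing[of x] by (auto simp: u_def)

lemma vd_h: "vd V h11 x = (PP x + 1) / 2 * vd V u x" "vd V h22 x = (PP x - 1) / 2 * vd V u x"
proof -
  have "vd V (\<lambda>x. h11 x + h22 x) x = vd V (\<lambda>x. \<psi> (u x)) x" by (simp add: weing u_def)
  then have 1: "vd V h11 x + vd V h22 x = PP x * vd V u x" by (simp add: vd_simps smh vd_psi)
  have 2: "vd V u x = vd V h11 x - vd V h22 x" unfolding u_def[abs_def] by (simp add: vd_simps smh)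
  have 3: "PP x * vd V u x + vd V u x = 2 * vd V h11 x" "PP x * vd V u x - vd V u x = 2 * vd V h22 x"
    using 1 2 by linarith+
  show "vd V h11 x = (PP x + 1) / 2 * vd V u x" "vd V h22 x = (PP x - 1) / 2 * vd V u x"
    using 3 by (simp_all add: field_simps)
qed

lemma vd_h12: "vd V h12 x = 0" 
proof -
  have "h12 = (\<lambda>x. 0)" using h12_0 by auto
  then show ?thesis by (simp add: vd_const)
qed

text \<open>The Codazzi equations of a principal frame, kept multiplied by \<open>u\<close> so that
  they can be differentiated without quotients.\<close>

lemma gk: "g x * u x = (1 + PP x) / 2 * vd Y u x" "k x * u x = - ((1 - PP x) / 2) * vd X u x"
  using codazzi[of x] by (simp_all add: vd_h12 h12_0 vd_h u_def[symmetric] field_simps)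

lemma gk': "g x = (1 + PP x) * vd Y u x / (2 * u x)" "k x = - (1 - PP x) * vd X u x / (2 * u x)"
  using gk[of x] u_pos'[of x] by (simp_all add: field_simps)

text \<open>The first relation of \<open>gk\<close> is differentiated along \<open>Y\<close>, the
  second along \<open>X\<close>. Their difference contains \<open>vd Y g x - vd X k x\<close>, which
  the Gauss equation evaluates.\<close>

lemma simons: "(1 - PP x) * vd X (vd X u) x + (1 + PP x) * vd Y (vd Y u) x
  = 2 * u x * (1 + h11 x * h22 x + (g x)\<^sup>2 + (k x)\<^sup>2) + PP2 x * ((vd X u x)\<^sup>2 - (vd Y u x)\<^sup>2) + 2 * g x * vd Y u x - 2 * k x * vd X u x"
proof -
  have sm': "smooth (vd X u)" "smooth (vd Y u)" by (intro smooth_vd sm smooth_u)+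
  have "vd Y (\<lambda>x. 2 * (g x * u x)) x = vd Y (\<lambda>x. (1 + PP x) * vd Y u x) x"
    using gk(1) by (intro arg_cong[where f = "\<lambda>z. vd Y z x"]) (auto simp: field_simps)
  then have 1: "vd Y g x * u x + g x * vd Y u x = (PP2 x * vd Y u x * vd Y u x + (1 + PP x) * vd Y (vd Y u) x) / 2"
    by (simp add: vd_simps smh smooth_u sm' smooth_psi_u vd_psi)
  have "vd X (\<lambda>x. 2 * (k x * u x)) x = vd X (\<lambda>x. (PP x - 1) * vd X u x) x"
    using gk(2) by (intro arg_cong[where f = "\<lambda>z. vd X z x"]) (auto simp: field_simps)
  then have 2: "vd X k x * u x + k x * vd X u x = (PP2 x * vd X u x * vd X u x + (PP x - 1) * vd X (vd X u) x) / 2"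
    by (simp add: vd_simps smh smooth_u sm' smooth_psi_u vd_psi)
  have "(vd Y g x - vd X k x) * u x = (1 + h11 x * h22 x + (g x)\<^sup>2 + (k x)\<^sup>2) * u x"
    unfolding gauss by (simp add: h12_0)
  then show ?thesis using 1 2 by (simp add: field_simps power2_eq_square)
qed

lemma tangent_dd: "z \<bullet> f x = 0 \<Longrightarrow> z \<bullet> n x = 0 \<Longrightarrow> \<exists>b. dd b f x = z"
proof -
  assume z: "z \<bullet> f x = 0" "z \<bullet> n x = 0"
  let ?b = "(z \<bullet> e1 x) *\<^sub>R X x + (z \<bullet> e2 x) *\<^sub>R Y x"
  have "dd ?b f x = (z \<bullet> e1 x) *\<^sub>R e1 x + (z \<bullet> e2 x) *\<^sub>R e2 x"
    by (simp add: dd_vadd dd_vscale smooth_differentiable sm vd_def)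
  also have "\<dots> = z" using expand[of z x] z by simp
  finally show ?thesis by blast
qed

lemma dd_n_inner:
  "dd b n y \<bullet> dd b f y = h11 y * (dd b f y \<bullet> e1 y)\<^sup>2 + h22 y * (dd b f y \<bullet> e2 y)\<^sup>2"
proof -
  have "dd b n y = (dd b f y \<bullet> e1 y) *\<^sub>R vd X n y + (dd b f y \<bullet> e2 y) *\<^sub>R vd Y n y"
    by (rule dd_decomp[OF smooth_differentiable[OF sm(2)]])
  then show ?thesis by (simp add: D1n D2n h12_0 inner_simps power2_eq_square inner_commute algebra_simps)
qed

lemma tangent_norm:
  "dd b f y \<bullet> dd c f y = (dd b f y \<bullet> e1 y) * (dd c f y \<bullet> e1 y) + (dd b f y \<bullet> e2 y) * (dd c f y \<bullet> e2 y)"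
  by (subst (1) expand[of "dd b f y" y]) (simp add: inner_add_left inner_add_right ndf fdf inner_commute)

text \<open>Convexity of \<psi> on the positive axis. The argument \<open>t = 0\<close> is
  admissible since the mean value theorem evaluates \<open>deriv \<psi>\<close> only at points
  strictly between \<open>t\<close> and \<open>s\<close>.\<close>

lemma psi_tangent_line:
  assumes "s > 0" "t \<ge> 0"
  shows "\<psi> s + deriv \<psi> s * (t - s) \<le> \<psi> t"
proof (cases "t = s")
  case False
  have mono: "deriv \<psi> a \<le> deriv \<psi> b" if "0 < a" "a \<le> b" for a b
    by (rule DERIV_nonneg_imp_nondecreasing[OF that(2)])
      (use psi_deriv2 psi''_nonneg that in \<open>meson less_le_trans\<close>)
  show ?thesis
  proof (cases "s < t")
    case True
    have "\<exists>z>s. z < t \<and> \<psi> t - \<psi> s = (t - s) * deriv \<psi> z" using True by (intro MVT2 psi_deriv)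
    then obtain z where z: "s < z" "z < t" "\<psi> t - \<psi> s = (t - s) * deriv \<psi> z" by blast
    then have "(t - s) * deriv \<psi> s \<le> (t - s) * deriv \<psi> z" using mono[of s z] assms by (intro mult_left_mono) auto
    then show ?thesis using z(3) by (simp add: mult.commute)
  next
    case ts: False
    then have "t < s" using \<open>t \<noteq> s\<close> by simp
    then have "\<exists>z>t. z < s \<and> \<psi> s - \<psi> t = (s - t) * deriv \<psi> z" by (intro MVT2 psi_deriv)
    then obtain z where z: "t < z" "z < s" "\<psi> s - \<psi> t = (s - t) * deriv \<psi> z" by blast
    then have "(s - t) * deriv \<psi> z \<le> (s - t) * deriv \<psi> s" using mono[of z s] assms by (intro mult_left_mono) auto
    then show ?thesis using z(3) by (simp add: algebra_simps)
  qed
qed simp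

end

section \<open>The two-point maximum principle\<close>

lemma line_deriv:
  fixes p :: "'a::real_normed_vector \<Rightarrow> real"
  shows "smooth p \<Longrightarrow> ((\<lambda>t. p (x + t *\<^sub>R a)) has_real_derivative dd a p (x + t *\<^sub>R a)) (at t)"
  using smooth_line[of p x a t UNIV] by (simp add: has_real_derivative_iff_has_vector_derivative)

lemma inner_line:
  fixes p q :: "'a::real_normed_vector \<Rightarrow> 'b::real_inner"
  assumes "smooth p" "smooth q"
  shows "((\<lambda>t. p (x + t *\<^sub>R a) \<bullet> q (y + t *\<^sub>R b)) has_real_derivative
    dd a p (x + t *\<^sub>R a) \<bullet> q (y + t *\<^sub>R b) + p (x + t *\<^sub>R a) \<bullet> dd b q (y + t *\<^sub>R b)) (at t)"
  using bounded_bilinear.has_vector_derivative[OF bounded_bilinear_inner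
      smooth_line[OF assms(1), of x a t UNIV] smooth_line[OF assms(2), of y b t UNIV]]
  by (simp add: has_real_derivative_iff_has_vector_derivative add.commute)

text \<open>The two-point function is restricted to a line moving both points, where a minimum has
  vanishing first and nonnegative second derivative. Moving one point alone gives the two
  first-order conditions.\<close>

lemma two_point_min:
  fixes f n :: "'a::euclidean_space \<Rightarrow> 'b::real_inner" and \<Phi> :: "'a \<Rightarrow> real"
  assumes f: "smooth f" and n: "smooth n" and p: "smooth \<Phi>"
    and min: "\<And>x' y'. 0 \<le> \<Phi> x' * (1 - f x' \<bullet> f y') + n x' \<bullet> f y'"
    and zero: "\<Phi> x * (1 - f x \<bullet> f y) + n x \<bullet> f y = 0"
  shows "dd w \<Phi> x * (1 - f x \<bullet> f y) - \<Phi> x * (dd w f x \<bullet> f y) + dd w n x \<bullet> f y = 0"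
    and "(n x - \<Phi> x *\<^sub>R f x) \<bullet> dd w f y = 0"
    and "smooth X \<Longrightarrow> 0 \<le> vd X (vd X \<Phi>) x * (1 - f x \<bullet> f y) - 2 * vd X \<Phi> x * (vd X f x \<bullet> f y + f x \<bullet> dd b f y)
      - \<Phi> x * (vd X (vd X f) x \<bullet> f y + 2 * (vd X f x \<bullet> dd b f y)) + vd X (vd X n) x \<bullet> f y + 2 * (vd X n x \<bullet> dd b f y)
      + (n x - \<Phi> x *\<^sub>R f x) \<bullet> dd b (dd b f) y"
proof -
  define z where "z a b t = \<Phi> (x + t *\<^sub>R a) * (1 - f (x + t *\<^sub>R a) \<bullet> f (y + t *\<^sub>R b)) + n (x + t *\<^sub>R a) \<bullet> f (y + t *\<^sub>R b)" for a b t
  define z' where "z' a b t = dd a \<Phi> (x + t *\<^sub>R a) * (1 - f (x + t *\<^sub>R a) \<bullet> f (y + t *\<^sub>R b))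
     - \<Phi> (x + t *\<^sub>R a) * (dd a f (x + t *\<^sub>R a) \<bullet> f (y + t *\<^sub>R b) + f (x + t *\<^sub>R a) \<bullet> dd b f (y + t *\<^sub>R b))
     + (dd a n (x + t *\<^sub>R a) \<bullet> f (y + t *\<^sub>R b) + n (x + t *\<^sub>R a) \<bullet> dd b f (y + t *\<^sub>R b))" for a b t
  define z2 where "z2 a b t = dd a (dd a \<Phi>) (x + t *\<^sub>R a) * (1 - f (x + t *\<^sub>R a) \<bullet> f (y + t *\<^sub>R b))
     - 2 * dd a \<Phi> (x + t *\<^sub>R a) * (dd a f (x + t *\<^sub>R a) \<bullet> f (y + t *\<^sub>R b) + f (x + t *\<^sub>R a) \<bullet> dd b f (y + t *\<^sub>R b))
     - \<Phi> (x + t *\<^sub>R a) * (dd a (dd a f) (x + t *\<^sub>R a) \<bullet> f (y + t *\<^sub>R b)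
         + 2 * (dd a f (x + t *\<^sub>R a) \<bullet> dd b f (y + t *\<^sub>R b)) + f (x + t *\<^sub>R a) \<bullet> dd b (dd b f) (y + t *\<^sub>R b))
     + dd a (dd a n) (x + t *\<^sub>R a) \<bullet> f (y + t *\<^sub>R b) + 2 * (dd a n (x + t *\<^sub>R a) \<bullet> dd b f (y + t *\<^sub>R b))
     + n (x + t *\<^sub>R a) \<bullet> dd b (dd b f) (y + t *\<^sub>R b)" for a b t
  note s = f n p smooth_dd[OF f] smooth_dd[OF n] smooth_dd[OF p]
  have d1: "(z a b has_real_derivative z' a b t) (at t)" for a b t
    unfolding z_def[abs_def] z'_def by (auto intro!: derivative_eq_intros line_deriv inner_line s simp: algebra_simps)
  have d2: "(z' a b has_real_derivative z2 a b t) (at t)" for a b t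
    unfolding z'_def[abs_def] z2_def
    by (auto intro!: derivative_eq_intros line_deriv inner_line s simp: algebra_simps)
  have m: "z a b 0 \<le> z a b t" for a b t using min[of "x + t *\<^sub>R a" "y + t *\<^sub>R b"] zero by (simp add: z_def)
  have r: "z' a b 0 = 0" "0 \<le> z2 a b 0" for a b using second_derivative_at_min[OF d1 d2 m, of a b] by auto
  have f0: "dd 0 f x = 0" "dd 0 n x = 0" "dd 0 \<Phi> x = 0" for x
    using linear_0[OF dd_linear] smooth_differentiable s(1-3) by blast+
  show 1: "dd w \<Phi> x * (1 - f x \<bullet> f y) - \<Phi> x * (dd w f x \<bullet> f y) + dd w n x \<bullet> f y = 0" for w
    using r(1)[of w 0] by (simp add: z'_def f0)
  show "(n x - \<Phi> x *\<^sub>R f x) \<bullet> dd w f y = 0"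
    using r(1)[of 0 w] by (simp add: z'_def f0 inner_diff_left)
  assume X: "smooth X"
  \<comment> \<open>Replacing the constant direction \<open>X x\<close> by the field adds
    derivatives along \<open>W\<close>; together they form the first-order condition in direction
    \<open>W\<close> and vanish.\<close>
  define W where "W = dd (X x) X x"
  have e: "dd (X x) (dd (X x) q) x = vd X (vd X q) x - dd W q x" if "smooth q" for q :: "'a \<Rightarrow> 'd::real_inner"
    unfolding vd_def[of X "vd X q"] dd_vd[OF X that] W_def by simp
  show "0 \<le> vd X (vd X \<Phi>) x * (1 - f x \<bullet> f y) - 2 * vd X \<Phi> x * (vd X f x \<bullet> f y + f x \<bullet> dd b f y)
      - \<Phi> x * (vd X (vd X f) x \<bullet> f y + 2 * (vd X f x \<bullet> dd b f y)) + vd X (vd X n) x \<bullet> f y + 2 * (vd X n x \<bullet> dd b f y)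
      + (n x - \<Phi> x *\<^sub>R f x) \<bullet> dd b (dd b f) y"
    using r(2)[of "X x" b] 1[of W] unfolding z2_def
    by (simp add: e[OF f] e[OF n] e[OF p] vd_def[of X f x, symmetric] vd_def[of X n x, symmetric] vd_def[of X \<Phi> x, symmetric]
       inner_diff_left algebra_simps)
qed

context principal_frame
begin

text \<open>The second derivative test is taken in the pairs (\<open>X x\<close>, \<open>b1\<close>)
  and (\<open>Y x\<close>, \<open>b2\<close>) and summed with the weights \<open>1 - P\<close> and
  \<open>1 + P\<close>. The sum compares the weighted Hessian \<open>L\<close> of \<Phi> with the
  bound \<open>R\<close> and yields the reverse of \<open>strict_supersolution\<close>.\<close>

lemma two_point_contradiction:
  assumes kap: "\<kappa> > 1"
  defines "\<Phi> \<equiv> (\<lambda>x. (\<psi> (u x) + \<kappa> * u x) / 2)"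
  assumes min: "\<And>x' y'. 0 \<le> \<Phi> x' * (1 - f x' \<bullet> f y') + n x' \<bullet> f y'"
    and zero: "\<Phi> x * (1 - f x \<bullet> f y) + n x \<bullet> f y = 0"
    and ne: "f x \<noteq> f y" and touch: "n x - \<Phi> x *\<^sub>R f x = n y - \<Phi> x *\<^sub>R f y"
  shows False
proof -
  have sP: "smooth \<Phi>" unfolding \<Phi>_def
    by (intro smooth_bounded_linear[OF bounded_linear_divide] smooth_intros smooth_psi_u smooth_u)
  note M = two_point_min[OF sm(1,2) sP min zero]
  let ?G = "f y"
  define F N E1 E2 where "F = f x" and "N = n x" and "E1 = e1 x" and "E2 = e2 x"
  define \<phi> where "\<phi> = \<Phi> x"
  define \<rho> where "\<rho> = 1 - F \<bullet> ?G"
  define c1 c2 where "c1 = E1 \<bullet> ?G" and "c2 = E2 \<bullet> ?G"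
  have FG: "F \<bullet> ?G = 1 - \<rho>" by (simp add: \<rho>_def)
  have NG: "N \<bullet> ?G = - (\<phi> * \<rho>)" using zero by (simp add: \<phi>_def \<rho>_def F_def N_def)
  have rho: "\<rho> > 0"
  proof -
    have "0 < (F - ?G) \<bullet> (F - ?G)" using ne by (simp add: F_def)
    also have "\<dots> = 2 * \<rho>" by (simp add: \<rho>_def F_def inner_diff_left inner_diff_right ff inner_commute)
    finally show ?thesis by simp
  qed
  have o: "F \<bullet> F = 1" "N \<bullet> N = 1" "E1 \<bullet> E1 = 1" "E2 \<bullet> E2 = 1" "?G \<bullet> ?G = 1"
    "E1 \<bullet> F = 0" "E2 \<bullet> F = 0" "N \<bullet> F = 0" "E1 \<bullet> N = 0" "E2 \<bullet> N = 0" "E1 \<bullet> E2 = 0"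
    "F \<bullet> E1 = 0" "F \<bullet> E2 = 0" "F \<bullet> N = 0" "N \<bullet> E1 = 0" "N \<bullet> E2 = 0" "E2 \<bullet> E1 = 0"
    "?G \<bullet> F = 1 - \<rho>" "?G \<bullet> E1 = c1" "?G \<bullet> E2 = c2"
    by (simp_all add: F_def N_def E1_def E2_def ortho FG[unfolded F_def, symmetric] c1_def c2_def inner_commute[of "f y"])
  have ny: "n y = N - \<phi> *\<^sub>R F + \<phi> *\<^sub>R ?G" using touch by (simp add: \<phi>_def F_def N_def algebra_simps)
  \<comment> \<open>the images of the principal directions under the reflection that exchanges \<open>f x\<close> and \<open>f y\<close>\<close>
  define T1 T2 where "T1 = E1 + (c1 / \<rho>) *\<^sub>R (F - ?G)" and "T2 = E2 + (c2 / \<rho>) *\<^sub>R (F - ?G)"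
  \<comment> \<open>By \<open>touch\<close> the reflection also carries \<open>n x\<close> to
    \<open>n y\<close>; hence the images are orthonormal and tangent at \<open>y\<close>.\<close>
  have T: "T1 \<bullet> ?G = 0" "T2 \<bullet> ?G = 0" "T1 \<bullet> n y = 0" "T2 \<bullet> n y = 0"
    "T1 \<bullet> T1 = 1" "T2 \<bullet> T2 = 1" "T1 \<bullet> T2 = 0" "F \<bullet> T1 = c1" "F \<bullet> T2 = c2" "E1 \<bullet> T1 = 1 - c1\<^sup>2 / \<rho>" "E2 \<bullet> T2 = 1 - c2\<^sup>2 / \<rho>"
    unfolding T1_def T2_def ny using rho NG NG[unfolded inner_commute[of N]]
    by (simp_all add: inner_add_left inner_add_right inner_diff_left inner_diff_right o FG c1_def[symmetric] c2_def[symmetric] field_simps power2_eq_square)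
  obtain b1 b2 where b: "dd b1 f y = T1" "dd b2 f y = T2" using tangent_dd[of T1 y] tangent_dd[of T2 y] T by blast
  define g' k' where "g' = g x" and "k' = k x"
  define l1 l2 where "l1 = h11 x" and "l2 = h22 x"
  define P P2 where "P = PP x" and "P2 = PP2 x"
  have lu: "l1 = (\<psi> (u x) + u x) / 2" "l2 = (\<psi> (u x) - u x) / 2" by (simp_all add: l1_def l2_def h_eq)
  have phi: "\<phi> = (\<psi> (u x) + \<kappa> * u x) / 2" by (simp add: \<phi>_def \<Phi>_def)
  have up: "u x > 0" by (rule u_pos')
  have pl: "\<phi> - l1 > 0" "\<phi> - l2 > 0"
  proof -
    have e: "\<phi> - l1 = (\<kappa> - 1) * u x / 2" "\<phi> - l2 = (\<kappa> + 1) * u x / 2" unfolding phi lu by (simp_all add: field_simps)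
    show "\<phi> - l1 > 0" "\<phi> - l2 > 0" unfolding e using kap up by simp_all
  qed
  have sVu: "smooth (vd V u)" if "smooth V" for V by (intro smooth_vd that smooth_u)
  have vP: "vd V \<Phi> x = (PP x + \<kappa>) / 2 * vd V u x" for V x
  proof -
    have "vd V (\<lambda>x. 1 / 2 * (\<psi> (u x) + \<kappa> * u x)) x = 1 / 2 * (PP x * vd V u x + \<kappa> * vd V u x)"
      by (simp only: vd_simps smooth_psi_u smooth_u vd_psi) simp
    moreover have "\<Phi> = (\<lambda>x. 1 / 2 * (\<psi> (u x) + \<kappa> * u x))" by (auto simp: \<Phi>_def)
    ultimately show ?thesis by (simp add: algebra_simps)
  qed
  have vP2: "vd V (vd V \<Phi>) x = (P + \<kappa>) / 2 * vd V (vd V u) x + P2 / 2 * (vd V u x)\<^sup>2" if "smooth V" for V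
  proof -
    have "vd V \<Phi> = (\<lambda>x. 1 / 2 * ((PP x + \<kappa>) * vd V u x))" using vP by auto
    moreover have "vd V (\<lambda>x. 1 / 2 * ((PP x + \<kappa>) * vd V u x)) x
       = 1 / 2 * (PP2 x * vd V u x * vd V u x + (PP x + \<kappa>) * vd V (vd V u) x)"
      by (simp only: vd_simps smooth_psi_u smooth_u vd_psi sVu[OF that]) simp
    ultimately show ?thesis by (simp add: P_def P2_def power2_eq_square field_simps)
  qed
  define Phi1 Phi2 Phi11 Phi22 where "Phi1 = vd X \<Phi> x" and "Phi2 = vd Y \<Phi> x"
    and "Phi11 = vd X (vd X \<Phi>) x" and "Phi22 = vd Y (vd Y \<Phi>) x"
  \<comment> \<open>The first-order conditions in the principal directions at \<open>x\<close> trade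
    \<open>c1\<close> and \<open>c2\<close> for derivatives of \<Phi>.\<close>
  have crit: "Phi1 * \<rho> = (\<phi> - l1) * c1" "Phi2 * \<rho> = (\<phi> - l2) * c2"
    using M(1)[of "X x"] M(1)[of "Y x"]
    by (simp_all add: vd_def[symmetric] D1n D2n h12_0 Phi1_def Phi2_def \<phi>_def[symmetric] l1_def l2_def \<rho>_def c1_def c2_def F_def E1_def E2_def algebra_simps)
  have D1n': "vd X (vd X n) x = vd X h11 x *\<^sub>R E1 + l1 *\<^sub>R vd X e1 x"
  proof -
    have "vd X n = (\<lambda>x. h11 x *\<^sub>R e1 x)" using D1n h12_0 by auto
    then show ?thesis by (simp add: vd_simps smh sme E1_def l1_def)
  qed
  have D2n': "vd Y (vd Y n) x = vd Y h22 x *\<^sub>R E2 + l2 *\<^sub>R vd Y e2 x"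
  proof -
    have "vd Y n = (\<lambda>x. h22 x *\<^sub>R e2 x)" using D2n h12_0 by auto
    then show ?thesis by (simp add: vd_simps smh sme E2_def l2_def)
  qed
  have A: "vd X e1 x \<bullet> ?G = - (1 - \<rho>) + l1 * (\<phi> * \<rho>) + g' * c2"
    "vd Y e2 x \<bullet> ?G = - (1 - \<rho>) + l2 * (\<phi> * \<rho>) - k' * c1"
    unfolding D1e1 D2e2 using FG NG
    by (simp_all add: inner_diff_left inner_add_left F_def N_def E1_def E2_def c1_def c2_def l1_def l2_def g'_def k'_def)
  \<comment> \<open>By \<open>touch\<close> the normal data at \<open>x\<close> may be replaced by
    those at \<open>y\<close>, so the second derivative at \<open>y\<close> is expressed by the
    second fundamental form at \<open>y\<close>.\<close>
  have Vb: "(n x - \<Phi> x *\<^sub>R f x) \<bullet> dd b (dd b f) y = \<phi> * (dd b f y \<bullet> dd b f y) - dd b n y \<bullet> dd b f y" for b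
  proof -
    have "n y \<bullet> dd b (dd b f) y = - (dd b n y \<bullet> dd b f y)"
      using dd_inner_eq_0[OF sm(2) smooth_dd[OF sm(1)], of b 0 b y] ndf by simp
    moreover have "f y \<bullet> dd b (dd b f) y = - (dd b f y \<bullet> dd b f y)"
      using dd_inner_eq_0[OF sm(1) smooth_dd[OF sm(1)], of b 0 b y] fdf by simp
    ultimately show ?thesis unfolding touch by (simp add: inner_diff_left \<phi>_def)
  qed
  have I1: "0 \<le> Phi11 * \<rho> - 4 * Phi1 * c1 - \<phi> * (- (1 - \<rho>) + l1 * (\<phi> * \<rho>) + g' * c2 + 2 * (1 - c1\<^sup>2 / \<rho>))
     + (vd X h11 x * c1 + l1 * (- (1 - \<rho>) + l1 * (\<phi> * \<rho>) + g' * c2)) + 2 * (l1 * (1 - c1\<^sup>2 / \<rho>)) + (\<phi> - dd b1 n y \<bullet> T1)"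
  proof -
    have v: "vd X f x = E1" "vd X n x = l1 *\<^sub>R E1" by (simp_all add: E1_def D1n h12_0 l1_def)
    show ?thesis using M(3)[OF sm(3), of b1] unfolding Vb b D1n' inner_add_left inner_scaleR_left A v T(5)
      by (simp add: T(8,10) c1_def[symmetric] \<phi>_def[symmetric] F_def[symmetric] FG Phi1_def Phi11_def algebra_simps)
  qed
  have I2: "0 \<le> Phi22 * \<rho> - 4 * Phi2 * c2 - \<phi> * (- (1 - \<rho>) + l2 * (\<phi> * \<rho>) - k' * c1 + 2 * (1 - c2\<^sup>2 / \<rho>))
     + (vd Y h22 x * c2 + l2 * (- (1 - \<rho>) + l2 * (\<phi> * \<rho>) - k' * c1)) + 2 * (l2 * (1 - c2\<^sup>2 / \<rho>)) + (\<phi> - dd b2 n y \<bullet> T2)"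
  proof -
    have v: "vd Y f x = E2" "vd Y n x = l2 *\<^sub>R E2" by (simp_all add: E2_def D2n h12_0 l2_def)
    show ?thesis using M(3)[OF sm(4), of b2] unfolding Vb b D2n' inner_add_left inner_scaleR_left A v T(6)
      by (simp add: T(9,11) c2_def[symmetric] \<phi>_def[symmetric] F_def[symmetric] FG Phi2_def Phi22_def algebra_simps)
  qed
  define H1 H2 where "H1 = dd b1 n y \<bullet> T1" and "H2 = dd b2 n y \<bullet> T2"
  have P: "0 \<le> P" "P < 1" unfolding P_def by (intro psi'_nonneg psi'_less_1 up)+
  \<comment> \<open>The weighted sum is \<open>H1 + H2 - P * (H1 - H2)\<close>. The trace
    \<open>H1 + H2\<close> equals \<open>\<psi> (u y)\<close>, the difference \<open>H1 - H2\<close>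
    is at most \<open>u y\<close>, and the tangent line of \<psi> at \<open>u x\<close> relates the
    two points.\<close>
  have concave: "(1 - P) * l1 + (1 + P) * l2 \<le> (1 - P) * H1 + (1 + P) * H2"
  proof -
    define p1 p2 q1 q2 where "p1 = T1 \<bullet> e1 y" and "p2 = T1 \<bullet> e2 y" and "q1 = T2 \<bullet> e1 y" and "q2 = T2 \<bullet> e2 y"
    have n: "p1\<^sup>2 + p2\<^sup>2 = 1" "q1\<^sup>2 + q2\<^sup>2 = 1" "p1 * q1 + p2 * q2 = 0"
      using T(5-7) tangent_norm[of b1 y b1] tangent_norm[of b2 y b2] tangent_norm[of b1 y b2]
      unfolding b by (simp_all add: p1_def p2_def q1_def q2_def power2_eq_square)
    have q: "q1\<^sup>2 = p2\<^sup>2" "q2\<^sup>2 = p1\<^sup>2"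
    proof -
      have "q1\<^sup>2 * (p1\<^sup>2 + p2\<^sup>2) = (p1 * q1)\<^sup>2 + q1\<^sup>2 * p2\<^sup>2" by (simp add: power2_eq_square algebra_simps)
      also have "p1 * q1 = - (p2 * q2)" using n(3) by simp
      also have "(- (p2 * q2))\<^sup>2 + q1\<^sup>2 * p2\<^sup>2 = p2\<^sup>2 * (q1\<^sup>2 + q2\<^sup>2)" by (simp add: power2_eq_square algebra_simps)
      finally show "q1\<^sup>2 = p2\<^sup>2" using n by simp
      then show "q2\<^sup>2 = p1\<^sup>2" using n(1,2) by simp
    qed
    have H: "H1 = h11 y * p1\<^sup>2 + h22 y * p2\<^sup>2" "H2 = h11 y * p2\<^sup>2 + h22 y * p1\<^sup>2"
      using dd_n_inner[of b1 y] dd_n_inner[of b2 y] unfolding b by (simp_all add: H1_def H2_def p1_def p2_def q[unfolded q1_def q2_def p1_def p2_def])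
    have "H1 + H2 = (h11 y + h22 y) * (p1\<^sup>2 + p2\<^sup>2)" unfolding H by (simp add: algebra_simps)
    then have s: "H1 + H2 = \<psi> (u y)" using weing[of y] n by (simp add: u_def)
    have "H1 - H2 = u y * (p1\<^sup>2 - p2\<^sup>2)" unfolding H u_def by (simp add: algebra_simps)
    also have "\<dots> \<le> u y * 1" using u_pos'[of y] n(1) zero_le_power2[of p2] by (intro mult_left_mono) linarith+
    finally have "P * (H1 - H2) \<le> P * u y" using P by (intro mult_left_mono) auto
    moreover have "\<psi> (u x) + P * (u y - u x) \<le> \<psi> (u y)"
      unfolding P_def using u_pos'[of y] by (intro psi_tangent_line up) auto
    ultimately have "\<psi> (u x) - P * u x \<le> (H1 + H2) - P * (H1 - H2)" using s by (simp add: algebra_simps)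
    then show ?thesis unfolding lu by (simp add: field_simps)
  qed
  have cod: "vd X h11 x = (P + 1) / 2 * vd X u x" "vd Y h22 x = (P - 1) / 2 * vd Y u x"
    "g' * u x = (1 + P) / 2 * vd Y u x" "k' * u x = - ((1 - P) / 2) * vd X u x"
    by (simp_all add: vd_h P_def gk g'_def k'_def)
  define L where "L = (1 - P) * (Phi11 - g' * Phi2) + (1 + P) * (Phi22 + k' * Phi1)"
  define R where "R = (1 - P) * (\<phi> - l1) * (1 + l1 * \<phi>) + (1 + P) * (\<phi> - l2) * (1 + l2 * \<phi>)
      + 2 * ((1 - P) * Phi1\<^sup>2 / (\<phi> - l1) + (1 + P) * Phi2\<^sup>2 / (\<phi> - l2))"
  have "L < R" unfolding L_def R_def
  proof (rule strict_supersolution[OF up P _ _ _ kap _ _ lu phi])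
    show "0 \<le> P2" "u x * P2 \<le> 1 - P\<^sup>2" "u x * P < \<psi> (u x)"
      unfolding P_def P2_def by (intro psi''_nonneg psi''_le psi'_less_psi up)+
    show "g' = (1 + P) * vd Y u x / (2 * u x)" "k' = - (1 - P) * vd X u x / (2 * u x)"
      unfolding g'_def k'_def P_def by (rule gk')+
    show "(1 - P) * vd X (vd X u) x + (1 + P) * vd Y (vd Y u) x
       = 2 * u x * (1 + l1 * l2 + g'\<^sup>2 + k'\<^sup>2) + P2 * ((vd X u x)\<^sup>2 - (vd Y u x)\<^sup>2) + 2 * g' * vd Y u x - 2 * k' * vd X u x"
      unfolding P_def P2_def l1_def l2_def g'_def k'_def by (rule simons)
  qed (simp_all add: Phi1_def Phi2_def Phi11_def Phi22_def vP vP2 sm P_def[symmetric])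
  moreover have "\<rho> * R \<le> \<rho> * L"
  proof -
    \<comment> \<open>Under the first-order conditions the quadratic terms of \<open>R\<close> and
      those of the second derivative test both become multiples of \<open>Phi1 * c1\<close> and
      \<open>Phi2 * c2\<close>.\<close>
    have qq: "r * (A\<^sup>2 / D) = A * c" "D * (c\<^sup>2 / r) = A * c" if "A * r = D * c" "D > 0" "r > 0" for A D c r :: real
    proof -
      have "r * (A\<^sup>2 / D) = A * (A * r) / D" by (simp add: power2_eq_square mult_ac)
      then show "r * (A\<^sup>2 / D) = A * c" using that by simp
      have "D * (c\<^sup>2 / r) = (D * c) * c / r" by (simp add: power2_eq_square mult_ac)
      then show "D * (c\<^sup>2 / r) = A * c" using that(3) by (simp flip: that(1))
    qed
    note q = qq(1)[OF crit(1) pl(1) rho] qq(1)[OF crit(2) pl(2) rho]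
    note q' = qq(2)[OF crit(1) pl(1) rho] qq(2)[OF crit(2) pl(2) rho]
    have lw: "l1 = l2 + u x" unfolding lu by (simp add: field_simps)
    \<comment> \<open>The derivatives of the principal curvatures cancel against part of the
      connection terms; what is left are the connection terms of \<open>L\<close>.\<close>
    have w: "(1 - P) * (vd X h11 x * c1 - (\<phi> - l1) * (g' * c2)) + (1 + P) * (vd Y h22 x * c2 + (\<phi> - l2) * (k' * c1))
       = - (1 - P) * (g' * (Phi2 * \<rho>)) + (1 + P) * (k' * (Phi1 * \<rho>))"
    proof -
      have eqs: "(\<phi> - l1) * (g' * c2) = g' * (Phi2 * \<rho>) - (g' * u x) * c2" "(\<phi> - l2) * (k' * c1) = k' * (Phi1 * \<rho>) + (k' * u x) * c1"
        unfolding crit lw by (simp_all add: algebra_simps)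
      show ?thesis unfolding eqs cod by (simp add: field_simps)
    qed
    define w1 w2 where "w1 = c1\<^sup>2 / \<rho>" and "w2 = c2\<^sup>2 / \<rho>"
    let ?I1 = "Phi11 * \<rho> - 4 * Phi1 * c1 - \<phi> * (- (1 - \<rho>) + l1 * (\<phi> * \<rho>) + g' * c2 + 2 * (1 - c1\<^sup>2 / \<rho>))
     + (vd X h11 x * c1 + l1 * (- (1 - \<rho>) + l1 * (\<phi> * \<rho>) + g' * c2)) + 2 * (l1 * (1 - c1\<^sup>2 / \<rho>)) + (\<phi> - dd b1 n y \<bullet> T1)"
    let ?I2 = "Phi22 * \<rho> - 4 * Phi2 * c2 - \<phi> * (- (1 - \<rho>) + l2 * (\<phi> * \<rho>) - k' * c1 + 2 * (1 - c2\<^sup>2 / \<rho>))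
     + (vd Y h22 x * c2 + l2 * (- (1 - \<rho>) + l2 * (\<phi> * \<rho>) - k' * c1)) + 2 * (l2 * (1 - c2\<^sup>2 / \<rho>)) + (\<phi> - dd b2 n y \<bullet> T2)"
    have e1: "?I1 = Phi11 * \<rho> - 2 * (Phi1 * c1) - \<rho> * ((\<phi> - l1) * (1 + l1 * \<phi>)) + (vd X h11 x * c1 - (\<phi> - l1) * (g' * c2)) + (l1 - H1)"
      using q'(1) unfolding H1_def w1_def[symmetric] by (simp add: algebra_simps)
    have e2: "?I2 = Phi22 * \<rho> - 2 * (Phi2 * c2) - \<rho> * ((\<phi> - l2) * (1 + l2 * \<phi>)) + (vd Y h22 x * c2 + (\<phi> - l2) * (k' * c1)) + (l2 - H2)"
      using q'(2) unfolding H2_def w2_def[symmetric] by (simp add: algebra_simps)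
    have "0 \<le> (1 - P) * ?I1 + (1 + P) * ?I2" by (rule add_nonneg_nonneg[OF mult_nonneg_nonneg[OF _ I1] mult_nonneg_nonneg[OF _ I2]]) (use P in simp_all)
    also have "\<dots> = \<rho> * ((1 - P) * Phi11 + (1 + P) * Phi22)
       - \<rho> * ((1 - P) * (\<phi> - l1) * (1 + l1 * \<phi>) + (1 + P) * (\<phi> - l2) * (1 + l2 * \<phi>))
       - 2 * ((1 - P) * (Phi1 * c1) + (1 + P) * (Phi2 * c2))
       + ((1 - P) * (vd X h11 x * c1 - (\<phi> - l1) * (g' * c2)) + (1 + P) * (vd Y h22 x * c2 + (\<phi> - l2) * (k' * c1)))
       + ((1 - P) * l1 + (1 + P) * l2 - ((1 - P) * H1 + (1 + P) * H2))"
      unfolding e1 e2 by (simp add: algebra_simps)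
    also have "\<dots> \<le> \<rho> * ((1 - P) * Phi11 + (1 + P) * Phi22)
       - \<rho> * ((1 - P) * (\<phi> - l1) * (1 + l1 * \<phi>) + (1 + P) * (\<phi> - l2) * (1 + l2 * \<phi>))
       - 2 * ((1 - P) * (Phi1 * c1) + (1 + P) * (Phi2 * c2))
       + (- (1 - P) * (g' * (Phi2 * \<rho>)) + (1 + P) * (k' * (Phi1 * \<rho>)))"
      unfolding w using concave by linarith
    also have "\<dots> = \<rho> * L - \<rho> * R"
      unfolding q[symmetric] L_def R_def by (simp add: algebra_simps)
    finally show ?thesis by simp
  qed
  ultimately show False using rho by simp
qed

end

section \<open>Embedded tori\<close>

text \<open>The dependence on the direction is quadratic with continuous coefficients, which makes
  the Hessian jointly continuous in point and direction.\<close>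

lemma dd2_expand:
  fixes p :: "real ^ 2 \<Rightarrow> 'b::real_inner"
  assumes p: "smooth p"
  shows "dd v (dd v p) x = (v $ 1)\<^sup>2 *\<^sub>R dd p1 (dd p1 p) x + (2 * v $ 1 * v $ 2) *\<^sub>R dd p1 (dd p2 p) x + (v $ 2)\<^sup>2 *\<^sub>R dd p2 (dd p2 p) x"
proof -
  have e: "dd v q x = (v $ 1) *\<^sub>R dd p1 q x + (v $ 2) *\<^sub>R dd p2 q x" if "smooth q" for q :: "real ^ 2 \<Rightarrow> 'b" and x
    by (subst pt_components[of v]) (simp only: dd_vadd dd_vscale smooth_differentiable[OF that])
  have "dd v p = (\<lambda>x. (v $ 1) *\<^sub>R dd p1 p x + (v $ 2) *\<^sub>R dd p2 p x)" using e[OF p] by auto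
  moreover have "(2 * v $ 1 * v $ 2) *\<^sub>R z = (v $ 1 * v $ 2) *\<^sub>R z + (v $ 1 * v $ 2) *\<^sub>R z" for z :: 'b
    by (simp add: scaleR_add_left[symmetric])
  ultimately show ?thesis
    by (simp add: e[OF smooth_dd[OF p]] dd_add dd_scaleR dd_const smooth_differentiable smooth_scaleR smooth_const smooth_dd p
       dd_commute[OF p, of p2 p1] scaleR_add_right power2_eq_square algebra_simps e smooth_add)
qed

lemma dd2_scale:
  assumes p: "smooth p"
  shows "dd (c *\<^sub>R v) (dd (c *\<^sub>R v) p) x = c\<^sup>2 *\<^sub>R dd v (dd v p) x"
proof -
  have e: "dd (c *\<^sub>R v) q = (\<lambda>x. c *\<^sub>R dd v q x)" if "smooth q" for q
    using smooth_differentiable[OF that] by (auto simp: dd_vscale)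
  show ?thesis unfolding e[OF p]
    by (simp add: dd_vscale dd_scaleR dd_const smooth_differentiable smooth_scaleR smooth_const smooth_dd p power2_eq_square)
qed

context torus_surface
begin

lemma latt: "lat i j + lat i' j' = lat (i + i') (j + j')" "- lat i j = lat (- i) (- j)"
  by (simp_all add: lat_def algebra_simps)

end

locale embedded_torus = torus_surface +
  assumes emb: "f x = f y \<Longrightarrow> \<exists>i j. y = x + lat i j"
begin

abbreviation "fund \<equiv> cbox 0 (pt (2 * pi) (2 * pi))"

lemma contf: "continuous_on S f" and contn: "continuous_on S n" by (intro smooth_continuous smf smn)+

lemma n_eq: "f x = f y \<Longrightarrow> n x = n y" using emb pern by metis

text \<open>Uniform continuity of the inverse of the embedding: the distance in space has a positive
  minimum on the compact set of pairs in the fundamental square that stay apart modulo the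
  lattice.\<close>

lemma close_in_space:
  assumes "d > 0"
  obtains e where "e > 0" "\<And>x y. norm (f x - f y) < e \<Longrightarrow> \<exists>i j. norm (y + lat i j - x) < d"
proof -
  define S where "S = (fund \<times> fund) \<inter> (\<Inter>(i, j)\<in>UNIV. {z. d \<le> norm (snd z + lat i j - fst z)})"
  have "closed {z :: (real ^ 2) \<times> (real ^ 2). d \<le> norm (snd z + lat i j - fst z)}" for i j
    by (intro closed_Collect_le continuous_intros)
  then have cS: "compact S" unfolding S_def
    by (intro compact_Int_closed compact_Times compact_cbox closed_INT) auto
  obtain e where e: "e > 0" "\<And>x y. (x, y) \<in> S \<Longrightarrow> e \<le> norm (f x - f y)"
  proof (cases "S = {}")
    case True
    then show thesis using that[of 1] by auto
  next
    case False
    have "continuous_on S (\<lambda>z. norm (f (fst z) - f (snd z)))"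
      by (intro continuous_intros continuous_on_compose2[OF contf[of UNIV]]) auto
    from continuous_attains_inf[OF cS False this] obtain z where z: "z \<in> S"
      "\<And>y. y \<in> S \<Longrightarrow> norm (f (fst z) - f (snd z)) \<le> norm (f (fst y) - f (snd y))" by auto
    have "f (fst z) \<noteq> f (snd z)"
    proof
      assume "f (fst z) = f (snd z)"
      then obtain i j where "snd z = fst z + lat i j" using emb by blast
      then have "norm (snd z + lat (- i) (- j) - fst z) = 0" by (simp add: latt(2)[symmetric])
      moreover have "d \<le> norm (snd z + lat (- i) (- j) - fst z)" using z(1) by (auto simp: S_def)
      ultimately show False using assms by simp
    qed
    then show thesis using z(2) by (intro that[of "norm (f (fst z) - f (snd z))"]) auto
  qed
  show thesis
  proof (rule that[OF e(1)])
    fix x y assume xy: "norm (f x - f y) < e"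
    obtain i j where i: "x + lat i j \<in> fund" using lattice_reduce by blast
    obtain k l where k: "y + lat k l \<in> fund" using lattice_reduce by blast
    have "(x + lat i j, y + lat k l) \<notin> S" using e(2)[of "x + lat i j" "y + lat k l"] xy by (auto simp: perf)
    then obtain a b where "norm (y + lat k l + lat a b - (x + lat i j)) < d" using i k by (auto simp: S_def not_le)
    moreover have "y + lat k l + lat a b - (x + lat i j) = y + lat (k + a - i) (l + b - j) - x"
      by (simp add: lat_def algebra_simps)
    ultimately show "\<exists>i j. norm (y + lat i j - x) < d" by metis
  qed
qed

text \<open>For fixed \<open>x\<close> the function \<open>V x \<bullet> f\<close> is critical at
  \<open>x\<close> with positive Hessian. Compactness of the unit directions over the fundamental
  square makes the size of the neighbourhood uniform, and \<open>close_in_space\<close> converts it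
  into a distance in space.\<close>

lemma near_diagonal:
  assumes V: "continuous_on UNIV V" and per: "\<And>i j x. V (x + lat i j) = V x"
    and tang: "\<And>v x. V x \<bullet> dd v f x = 0"
    and pos: "\<And>v x. v \<noteq> 0 \<Longrightarrow> V x \<bullet> dd v (dd v f) x > 0"
  obtains e where "e > 0" "\<And>x y. f x \<noteq> f y \<Longrightarrow> norm (f x - f y) < e \<Longrightarrow> V x \<bullet> f x < V x \<bullet> f y"
proof -
  define H where "H = (\<lambda>(x, y, v). V x \<bullet> dd v (dd v f) y)"
  have contd: "continuous_on S (dd v (dd w f))" for S v w by (intro smooth_continuous smooth_dd smf)
  have Heq: "H = (\<lambda>z. V (fst z) \<bullet> ((snd (snd z) $ 1)\<^sup>2 *\<^sub>R dd p1 (dd p1 f) (fst (snd z))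
      + (2 * snd (snd z) $ 1 * snd (snd z) $ 2) *\<^sub>R dd p1 (dd p2 f) (fst (snd z)) + (snd (snd z) $ 2)\<^sup>2 *\<^sub>R dd p2 (dd p2 f) (fst (snd z))))"
    unfolding H_def case_prod_unfold by (rule ext, rule arg_cong[OF dd2_expand[OF smf]])
  have HV: "continuous_on S H" for S
    unfolding Heq
    by (intro continuous_intros continuous_on_compose2[OF V] continuous_on_compose2[OF contd[of UNIV]] continuous_on_component) auto
  let ?K = "fund \<times> sphere 0 1 :: ((real ^ 2) \<times> (real ^ 2)) set"
  have ne: "?K \<noteq> {}" using lattice_reduce[of 0] by auto
  have "continuous_on ?K (\<lambda>z. H (fst z, fst z, snd z))"
    by (intro continuous_on_compose2[OF HV[of UNIV]] continuous_intros) auto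
  from continuous_attains_inf[OF compact_Times[OF compact_cbox compact_sphere] ne this]
  obtain z where z: "z \<in> ?K" "\<And>w. w \<in> ?K \<Longrightarrow> H (fst z, fst z, snd z) \<le> H (fst w, fst w, snd w)" by auto
  define m where "m = H (fst z, fst z, snd z)"
  have m: "m > 0" unfolding m_def H_def using z(1) by (auto intro!: pos)
  obtain R where R: "\<And>x. x \<in> fund \<Longrightarrow> norm x \<le> R"
    using bounded_cbox[of "0 :: real ^ 2" "pt (2 * pi) (2 * pi)"] by (auto simp: bounded_iff)
  let ?C = "fund \<times> cball 0 (R + 1) \<times> sphere 0 1 :: ((real ^ 2) \<times> (real ^ 2) \<times> (real ^ 2)) set"
  have "uniformly_continuous_on ?C H"
    by (intro compact_uniformly_continuous HV compact_Times compact_cbox compact_cball compact_sphere)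
  then obtain d0 where d0: "d0 > 0" "\<And>a b. a \<in> ?C \<Longrightarrow> b \<in> ?C \<Longrightarrow> dist b a < d0 \<Longrightarrow> dist (H b) (H a) < m"
    using m unfolding uniformly_continuous_on_def by metis
  \<comment> \<open>The bound 1 keeps \<open>y\<close> in the ball of radius \<open>R + 1\<close>,
    on which \<open>H\<close> is uniformly continuous.\<close>
  define d where "d = min d0 1"
  have d: "d > 0" using d0 by (simp add: d_def)
  have Hpos: "V x \<bullet> dd v (dd v f) y > 0" if x: "x \<in> fund" and xy: "norm (y - x) < d" and v: "v \<noteq> 0" for x y v
  proof -
    define w where "w = v /\<^sub>R norm v"
    have w: "norm w = 1" using v by (simp add: w_def)
    have "norm y \<le> R + 1" using R[OF x] xy norm_triangle_ineq[of x "y - x"] by (simp add: d_def)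
    then have "dist (H (x, y, w)) (H (x, x, w)) < m"
      using R[OF x] x w xy by (intro d0(2)) (auto simp: dist_Pair_Pair dist_norm d_def)
    moreover have "m \<le> H (x, x, w)" using z(2)[of "(x, w)"] x w by (simp add: m_def)
    ultimately have "H (x, y, w) > 0" by (simp add: dist_real_def)
    moreover have "v = norm v *\<^sub>R w" using v by (simp add: w_def)
    then have "dd v (dd v f) y = (norm v)\<^sup>2 *\<^sub>R dd w (dd w f) y"
      by (metis dd2_scale[OF smf])
    ultimately show ?thesis using v by (simp add: H_def)
  qed
  obtain e where e: "e > 0" "\<And>x y. norm (f x - f y) < e \<Longrightarrow> \<exists>i j. norm (y + lat i j - x) < d"
    using close_in_space[OF d] by metis
  show thesis
  proof (rule that[OF e(1)])
    fix x y assume ne: "f x \<noteq> f y" and xy: "norm (f x - f y) < e"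
    obtain i j where i: "x + lat i j \<in> fund" using lattice_reduce by blast
    define x' where "x' = x + lat i j"
    have x': "f x' = f x" "V x' = V x" "x' \<in> fund" using i by (auto simp: x'_def perf per)
    obtain k l where k: "norm (y + lat k l - x') < d" using e(2)[of x' y] xy x' by auto
    define v where "v = y + lat k l - x'"
    have fy: "f (x' + 1 *\<^sub>R v) = f y" by (simp add: v_def perf)
    have v: "v \<noteq> 0" using fy ne x'(1) by auto
    let ?p = "\<lambda>z. V x' \<bullet> f z"
    have sp: "smooth ?p" by (intro smooth_intros smf)
    have dp: "dd w ?p = (\<lambda>z. V x' \<bullet> dd w f z)" for w by (rule ext) (simp add: dd_inner dd_const smooth_differentiable smooth_const smf)
    have sdf: "smooth (dd w f)" for w by (intro smooth_dd smf)
    have ddp: "dd w (dd w ?p) = (\<lambda>z. V x' \<bullet> dd w (dd w f) z)" for w unfolding dp by (rule ext) (simp add: dd_inner dd_const smooth_differentiable smooth_const sdf)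
    obtain s where s: "0 < s" "s < 1" "?p (x' + 1 *\<^sub>R v) - ?p x' = 1 * dd v ?p (x' + s *\<^sub>R v)"
      by (rule smooth_line_mvt[OF sp zero_less_one])
    obtain t where t: "0 < t" "t < s" "dd v ?p (x' + s *\<^sub>R v) - dd v ?p x' = s * dd v (dd v ?p) (x' + t *\<^sub>R v)"
      by (rule smooth_line_mvt[OF smooth_dd[OF sp] s(1)])
    have "norm (x' + t *\<^sub>R v - x') < d"
    proof -
      have "t * norm v \<le> 1 * norm v" using s t by (intro mult_right_mono) auto
      then show ?thesis using t k by (simp add: v_def)
    qed
    then have "V x' \<bullet> dd v (dd v f) (x' + t *\<^sub>R v) > 0" by (intro Hpos x' v)
    then have "0 < ?p (x' + 1 *\<^sub>R v) - ?p x'"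
      using s(1) t(3)[unfolded ddp] \<open>V x' \<bullet> dd v (dd v f) (x' + t *\<^sub>R v) > 0\<close> tang[of x' v] unfolding s(3) by (simp add: dp)
    then show "V x \<bullet> f x < V x \<bullet> f y" unfolding fy x' by simp
  qed
qed

lemma f_dd2: "f x \<bullet> dd v (dd v f) x = - (dd v f x \<bullet> dd v f x)" and n_dd2: "n x \<bullet> dd v (dd v f) x = - (dd v n x \<bullet> dd v f x)"
  using dd_inner_eq_0[OF smf smooth_dd[OF smf], of v 0 v x] gs.fdf dd_inner_eq_0[OF smn smooth_dd[OF smf], of v 0 v x] ndf by simp_all

text \<open>As \<open>1 - f x \<bullet> f y\<close> is half the squared distance, this says that at
  each point balls of curvature \<open>C\<close> touch the surface on both sides without being
  entered. Near the diagonal a bound \<open>A\<close> for the second fundamental form suffices; at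
  distance at least \<open>e\<close> the constant \<open>2 / e\<^sup>2\<close> does.\<close>

lemma quadratic_estimate:
  obtains C where "C > 0" "\<And>x y. \<bar>n x \<bullet> f y\<bar> \<le> C * (1 - f x \<bullet> f y)"
proof -
  have contc: "continuous_on UNIV gs.h11" "continuous_on UNIV gs.h12" "continuous_on UNIV gs.h22"
    by (intro smooth_continuous gs.smh)+
  obtain z where z: "\<And>x. \<bar>gs.h11 x\<bar> + \<bar>gs.h12 x\<bar> + \<bar>gs.h22 x\<bar> \<le> \<bar>gs.h11 z\<bar> + \<bar>gs.h12 z\<bar> + \<bar>gs.h22 z\<bar>"
    by (rule periodic_attains_max[of "\<lambda>x. \<bar>gs.h11 x\<bar> + \<bar>gs.h12 x\<bar> + \<bar>gs.h22 x\<bar>"]) (auto simp: per_h intro!: continuous_intros contc)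
  define A where "A = \<bar>gs.h11 z\<bar> + \<bar>gs.h12 z\<bar> + \<bar>gs.h22 z\<bar> + 1"
  have A: "A > 0" by (simp add: A_def)
  have hbound: "\<bar>dd v n x \<bullet> dd v f x\<bar> < A * (dd v f x \<bullet> dd v f x)" if v: "v \<noteq> 0" for v x
  proof -
    define a b where "a = dd v f x \<bullet> gs.e1 x" and "b = dd v f x \<bullet> gs.e2 x"
    have dvf: "dd v f x = a *\<^sub>R gs.e1 x + b *\<^sub>R gs.e2 x" unfolding a_def b_def by (rule gs.dd_decomp[OF df])
    have dvn: "dd v n x = a *\<^sub>R vd gX n x + b *\<^sub>R vd gY n x" unfolding a_def b_def
      by (rule gs.dd_decomp[OF smooth_differentiable[OF smn]])
    have q: "dd v n x \<bullet> dd v f x = gs.h11 x * a\<^sup>2 + gs.h12 x * (2 * a * b) + gs.h22 x * b\<^sup>2"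
      unfolding dvn gs.D1n gs.D2n by (subst dvf) (simp add: inner_simps gs.ortho power2_eq_square algebra_simps)
    have nn: "dd v f x \<bullet> dd v f x = a\<^sup>2 + b\<^sup>2" unfolding dvf by (simp add: inner_simps gs.ortho power2_eq_square)
    have pos: "a\<^sup>2 + b\<^sup>2 > 0" using inj[of v x] v unfolding nn[symmetric] by auto
    have ab: "\<bar>2 * a * b\<bar> \<le> a\<^sup>2 + b\<^sup>2"
      using zero_le_power2[of "a + b"] zero_le_power2[of "a - b"] by (simp add: abs_le_iff power2_eq_square algebra_simps)
    have "\<bar>dd v n x \<bullet> dd v f x\<bar> \<le> \<bar>gs.h11 x\<bar> * a\<^sup>2 + \<bar>gs.h12 x\<bar> * \<bar>2 * a * b\<bar> + \<bar>gs.h22 x\<bar> * b\<^sup>2"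
      unfolding q by (intro order_trans[OF abs_triangle_ineq] add_mono order_trans[OF abs_triangle_ineq]) (auto simp: abs_mult)
    also have "\<dots> \<le> \<bar>gs.h11 x\<bar> * (a\<^sup>2 + b\<^sup>2) + \<bar>gs.h12 x\<bar> * (a\<^sup>2 + b\<^sup>2) + \<bar>gs.h22 x\<bar> * (a\<^sup>2 + b\<^sup>2)"
      by (intro add_mono mult_left_mono ab) auto
    also have "\<dots> = (\<bar>gs.h11 x\<bar> + \<bar>gs.h12 x\<bar> + \<bar>gs.h22 x\<bar>) * (a\<^sup>2 + b\<^sup>2)" by (simp add: algebra_simps)
    also have "\<dots> < A * (a\<^sup>2 + b\<^sup>2)" using z[of x] pos by (intro mult_strict_right_mono) (auto simp: A_def)
    finally show ?thesis unfolding nn .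
  qed
  have nd: "\<exists>e>0. \<forall>x y. f x \<noteq> f y \<longrightarrow> norm (f x - f y) < e \<longrightarrow> s * (n x \<bullet> f y) > - A * (1 - f x \<bullet> f y)" if s: "s = 1 \<or> s = - 1" for s :: real
  proof -
    define V where "V x = s *\<^sub>R n x - A *\<^sub>R f x" for x
    have "\<exists>e>0. \<forall>x y. f x \<noteq> f y \<longrightarrow> norm (f x - f y) < e \<longrightarrow> V x \<bullet> f x < V x \<bullet> f y"
    proof (rule near_diagonal[of V])
      show "continuous_on UNIV V" unfolding V_def[abs_def] by (intro continuous_intros contf contn)
      show "V (x + lat i j) = V x" for x i j by (simp add: V_def perf pern)
      show "V x \<bullet> dd v f x = 0" for x v by (simp add: V_def inner_diff_left ndf gs.fdf)
      show "V x \<bullet> dd v (dd v f) x > 0" if "v \<noteq> 0" for x v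
        using hbound[OF that, of x] s by (auto simp: V_def inner_diff_left f_dd2 n_dd2)
    qed blast
    moreover have "V x \<bullet> f x = - A" "V x \<bullet> f y = s * (n x \<bullet> f y) - A * (f x \<bullet> f y)" for x y
      by (simp_all add: V_def inner_diff_left ff nf)
    ultimately show ?thesis by (simp add: algebra_simps)
  qed
  obtain e1 where e1: "e1 > 0" "\<And>x y. f x \<noteq> f y \<Longrightarrow> norm (f x - f y) < e1 \<Longrightarrow> n x \<bullet> f y > - A * (1 - f x \<bullet> f y)"
    using nd[of 1] by auto
  obtain e2 where e2: "e2 > 0" "\<And>x y. f x \<noteq> f y \<Longrightarrow> norm (f x - f y) < e2 \<Longrightarrow> - (n x \<bullet> f y) > - A * (1 - f x \<bullet> f y)"
    using nd[of "-1"] by auto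
  define e where "e = min e1 e2"
  have e: "e > 0" using e1 e2 by (simp add: e_def)
  have rho: "1 - f x \<bullet> f y = (norm (f x - f y))\<^sup>2 / 2" for x y
    by (simp add: power2_norm_eq_inner inner_diff_left inner_diff_right ff inner_commute)
  show thesis
  proof (rule that[of "max A (2 / e\<^sup>2)"])
    show "0 < max A (2 / e\<^sup>2)" using A by simp
    fix x y
    consider "f x = f y" | "f x \<noteq> f y" "norm (f x - f y) < e" | "norm (f x - f y) \<ge> e" by linarith
    then show "\<bar>n x \<bullet> f y\<bar> \<le> max A (2 / e\<^sup>2) * (1 - f x \<bullet> f y)"
    proof cases
      case 1
      then show ?thesis using nf[of x] ff[of y] by (simp add: 1[symmetric])
    next
      case 2
      then have "\<bar>n x \<bullet> f y\<bar> \<le> A * (1 - f x \<bullet> f y)" using e1(2)[of x y] e2(2)[of x y] by (auto simp: e_def)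
      also have "\<dots> \<le> max A (2 / e\<^sup>2) * (1 - f x \<bullet> f y)" unfolding rho by (intro mult_right_mono) auto
      finally show ?thesis .
    next
      case 3
      have "\<bar>n x \<bullet> f y\<bar> \<le> norm (n x) * norm (f y)" by (rule Cauchy_Schwarz_ineq2)
      also have "\<dots> = 1" by (simp add: norm_eq_sqrt_inner nn ff)
      also have "\<dots> = 2 / e\<^sup>2 * (e\<^sup>2 / 2)" using e by simp
      also have "\<dots> \<le> 2 / e\<^sup>2 * (1 - f x \<bullet> f y)" unfolding rho using 3 e by (intro mult_left_mono divide_right_mono power_mono) auto
      also have "\<dots> \<le> max A (2 / e\<^sup>2) * (1 - f x \<bullet> f y)" unfolding rho by (intro mult_right_mono) auto
      finally show ?thesis .
    qed
  qed
qed

end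

section \<open>The two sides of an embedded torus\<close>

context embedded_torus
begin

text \<open>For unit vectors \<open>p\<close> this is the cosine of the spherical distance from
  \<open>p\<close> to the torus.\<close>

definition height :: "real ^ 4 \<Rightarrow> real" where
  "height p = (SUP z. p \<bullet> f z)"

text \<open>Unit vectors that have a nearest point on the torus from which they lie in the direction
  of \<open>s *\<^sub>R n\<close> or on the torus itself or orthogonal to its normal there. The weak
  inequality lets the sides overlap and makes both of them closed.\<close>

definition side :: "real \<Rightarrow> (real ^ 4) set" where
  "side s = {p \<in> sphere 0 1. \<exists>z. (\<forall>w. p \<bullet> f w \<le> p \<bullet> f z) \<and> s * (p \<bullet> n z) \<ge> 0}"

lemma norm_f: "norm (f x) = 1"
  by (simp add: norm_eq_sqrt_inner ff)

lemma height_attained: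
  obtains z where "\<And>w. p \<bullet> f w \<le> p \<bullet> f z" "height p = p \<bullet> f z"
proof -
  obtain z where z: "\<And>w. p \<bullet> f w \<le> p \<bullet> f z"
    by (rule periodic_attains_max[of "\<lambda>w. p \<bullet> f w"]) (auto simp: perf intro!: continuous_intros contf)
  have "height p = p \<bullet> f z" unfolding height_def
    by (rule cSup_eq_maximum) (use z in auto)
  then show thesis using z that by blast
qed

lemma height_eq: "(\<And>w. p \<bullet> f w \<le> p \<bullet> f z) \<Longrightarrow> height p = p \<bullet> f z"
  unfolding height_def by (rule cSup_eq_maximum) auto

lemma height_ge: "p \<bullet> f w \<le> height p"
  by (metis height_attained)

lemma height_le: "norm p = 1 \<Longrightarrow> height p \<le> 1"
  by (metis height_attained norm_cauchy_schwarz norm_f mult_1)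

lemma height_cont: "continuous_on S height"
proof -
  have "height p - height q \<le> dist p q" for p q
  proof -
    obtain z where z: "height p = p \<bullet> f z" by (rule height_attained)
    have "height p - height q \<le> p \<bullet> f z - q \<bullet> f z" using height_ge[of q z] z by simp
    also have "\<dots> = (p - q) \<bullet> f z" by (simp add: inner_diff_left)
    also have "\<dots> \<le> norm (p - q) * norm (f z)" by (rule norm_cauchy_schwarz)
    finally show ?thesis by (simp add: norm_f dist_norm)
  qed
  then have "dist (height p) (height q) \<le> dist p q" for p q
    by (smt (verit) dist_commute dist_real_def)
  then show ?thesis unfolding continuous_on_iff by (meson le_less_trans)
qed

lemma height_1: "norm p = 1 \<Longrightarrow> height p = 1 \<Longrightarrow> \<exists>z. p = f z"
proof -
  assume p: "norm p = 1" "height p = 1"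
  obtain z where z: "height p = p \<bullet> f z" by (rule height_attained)
  have "(p - f z) \<bullet> (p - f z) = 0"
    using p z by (simp add: inner_diff_left inner_diff_right ff inner_commute norm_eq_1)
  then show ?thesis by auto
qed

text \<open>At a nearest point the differential of \<open>p \<bullet> f\<close> vanishes, so
  \<open>p\<close> has no tangential component there.\<close>

lemma max_expand:
  assumes "\<And>w. p \<bullet> f w \<le> p \<bullet> f z"
  shows "p = (p \<bullet> f z) *\<^sub>R f z + (p \<bullet> n z) *\<^sub>R n z"
proof -
  have "(\<lambda>v. p \<bullet> dd v f z) = (\<lambda>v. 0)"
  proof (rule has_derivative_local_max)
    show "((\<lambda>w. p \<bullet> f w) has_derivative (\<lambda>v. p \<bullet> dd v f z)) (at z)"
      by (intro has_derivative_inner_right smooth_has_dd smf)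
  qed (use assms in auto)
  then have "p \<bullet> dd v f z = 0" for v by metis
  then have "p \<bullet> gs.e1 z = 0" "p \<bullet> gs.e2 z = 0" by (simp_all add: vd_def)
  then show ?thesis using gs.expand[of p z] by simp
qed

text \<open>By periodicity the nearest point can be taken in the fundamental square, so the set is
  the projection of a compact set.\<close>

lemma side_closed: "closed (side s)"
proof -
  let ?K = "{(p, z). (\<forall>w. p \<bullet> f w \<le> p \<bullet> f z) \<and> s * (p \<bullet> n z) \<ge> 0}"
  have "closed {(p, z). p \<bullet> f w \<le> p \<bullet> f z}" for w
    unfolding case_prod_unfold
    by (intro closed_Collect_le continuous_intros continuous_on_compose2[OF contf[of UNIV]]) auto
  moreover have "closed {(p, z). s * (p \<bullet> n z) \<ge> 0}"
    unfolding case_prod_unfold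
    by (intro closed_Collect_le continuous_intros continuous_on_compose2[OF contn[of UNIV]]) auto
  ultimately have "closed ((\<Inter>w. {(p, z). p \<bullet> f w \<le> p \<bullet> f z}) \<inter> {(p, z). s * (p \<bullet> n z) \<ge> 0})"
    by (intro closed_Int closed_INT) auto
  also have "(\<Inter>w. {(p, z). p \<bullet> f w \<le> p \<bullet> f z}) \<inter> {(p, z). s * (p \<bullet> n z) \<ge> 0} = ?K" by auto
  finally have "compact ((sphere 0 1 \<times> fund) \<inter> ?K)"
    by (intro compact_Int_closed compact_Times compact_sphere compact_cbox)
  then have "compact (fst ` ((sphere 0 1 \<times> fund) \<inter> ?K))"
    by (rule compact_continuous_image[rotated]) (intro continuous_intros)
  moreover have "fst ` ((sphere 0 1 \<times> fund) \<inter> ?K) = side s"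
  proof (intro equalityI subsetI)
    fix p assume "p \<in> side s"
    then obtain z where z: "p \<in> sphere 0 1" "\<And>w. p \<bullet> f w \<le> p \<bullet> f z" "s * (p \<bullet> n z) \<ge> 0" by (auto simp: side_def)
    obtain i j where "z + lat i j \<in> fund" using lattice_reduce by blast
    then have "(p, z + lat i j) \<in> (sphere 0 1 \<times> fund) \<inter> ?K" using z by (auto simp: perf pern)
    then show "p \<in> fst ` ((sphere 0 1 \<times> fund) \<inter> ?K)" by force
  next
    fix p assume "p \<in> fst ` ((sphere 0 1 \<times> fund) \<inter> ?K)"
    then obtain z where "p \<in> sphere 0 1" "\<forall>w. p \<bullet> f w \<le> p \<bullet> f z" "s * (p \<bullet> n z) \<ge> 0" by auto
    then show "p \<in> side s" unfolding side_def by blast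
  qed
  ultimately show ?thesis using compact_imp_closed by simp
qed

lemma side_union: "side 1 \<union> side (-1) = sphere 0 1"
proof -
  have "p \<in> side 1 \<union> side (-1)" if "p \<in> sphere 0 1" for p
    using height_attained[of p] that by (auto simp: side_def) (metis linorder_le_cases)
  moreover have "side s \<subseteq> sphere 0 1" for s by (auto simp: side_def)
  ultimately show ?thesis by blast
qed

text \<open>The angle \<open>\<plusminus> \<tau>\<close>, with the sign given by the side on which a point lies, is well defined modulo \<open>2 \<pi>\<close> and
  continuous on the sphere, and \<open>\<theta>\<close> is its lift. The lift is constant on the torus, so no path can leave the torus on
  one side and return to it on the other one. This replaces the Jordan-Brouwer separation theorem.\<close>

lemma side_function:
  obtains \<theta> \<tau> where "continuous_on (sphere 0 1) \<theta>" "\<And>x y. \<theta> (f x) = \<theta> (f y)"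
    "\<And>p s. s = 1 \<or> s = -1 \<Longrightarrow> p \<in> side s \<Longrightarrow> cos (\<theta> p) = cos (\<tau> p) \<and> sin (\<theta> p) = s * sin (\<tau> p)"
    "\<And>p. norm p = 1 \<Longrightarrow> 0 \<le> \<tau> p \<and> \<tau> p \<le> pi"
    "\<And>p. norm p = 1 \<Longrightarrow> \<tau> p = 0 \<Longrightarrow> height p = 1"
    "\<And>x. \<tau> (f x) = 0" "\<exists>a<1. \<forall>p. norm p = 1 \<longrightarrow> height p > a \<longrightarrow> \<tau> p < pi"
proof -
  obtain C where C: "C > 0" "\<And>x y. \<bar>n x \<bullet> f y\<bar> \<le> C * (1 - f x \<bullet> f y)" using quadratic_estimate by blast
  \<comment> \<open>For a point at angle \<open>t\<close> in [0, pi] along a normal,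
    \<open>cos t > a\<close> is equivalent to \<open>C * sin t < cos t\<close>. Above this height
    the quadratic estimate makes nearest points unique on the torus.\<close>
  define a where "a = C / sqrt (1 + C\<^sup>2)"
  have sq: "sqrt (1 + C\<^sup>2) > 0" by (simp add: add_pos_nonneg)
  have a0: "a > 0" using C sq by (simp add: a_def)
  have a2: "a\<^sup>2 * (1 + C\<^sup>2) = C\<^sup>2"
  proof -
    have "1 + C\<^sup>2 > 0" by (simp add: add_pos_nonneg)
    then show ?thesis by (simp add: a_def power_divide)
  qed
  have a1: "a < 1"
  proof -
    have "sqrt (1 + C\<^sup>2) > sqrt (C\<^sup>2)" by (intro real_sqrt_less_mono) simp
    then show ?thesis using C(1) sq by (simp add: a_def)
  qed
  \<comment> \<open>The scaling lets \<tau> grow from 0 on the torus to pi at height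
    \<open>a\<close>; there and farther away both signs give the same point of the circle, so an
    overlap of the sides does no harm.\<close>
  define \<tau> where "\<tau> p = pi * min 1 ((1 - height p) / (1 - a))" for p
  have t: "0 \<le> \<tau> p \<and> \<tau> p \<le> pi" if "norm p = 1" for p
    using height_le[OF that] a1 by (auto simp: \<tau>_def min_def mult_le_cancel_left1)
  have t0: "height p = 1" if "\<tau> p = 0" for p using that a1 by (auto simp: \<tau>_def min_def split: if_splits)
  have t_pi: "\<tau> p = pi" if "height p \<le> a" for p using that a1 by (simp add: \<tau>_def min_def field_simps)
  have t_lt: "\<tau> p < pi" if "height p > a" for p using that a1 by (simp add: \<tau>_def min_def field_simps)
  have hf: "height (f x) = 1" for x
  proof -
    have "height (f x) = f x \<bullet> f x"
      by (rule height_eq) (metis norm_cauchy_schwarz norm_f ff mult_1)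
    then show ?thesis by (simp add: ff)
  qed
  have tf: "\<tau> (f x) = 0" for x using a1 by (simp add: \<tau>_def hf)
  have ct: "continuous_on S \<tau>" for S unfolding \<tau>_def[abs_def] using a1 by (intro continuous_intros height_cont) auto
  \<comment> \<open>Nearest points with opposite signs of the normal component satisfy
    \<open>\<alpha> * \<rho> \<le> (C * \<beta>) * \<rho>\<close>, while the height gives
    \<open>C * \<beta> < \<alpha>\<close>. So they coincide, the normal component is zero, and
    \<open>p\<close> is on the torus.\<close>
  have overlap: "\<tau> p = 0 \<or> \<tau> p = pi" if p: "p \<in> side 1" "p \<in> side (-1)" for p
  proof (cases "height p \<le> a")
    case False
    obtain z where z: "\<And>w. p \<bullet> f w \<le> p \<bullet> f z" "p \<bullet> n z \<ge> 0" using p(1) by (auto simp: side_def)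
    obtain z' where z': "\<And>w. p \<bullet> f w \<le> p \<bullet> f z'" "p \<bullet> n z' \<le> 0" using p(2) by (auto simp: side_def)
    define \<alpha> where "\<alpha> = height p"
    have al: "p \<bullet> f z = \<alpha>" "p \<bullet> f z' = \<alpha>" using height_eq[OF z(1)] height_eq[OF z'(1)] by (simp_all add: \<alpha>_def)
    define \<beta> where "\<beta> = p \<bullet> n z"
    have e: "p = \<alpha> *\<^sub>R f z + \<beta> *\<^sub>R n z" using max_expand[OF z(1)] al by (simp add: \<beta>_def)
    have e': "p = \<alpha> *\<^sub>R f z' + (p \<bullet> n z') *\<^sub>R n z'" using max_expand[OF z'(1)] al by simp
    have n1: "\<alpha>\<^sup>2 + \<beta>\<^sup>2 = 1" "\<alpha>\<^sup>2 + (p \<bullet> n z')\<^sup>2 = 1"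
    proof -
      have pp: "p \<bullet> p = 1" using p(1) by (simp add: side_def norm_eq_1)
      have "p \<bullet> p = \<alpha> * (p \<bullet> f z) + \<beta> * (p \<bullet> n z)" by (subst (2) e) (simp add: inner_add_right)
      then show "\<alpha>\<^sup>2 + \<beta>\<^sup>2 = 1" using al pp by (simp add: \<beta>_def power2_eq_square)
      have "p \<bullet> p = \<alpha> * (p \<bullet> f z') + (p \<bullet> n z') * (p \<bullet> n z')" by (subst (2) e') (simp add: inner_add_right)
      then show "\<alpha>\<^sup>2 + (p \<bullet> n z')\<^sup>2 = 1" using al pp by (simp add: power2_eq_square)
    qed
    then have "(p \<bullet> n z')\<^sup>2 = \<beta>\<^sup>2" by simp
    then have b': "p \<bullet> n z' = - \<beta>" using z(2) z'(2) unfolding \<beta>_def by (auto simp: power2_eq_iff)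
    define \<rho> where "\<rho> = 1 - f z \<bullet> f z'"
    have "p \<bullet> f z' = \<alpha> * (1 - \<rho>) + \<beta> * (n z \<bullet> f z')" by (subst e) (simp add: inner_add_left \<rho>_def)
    then have "\<alpha> * \<rho> = \<beta> * (n z \<bullet> f z')" using al by (simp add: algebra_simps)
    also have "\<dots> \<le> \<beta> * (C * \<rho>)" using C(2)[of z z'] z(2) by (intro mult_left_mono) (auto simp: \<rho>_def \<beta>_def)
    finally have le: "\<alpha> * \<rho> \<le> (C * \<beta>) * \<rho>" by (simp add: mult_ac)
    have lt: "C * \<beta> < \<alpha>"
    proof -
      have "\<alpha> > a" using False by (simp add: \<alpha>_def)
      then have "a\<^sup>2 < \<alpha>\<^sup>2" using a0 by (intro power_strict_mono) auto
      then have "a\<^sup>2 * (1 + C\<^sup>2) < \<alpha>\<^sup>2 * (1 + C\<^sup>2)" by (intro mult_strict_right_mono) (auto simp: add_pos_nonneg)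
      moreover have "(C * \<beta>)\<^sup>2 = C\<^sup>2 * (1 - \<alpha>\<^sup>2)" using n1(1) by (simp add: power_mult_distrib flip: n1(1))
      ultimately have "(C * \<beta>)\<^sup>2 < \<alpha>\<^sup>2" unfolding a2 by (simp add: algebra_simps)
      then show ?thesis using \<open>\<alpha> > a\<close> a0 by (intro power2_less_imp_less[of "C * \<beta>" \<alpha>]) auto
    qed
    have rho0: "\<rho> \<ge> 0" using norm_cauchy_schwarz[of "f z" "f z'"] by (simp add: \<rho>_def norm_f)
    have "\<rho> = 0"
    proof (rule ccontr)
      assume "\<rho> \<noteq> 0"
      then have "\<rho> > 0" using rho0 by simp
      then show False using mult_strict_right_mono[OF lt \<open>\<rho> > 0\<close>] le by simp
    qed
    then have "(f z - f z') \<bullet> (f z - f z') = 0" by (simp add: \<rho>_def inner_diff_left inner_diff_right ff inner_commute)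
    then have "f z = f z'" by simp
    then have "n z = n z'" by (rule n_eq)
    then have "\<beta> = 0" using b' by (simp add: \<beta>_def)
    then have "\<alpha>\<^sup>2 = 1" using n1 by simp
    then have "\<alpha> = 1" using False a0 by (simp add: \<alpha>_def power2_eq_1_iff)
    then show ?thesis by (simp add: \<tau>_def \<alpha>_def[symmetric])
  qed (simp add: t_pi)
  define G where "G p = (if p \<in> side 1 then cis (\<tau> p) else cis (- \<tau> p))" for p
  have "continuous_on (side 1 \<union> side (-1)) G"
    unfolding G_def[abs_def]
  proof (rule continuous_on_cases[OF side_closed side_closed])
    show "continuous_on (side 1) (\<lambda>p. cis (\<tau> p))" "continuous_on (side (-1)) (\<lambda>p. cis (- \<tau> p))"
      by (intro continuous_intros ct)+
    show "\<forall>p. p \<in> side 1 \<and> p \<notin> side 1 \<or> p \<in> side (-1) \<and> p \<in> side 1 \<longrightarrow> cis (\<tau> p) = cis (- \<tau> p)"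
      using overlap by (force simp: complex_eq_iff)
  qed
  then have cG: "continuous_on (sphere 0 1) G" by (simp add: side_union)
  have Gs: "G p = cis (s * \<tau> p)" if "s = 1 \<or> s = -1" "p \<in> side s" for p s
    using that overlap[of p] by (force simp: G_def complex_eq_iff)
  have sc: "simply_connected (sphere (0 :: real ^ 4) 1)" by (rule simply_connected_sphere) simp
  have Gnz: "G p \<noteq> 0" for p by (simp add: G_def)
  obtain g where g: "continuous_on (sphere 0 1) g" "\<And>p. p \<in> sphere 0 1 \<Longrightarrow> G p = exp (g p)"
    by (rule continuous_logarithm_on_simply_connected[OF cG sc locally_path_connected_sphere Gnz]) blast
  define \<theta> where "\<theta> p = Im (g p)" for p
  have c\<theta>: "continuous_on (sphere 0 1) \<theta>" unfolding \<theta>_def[abs_def] by (intro continuous_intros g)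
  have "cmod (G p) = 1" for p by (simp add: G_def)
  then have "Re (g p) = 0" if "p \<in> sphere 0 1" for p using g(2)[OF that] by (metis exp_eq_one_iff norm_exp_eq_Re)
  then have G\<theta>: "G p = cis (\<theta> p)" if "p \<in> sphere 0 1" for p
    using g(2)[OF that] that by (simp add: exp_eq_polar \<theta>_def)
  have main: "cos (\<theta> p) = cos (\<tau> p) \<and> sin (\<theta> p) = s * sin (\<tau> p)" if s: "s = 1 \<or> s = -1" and p: "p \<in> side s" for p s
  proof -
    have "p \<in> sphere 0 1" using p by (simp add: side_def)
    then have "cis (\<theta> p) = cis (s * \<tau> p)" using G\<theta> Gs[OF s p] by simp
    then show ?thesis using s by (auto simp: complex_eq_iff)
  qed
  have f_sphere: "f x \<in> sphere 0 1" for x by (simp add: norm_f)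
  have cosf: "cos (\<theta> (f x)) = 1" for x
  proof -
    obtain s :: real where "s = 1 \<or> s = -1" "f x \<in> side s" using side_union f_sphere[of x] by (metis UnE)
    then show ?thesis using main tf by fastforce
  qed
  have "\<theta> (f x) = \<theta> (f y)" for x y
  proof -
    \<comment> \<open>On the torus \<theta> is a multiple of 2 pi, and a continuous function with
      discrete values on the connected plane is constant.\<close>
    have "(\<lambda>x. complex_of_real (\<theta> (f x))) constant_on UNIV"
    proof (rule continuous_discrete_range_constant)
      show "continuous_on UNIV (\<lambda>x. complex_of_real (\<theta> (f x)))"
        by (intro continuous_intros continuous_on_compose2[OF c\<theta> contf]) (auto simp: norm_f)
      fix x
      have "2 * pi \<le> \<bar>\<theta> (f y) - \<theta> (f x)\<bar>" if "\<theta> (f y) \<noteq> \<theta> (f x)" for y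
      proof -
        obtain i j :: int where ij: "\<theta> (f x) = of_int i * (2 * pi)" "\<theta> (f y) = of_int j * (2 * pi)"
          using cosf[of x] cosf[of y] cos_one_2pi_int by (metis mult.assoc)
        then have "i \<noteq> j" using that by auto
        then have "1 \<le> \<bar>real_of_int j - real_of_int i\<bar>" by linarith
        then have "1 * (2 * pi) \<le> \<bar>real_of_int j - real_of_int i\<bar> * (2 * pi)" by (intro mult_right_mono) auto
        also have "\<dots> = \<bar>\<theta> (f y) - \<theta> (f x)\<bar>" unfolding ij by (simp add: abs_mult left_diff_distrib[symmetric])
        finally show ?thesis by simp
      qed
      then show "\<exists>e>0. \<forall>y. y \<in> UNIV \<and> complex_of_real (\<theta> (f y)) \<noteq> complex_of_real (\<theta> (f x)) \<longrightarrow>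
          e \<le> cmod (complex_of_real (\<theta> (f y)) - complex_of_real (\<theta> (f x)))"
        by (intro exI[of _ "2 * pi"]) (auto simp: of_real_diff[symmetric] simp del: of_real_diff)
    qed (rule connected_UNIV)
    then show ?thesis unfolding constant_on_def by (metis UNIV_I of_real_eq_iff)
  qed
  with c\<theta> main t t0 tf a1 t_lt show thesis by (intro that[of \<theta> \<tau>]) blast+
qed

text \<open>Shortly after the start the normal geodesic is on side \<open>s\<close>, so \<theta>
  leaves its initial value in the direction of \<open>s\<close>. It cannot come back, because the
  cosine of \<theta> is 1 only on the torus, which \<open>off\<close> excludes.\<close>

lemma leave_side:
  assumes s: "s = 1 \<or> s = -1" and t0: "0 < t0"
    and \<theta>: "continuous_on (sphere 0 1) \<theta>"
    and main: "\<And>p s. s = 1 \<or> s = -1 \<Longrightarrow> p \<in> side s \<Longrightarrow> cos (\<theta> p) = cos (\<tau> p) \<and> sin (\<theta> p) = s * sin (\<tau> p)"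
    and \<tau>: "\<And>p. norm p = 1 \<Longrightarrow> 0 \<le> \<tau> p \<and> \<tau> p \<le> pi" "\<And>p. norm p = 1 \<Longrightarrow> \<tau> p = 0 \<Longrightarrow> height p = 1"
      "\<And>x. \<tau> (f x) = 0" "a < 1" "\<And>p. norm p = 1 \<Longrightarrow> height p > a \<Longrightarrow> \<tau> p < pi"
    and off: "\<And>t z. 0 < t \<Longrightarrow> t \<le> t0 \<Longrightarrow> cos t *\<^sub>R f x + (s * sin t) *\<^sub>R n x \<noteq> f z"
  shows "s * (\<theta> (cos t0 *\<^sub>R f x + (s * sin t0) *\<^sub>R n x) - \<theta> (f x)) > 0"
proof -
  define p where "p t = cos t *\<^sub>R f x + (s * sin t) *\<^sub>R n x" for t
  have s2: "s * s = 1" using s by auto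
  have pn: "norm (p t) = 1" for t
  proof -
    have "p t \<bullet> p t = (cos t)\<^sup>2 + (s * s) * (sin t)\<^sup>2"
      unfolding p_def by (simp add: inner_add_left inner_add_right ff nn nf inner_commute[of "f x" "n x"] power2_eq_square algebra_simps)
    then show ?thesis by (simp add: s2 norm_eq_1)
  qed
  have cp: "continuous_on S p" for S unfolding p_def[abs_def] by (intro continuous_intros)
  have c: "continuous_on S (\<lambda>t. \<theta> (p t))" for S
    by (rule continuous_on_compose2[OF \<theta> cp]) (auto simp: pn)
  have tau1: "cos (\<theta> q) = cos (\<tau> q)" if "norm q = 1" for q
    using main[of 1 q] main[of "-1" q] side_union that by fastforce
  have ne1: "cos (\<theta> (p t)) \<noteq> 1" if "0 < t" "t \<le> t0" for t
  proof
    assume "cos (\<theta> (p t)) = 1"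
    then have "cos (\<tau> (p t)) = cos 0" using tau1[OF pn] by simp
    then have "\<tau> (p t) = 0" using \<tau>(1)[OF pn[of t]] cos_inj_pi[of "\<tau> (p t)" 0] by auto
    then obtain z where "p t = f z" using \<tau>(2)[OF pn] height_1[OF pn] by blast
    then show False using off[OF that] by (simp add: p_def)
  qed
  have cosx: "cos (\<theta> (f x)) = 1" using tau1[of "f x"] \<tau>(3) by (simp add: norm_f)
  obtain C where C: "C > 0" "\<And>x y. \<bar>n x \<bullet> f y\<bar> \<le> C * (1 - f x \<bullet> f y)" using quadratic_estimate by blast
  have p0: "p 0 = f x" by (simp add: p_def)
  have "isCont (\<lambda>t. cos t - C * sin t) 0" "isCont (\<lambda>t::real. cos t) 0" "isCont (\<lambda>t. \<bar>\<theta> (p t) - \<theta> (f x)\<bar>) 0"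
    using c[of UNIV] by (auto intro!: continuous_intros simp: continuous_on_eq_continuous_at)
  then have l: "((\<lambda>t. cos t - C * sin t) \<longlongrightarrow> 1) (at 0)" "((\<lambda>t::real. cos t) \<longlongrightarrow> 1) (at 0)" "((\<lambda>t. \<bar>\<theta> (p t) - \<theta> (f x)\<bar>) \<longlongrightarrow> 0) (at 0)"
    by (simp_all add: isCont_def p0)
  have "\<forall>\<^sub>F t in at 0. cos t - C * sin t > 0" "\<forall>\<^sub>F t in at 0. cos t > a" "\<forall>\<^sub>F t in at 0. \<bar>\<theta> (p t) - \<theta> (f x)\<bar> < pi"
    by (rule order_tendstoD(1)[OF l(1) zero_less_one], rule order_tendstoD(1)[OF l(2) \<tau>(4)], rule order_tendstoD(2)[OF l(3) pi_gt_zero])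
  then have ev: "\<forall>\<^sub>F t in at_right 0. cos t - C * sin t > 0 \<and> cos t > a \<and> \<bar>\<theta> (p t) - \<theta> (f x)\<bar> < pi"
    unfolding eventually_at_split by (simp add: eventually_conj_iff)
  have "\<forall>\<^sub>F t in at_right 0. t \<in> {0<..<min t0 (pi / 2)}" using t0 by (intro eventually_at_right_real) auto
  \<comment> \<open>The condition \<open>C * sin t1 < cos t1\<close> makes \<open>f x\<close> a
    nearest point, so the path is on side \<open>s\<close> at time \<open>t1\<close>. The bound pi
    on the change of \<theta> turns the sign of its sine into its own sign.\<close>
  from eventually_happens'[OF _ eventually_conj[OF ev this]] obtain t1 where t1: "0 < t1" "t1 < t0" "t1 < pi / 2" "cos t1 - C * sin t1 > 0" "cos t1 > a" "\<bar>\<theta> (p t1) - \<theta> (f x)\<bar> < pi"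
    by auto
  have sin1: "sin t1 > 0" "cos t1 > 0" using t1 by (auto intro!: sin_gt_zero cos_gt_zero)
  have px: "p t1 \<bullet> f x = cos t1" "p t1 \<bullet> n x = s * sin t1" by (simp_all add: p_def inner_add_left ff nn nf inner_commute[of "f x" "n x"])
  have mx: "p t1 \<bullet> f z \<le> p t1 \<bullet> f x" for z
  proof -
    define \<rho> where "\<rho> = 1 - f x \<bullet> f z"
    have rho: "\<rho> \<ge> 0" using norm_cauchy_schwarz[of "f x" "f z"] by (simp add: \<rho>_def norm_f)
    have "s * (n x \<bullet> f z) \<le> C * \<rho>" using C(2)[of x z] s by (auto simp: \<rho>_def)
    then have "sin t1 * (s * (n x \<bullet> f z)) \<le> sin t1 * (C * \<rho>)" using sin1 by (intro mult_left_mono) auto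
    also have "\<dots> = (C * sin t1) * \<rho>" by simp
    also have "\<dots> \<le> cos t1 * \<rho>" using t1 rho by (intro mult_right_mono) auto
    finally have "cos t1 * (1 - \<rho>) + sin t1 * (s * (n x \<bullet> f z)) \<le> cos t1" by (simp add: algebra_simps)
    then show ?thesis unfolding px by (simp add: p_def inner_add_left \<rho>_def mult_ac)
  qed
  moreover have "s * (p t1 \<bullet> n x) \<ge> 0" using sin1 s2 by (simp add: px mult.assoc[symmetric])
  ultimately have "p t1 \<in> side s" using pn[of t1] unfolding side_def by auto
  then have sn: "sin (\<theta> (p t1)) = s * sin (\<tau> (p t1))" using main[OF s] by simp
  have "height (p t1) = cos t1" using height_eq[OF mx] px by simp
  then have "\<tau> (p t1) < pi" using \<tau>(5)[OF pn] t1 by simp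
  moreover have "\<tau> (p t1) \<noteq> 0" using ne1[of t1] tau1[OF pn, of t1] t1 by auto
  ultimately have "sin (\<tau> (p t1)) > 0" using \<tau>(1)[OF pn[of t1]] by (intro sin_gt_zero) auto
  then have "s * sin (\<theta> (p t1)) > 0" unfolding sn using s2 by (simp add: mult.assoc[symmetric])
  moreover have "sin (\<theta> (p t1)) = sin (\<theta> (p t1) - \<theta> (f x))"
    using cosx sin_cos_squared_add[of "\<theta> (f x)"] by (simp add: sin_diff)
  moreover have "sin (s * d) = s * sin d" for d using s by auto
  ultimately have pos: "sin (s * (\<theta> (p t1) - \<theta> (f x))) > 0" by simp
  have pos1: "s * (\<theta> (p t1) - \<theta> (f x)) > 0"
  proof (rule ccontr)
    assume "\<not> ?thesis"
    then have "0 \<le> - (s * (\<theta> (p t1) - \<theta> (f x)))" by simp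
    moreover have "- (s * (\<theta> (p t1) - \<theta> (f x))) \<le> pi" using t1(6) s by (auto simp: abs_if split: if_splits)
    ultimately have "sin (- (s * (\<theta> (p t1) - \<theta> (f x)))) \<ge> 0" by (rule sin_ge_zero)
    then show False using pos by simp
  qed
  show ?thesis
  proof (rule ccontr)
    assume "\<not> ?thesis"
    then have neg: "s * (\<theta> (p t0) - \<theta> (f x)) \<le> 0" by (simp add: p_def)
    have "\<exists>t\<ge>t1. t \<le> t0 \<and> s * (\<theta> (p t) - \<theta> (f x)) = 0"
      using neg pos1 t1(1,2) by (intro IVT2') (auto intro!: continuous_intros c)
    then obtain t where t: "t1 \<le> t" "t \<le> t0" "s * (\<theta> (p t) - \<theta> (f x)) = 0" by blast
    then have "\<theta> (p t) = \<theta> (f x)" using s by auto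
    then show False using ne1[of t] t t1 cosx by simp
  qed
qed

text \<open>By \<open>ball\<close> the surface avoids an open geodesic ball. By \<open>touch\<close>
  its centre is reached from \<open>f x\<close> along \<open>- n x\<close> and from
  \<open>f y\<close> along \<open>n y\<close>, both times without meeting the torus. The value of
  \<theta> at the centre would be both smaller and larger than its common value on the
  torus.\<close>

lemma touching_sign:
  assumes ball: "\<And>z. (n x - \<phi> *\<^sub>R f x) \<bullet> f z \<ge> - \<phi>"
    and touch: "n x - \<phi> *\<^sub>R f x = - n y - \<phi> *\<^sub>R f y"
  shows False
proof -
  define r where "r = sqrt (1 + \<phi>\<^sup>2)"
  have r: "r > 0" "r\<^sup>2 = 1 + \<phi>\<^sup>2" by (simp_all add: r_def add_pos_nonneg)
  have "(\<phi> / r)\<^sup>2 + (1 / r)\<^sup>2 = (1 + \<phi>\<^sup>2) / r\<^sup>2" by (simp add: power_divide add_divide_distrib)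
  then have "(\<phi> / r)\<^sup>2 + (1 / r)\<^sup>2 = 1" using r(1) by (simp flip: r(2))
  \<comment> \<open>\<open>t0\<close> is the radius of the ball, with cotangent \<phi>.\<close>
  then obtain t0 where t0: "0 \<le> t0" "t0 \<le> pi" "\<phi> / r = cos t0" "1 / r = sin t0"
    using sincos_total_pi[of "1 / r" "\<phi> / r"] r by auto
  then have "t0 \<noteq> 0" using r by auto
  then have t0p: "0 < t0" using t0 by simp
  have c: "cos t0 * r = \<phi>" "sin t0 * r = 1" using t0(3,4) r by (simp_all flip: t0(3,4))
  \<comment> \<open>The right side is \<open>r * cos (t0 - t)\<close>, so the whole radius after its
    starting point lies in the open ball.\<close>
  have lt: "\<phi> < \<phi> * cos t + sin t" if "0 < t" "t \<le> t0" for t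
  proof -
    have "cos t0 < cos (t0 - t)" using that t0 by (intro cos_monotone_0_pi) auto
    then have "cos t0 * r < (cos t0 * cos t + sin t0 * sin t) * r" unfolding cos_diff using r by (intro mult_strict_right_mono) auto
    also have "\<dots> = (cos t0 * r) * cos t + (sin t0 * r) * sin t" by (simp add: algebra_simps)
    finally show ?thesis unfolding c by simp
  qed
  let ?V = "n x - \<phi> *\<^sub>R f x"
  have fn: "f z \<bullet> n z = 0" for z using nf[of z] by (simp add: inner_commute)
  have Vp: "?V \<bullet> (cos t *\<^sub>R f x + (-1 * sin t) *\<^sub>R n x) = - (\<phi> * cos t + sin t)"
    "?V \<bullet> (cos t *\<^sub>R f y + (1 * sin t) *\<^sub>R n y) = - (\<phi> * cos t + sin t)" for t
    by (simp add: inner_simps ff nn nf fn algebra_simps) (simp add: touch inner_simps ff nn nf fn algebra_simps)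
  obtain \<theta> \<tau> where \<theta>: "continuous_on (sphere 0 1) \<theta>" "\<And>x y. \<theta> (f x) = \<theta> (f y)"
    "\<And>p s. s = 1 \<or> s = -1 \<Longrightarrow> p \<in> side s \<Longrightarrow> cos (\<theta> p) = cos (\<tau> p) \<and> sin (\<theta> p) = s * sin (\<tau> p)"
    "\<And>p. norm p = 1 \<Longrightarrow> 0 \<le> \<tau> p \<and> \<tau> p \<le> pi"
    "\<And>p. norm p = 1 \<Longrightarrow> \<tau> p = 0 \<Longrightarrow> height p = 1"
    "\<And>x. \<tau> (f x) = 0" "\<exists>a<1. \<forall>p. norm p = 1 \<longrightarrow> height p > a \<longrightarrow> \<tau> p < pi"
    by (rule side_function) blast
  then obtain a where a: "a < 1" "\<And>p. norm p = 1 \<Longrightarrow> height p > a \<Longrightarrow> \<tau> p < pi" by blast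
  have "-1 * (\<theta> (cos t0 *\<^sub>R f x + (-1 * sin t0) *\<^sub>R n x) - \<theta> (f x)) > 0"
  proof (rule leave_side[OF _ t0p \<theta>(1,3-6) a])
    fix t z assume t: "0 < t" "t \<le> t0"
    show "cos t *\<^sub>R f x + (-1 * sin t) *\<^sub>R n x \<noteq> f z"
      using lt[OF t] ball[of z] Vp(1)[of t] by auto
  qed auto
  moreover have "1 * (\<theta> (cos t0 *\<^sub>R f y + (1 * sin t0) *\<^sub>R n y) - \<theta> (f y)) > 0"
  proof (rule leave_side[OF _ t0p \<theta>(1,3-6) a])
    fix t z assume t: "0 < t" "t \<le> t0"
    show "cos t *\<^sub>R f y + (1 * sin t) *\<^sub>R n y \<noteq> f z"
      using lt[OF t] ball[of z] Vp(2)[of t] by auto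
  qed auto
  moreover have "cos t0 *\<^sub>R f x + (-1 * sin t0) *\<^sub>R n x = cos t0 *\<^sub>R f y + (1 * sin t0) *\<^sub>R n y"
  proof -
    have "\<phi> *\<^sub>R f x - n x = \<phi> *\<^sub>R f y + n y" using arg_cong[OF touch, of uminus] by (simp add: algebra_simps)
    then have "(1 / r) *\<^sub>R (\<phi> *\<^sub>R f x - n x) = (1 / r) *\<^sub>R (\<phi> *\<^sub>R f y + n y)" by simp
    then show ?thesis by (simp add: t0(3,4)[symmetric] scaleR_diff_right scaleR_add_right)
  qed
  moreover have "\<theta> (f x) = \<theta> (f y)" by (rule \<theta>(2))
  ultimately show False by simp
qed

end

section \<open>Constancy of the rotation plane\<close>

text \<open>A negative third derivative in some direction would take \<open>p\<close> below its
  minimum; for \<open>v\<close> and \<open>- v\<close> together this leaves only zero.\<close>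

lemma third_derivative_at_degenerate_min:
  fixes p :: "'a::real_normed_vector \<Rightarrow> real"
  assumes p: "smooth p" and min: "\<And>y. p x \<le> p y" and z: "dd v p x = 0" "dd v (dd v p) x = 0"
  shows "dd v (dd v (dd v p)) x = 0"
proof -
  have *: "0 \<le> dd w (dd w (dd w p)) x" if zw: "dd w p x = 0" "dd w (dd w p) x = 0" for w
  proof (rule ccontr)
    let ?q = "dd w (dd w (dd w p))"
    assume "\<not> 0 \<le> ?q x"
    have s: "smooth (dd w p)" "smooth (dd w (dd w p))" "smooth ?q" by (intro smooth_dd p)+
    have "continuous_on UNIV (\<lambda>t. ?q (x + t *\<^sub>R w))"
      by (rule continuous_on_compose2[OF smooth_continuous[OF s(3), of UNIV]]) (auto intro!: continuous_intros)
    then have "isCont (\<lambda>t. ?q (x + t *\<^sub>R w)) 0" by (simp add: continuous_on_eq_continuous_at)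
    then obtain d where d: "d > 0" "\<And>t. dist t 0 < d \<Longrightarrow> dist (?q (x + t *\<^sub>R w)) (?q (x + 0 *\<^sub>R w)) < - ?q x"
      unfolding continuous_at_eps_delta using \<open>\<not> 0 \<le> ?q x\<close> by (metis neg_0_less_iff_less not_le)
    define h where "h = d / 2"
    have h: "h > 0" using d by (simp add: h_def)
    obtain t1 where t1: "0 < t1" "t1 < h" "p (x + h *\<^sub>R w) - p x = h * dd w p (x + t1 *\<^sub>R w)"
      by (rule smooth_line_mvt[OF p h])
    obtain t2 where t2: "0 < t2" "t2 < t1" "dd w p (x + t1 *\<^sub>R w) - dd w p x = t1 * dd w (dd w p) (x + t2 *\<^sub>R w)"
      by (rule smooth_line_mvt[OF s(1) t1(1)])
    obtain t3 where t3: "0 < t3" "t3 < t2" "dd w (dd w p) (x + t2 *\<^sub>R w) - dd w (dd w p) x = t2 * ?q (x + t3 *\<^sub>R w)"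
      by (rule smooth_line_mvt[OF s(2) t2(1)])
    have "dist (?q (x + t3 *\<^sub>R w)) (?q (x + 0 *\<^sub>R w)) < - ?q x"
      using t1 t2 t3 by (intro d) (auto simp: h_def)
    then have "?q (x + t3 *\<^sub>R w) < 0" by (simp add: dist_real_def abs_if split: if_splits)
    then have "h * (t1 * (t2 * ?q (x + t3 *\<^sub>R w))) < 0" using h t1 t2 by (intro mult_pos_neg) auto
    then have "p (x + h *\<^sub>R w) < p x" using t1(3) t2(3) t3(3) zw by simp
    then show False using min by (simp add: not_le[symmetric])
  qed
  have m: "dd (- v) q = (\<lambda>y. - dd v q y)" if "smooth q" for q :: "'a \<Rightarrow> real"
    using smooth_differentiable[OF that] by (auto simp: dd_vminus)
  have s: "smooth (dd v p)" "smooth (dd v (dd v p))" by (intro smooth_dd p)+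
  have m1: "dd (- v) p = (\<lambda>y. - dd v p y)" by (rule m[OF p])
  have m2: "dd (- v) (\<lambda>y. - dd v p y) = dd v (dd v p)"
    unfolding m[OF smooth_minus[OF s(1)]] by (rule ext) (simp add: dd_minus smooth_differentiable s)
  have "0 \<le> dd (- v) (dd (- v) (dd (- v) p)) x"
    by (rule *) (use z in \<open>simp_all add: m1 m2\<close>)
  also have "dd (- v) (dd (- v) (dd (- v) p)) x = - dd v (dd v (dd v p)) x"
    by (simp add: m1 m2 m[OF s(2)])
  finally show ?thesis using *[OF z] by simp
qed

text \<open>For orthonormal \<open>a\<close>, \<open>b\<close> this is the infinitesimal rotation in
  their plane.\<close>

definition wedge :: "real ^ 4 \<Rightarrow> real ^ 4 \<Rightarrow> real ^ 4 ^ 4" where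
  "wedge a b = (\<chi> i j. a $ i * b $ j - b $ i * a $ j)"

lemma transpose_wedge: "transpose (wedge a b) = - wedge a b"
  by (simp add: vec_eq_iff transpose_def wedge_def)

lemma wedge_mult: "wedge a b *v z = (b \<bullet> z) *\<^sub>R a - (a \<bullet> z) *\<^sub>R b"
  by (auto simp: vec_eq_iff matrix_vector_mult_def wedge_def inner_vec_def sum_distrib_left sum_distrib_right
      sum_subtractf[symmetric] algebra_simps intro!: sum.cong)

lemma rank_wedge:
  assumes "a \<bullet> a = 1" "b \<bullet> b = 1" "a \<bullet> b = 0"
  shows "rank (wedge a b) = 2"
proof -
  have ba: "b \<bullet> a = 0" using assms by (simp add: inner_commute)
  have ne: "a \<noteq> b" "a \<noteq> 0" "b \<noteq> 0" using assms by auto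
  have "pairwise orthogonal {a, b}" using assms ba by (auto simp: pairwise_insert orthogonal_def)
  then have ind: "independent {a, b}" by (rule pairwise_orthogonal_independent) (use ne in auto)
  have "range (\<lambda>z. wedge a b *v z) = span {a, b}"
  proof (intro equalityI subsetI)
    fix y assume "y \<in> range (\<lambda>z. wedge a b *v z)"
    then obtain z where "y = (b \<bullet> z) *\<^sub>R a - (a \<bullet> z) *\<^sub>R b" by (auto simp: wedge_mult)
    then show "y \<in> span {a, b}" by (simp add: span_base span_diff span_mul)
  next
    fix y assume "y \<in> span {a, b}"
    then obtain c d where y: "y = c *\<^sub>R a + d *\<^sub>R b"
      by (auto simp: span_insert span_singleton) (metis diff_eq_eq add.commute)
    have "y = wedge a b *v (c *\<^sub>R b - d *\<^sub>R a)"
      using assms ba by (simp add: wedge_mult y inner_diff_right)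
    then show "y \<in> range (\<lambda>z. wedge a b *v z)" by blast
  qed
  then have "rank (wedge a b) = dim (span {a, b})" by (simp add: rank_dim_range)
  also have "\<dots> = card {a, b}" using dim_eq_card_independent[OF ind] by simp
  finally show ?thesis using ne by simp
qed

context principal_frame
begin

text \<open>By \<open>Z\<close> the function \<open>V x \<bullet> f\<close> has a minimum at
  \<open>x\<close>, degenerate along the first principal direction \<open>v\<close>, so its third
  derivative along \<open>v\<close> vanishes. With \<open>V\<close> moving along,
  \<open>V z \<bullet> dd v (dd v f) z\<close> is nonnegative and zero at \<open>x\<close>, so its
  derivative vanishes too. The difference of the two derivatives is a multiple of
  \<open>dd v h11 x\<close>.\<close>

lemma vd_h11_zero:
  assumes Z: "\<And>x y. 0 \<le> h11 x * (1 - f x \<bullet> f y) + n x \<bullet> f y"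
  shows "vd X h11 x = 0"
proof -
  define v where "v = X x"
  define V where "V z = n z - h11 z *\<^sub>R f z" for z
  have sV: "smooth V" unfolding V_def[abs_def] by (intro smooth_intros sm smh)
  have sd: "smooth (dd v f)" "smooth (dd v (dd v f))" by (intro smooth_dd sm)+
  have f2: "f z \<bullet> dd v (dd v f) z = - (dd v f z \<bullet> dd v f z)" and n2: "n z \<bullet> dd v (dd v f) z = - (dd v n z \<bullet> dd v f z)" for z
    using dd_inner_eq_0[OF sm(1) sd(1), of 0 v z] fdf dd_inner_eq_0[OF sm(2) sd(1), of 0 v z] ndf by simp_all
  have dv: "dd v f x = e1 x" "dd v n x = h11 x *\<^sub>R e1 x"
    using D1n[of x] by (simp_all add: v_def vd_def h12_0)
  have mz: "V z \<bullet> dd v (dd v f) z = u z * (dd v f z \<bullet> e2 z)\<^sup>2" for z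
    using dd_n_inner[of v z] tangent_norm[of v z v]
    by (simp add: V_def inner_diff_left f2 n2 u_def power2_eq_square algebra_simps)
  have mx: "V x \<bullet> dd v (dd v f) x = 0" unfolding mz dv by (simp add: ortho)
  let ?p = "\<lambda>z. V x \<bullet> f z"
  have sp: "smooth ?p" by (intro smooth_intros sm)
  have dp: "dd v (\<lambda>z. V x \<bullet> q z) = (\<lambda>z. V x \<bullet> dd v q z)" if "smooth q" for q
    by (rule ext) (simp add: dd_inner dd_const smooth_differentiable smooth_const that)
  have "dd v (dd v (dd v ?p)) x = 0"
  proof (rule third_derivative_at_degenerate_min[OF sp])
    show "V x \<bullet> f x \<le> V x \<bullet> f y" for y
      using Z[of x y] by (simp add: V_def inner_diff_left ff nf algebra_simps)
    show "dd v ?p x = 0" unfolding dp[OF sm(1)] by (simp add: V_def inner_diff_left ndf fdf)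
    show "dd v (dd v ?p) x = 0" by (simp add: dp sm sd mx)
  qed
  then have third: "V x \<bullet> dd v (dd v (dd v f)) x = 0" by (simp add: dp sm sd)
  let ?m = "\<lambda>z. V z \<bullet> dd v (dd v f) z"
  have sm': "smooth ?m" by (intro smooth_inner sV sd)
  have "(\<lambda>w. dd w ?m x) = (\<lambda>w. 0)"
  proof (rule has_derivative_local_min[OF smooth_has_dd[OF sm']])
    have "?m x \<le> ?m y" for y unfolding mx using mz[of y] u_pos'[of y] by simp
    then show "\<forall>\<^sub>F y in at x. ?m x \<le> ?m y" by simp
  qed
  then have "dd v ?m x = 0" by metis
  then have "dd v V x \<bullet> dd v (dd v f) x = 0"
    using third by (simp add: dd_inner smooth_differentiable sV sd)
  moreover have "dd v V x = - (dd v h11 x *\<^sub>R f x)"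
    unfolding V_def[abs_def] by (simp add: dd_diff dd_scaleR smooth_differentiable smooth_scaleR sm smh dv)
  ultimately have "dd v h11 x * (dd v f x \<bullet> dd v f x) = 0" by (simp add: f2)
  then have "dd v h11 x = 0" unfolding dv ortho by simp
  then show ?thesis by (simp add: vd_def v_def)
qed

text \<open>The plane is spanned by \<open>e1\<close> and the curvature vector \<open>- w\<close> of its integral curve.\<close>

lemma rotation_plane_constant:
  assumes h: "\<And>x. vd X h11 x = 0"
  obtains Q where "transpose Q = - Q" "rank Q = 2" "\<And>x. \<exists>c. Q *v f x = c *\<^sub>R e1 x"
proof -
  have u0: "vd X u x = 0" for x using h[of x] psi'_nonneg[OF u_pos'[of x]] unfolding vd_h by simp
  have k0: "k x = 0" for x using gk(2)[of x] u0[of x] u_pos'[of x] by simp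
  have vdc: "vd V q x = 0" if "\<And>x. q x = 0" for V x and q :: "real ^ 2 \<Rightarrow> real"
  proof -
    have "q = (\<lambda>x. 0)" using that by auto
    then show ?thesis by (simp add: vd_const)
  qed
  have gu: "vd Y h11 x = g x * u x" for x using codazzi(1)[of x] by (simp add: vd_h12 h12_0 u_def)
  \<comment> \<open>Since \<open>k\<close> vanishes and \<open>h11\<close> is constant along
    \<open>X\<close>, the commutator rule makes \<open>vd Y h11\<close> constant along
    \<open>X\<close>; by Codazzi this function is \<open>g x * u x\<close>.\<close>
  have g0: "vd X g x = 0" for x
  proof -
    have "vd X (vd Y h11) x = 0" using commutator[OF smh(1), of x] vdc[OF h] by (simp add: h k0)
    moreover have "vd Y h11 = (\<lambda>x. g x * u x)" using gu by auto
    ultimately have "vd X g x * u x = 0" by (simp add: vd_mult smh smooth_u u0)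
    then show ?thesis using u_pos'[of x] by simp
  qed
  define w where "w x = f x + h11 x *\<^sub>R n x - g x *\<^sub>R e2 x" for x
  define s where "s x = 1 + (h11 x)\<^sup>2 + (g x)\<^sup>2" for x
  have s: "s x > 0" for x by (simp add: s_def add_pos_nonneg)
  have sw: "smooth w" "smooth s" unfolding w_def[abs_def] s_def[abs_def] power2_eq_square by (intro smooth_intros sm sme smh)+
  have ww: "w x \<bullet> w x = s x" and we: "w x \<bullet> e1 x = 0" for x
    by (simp_all add: w_def s_def inner_simps ortho power2_eq_square)
  have e1w: "vd X e1 x = - w x" "vd Y e1 x = 0" for x
    by (simp_all add: D1e1 D2e1 w_def h12_0 k0)
  have D1w: "vd X w x = s x *\<^sub>R e1 x" for x
    unfolding w_def[abs_def]
    by (simp add: vd_simps sm sme smh h g0 D1n D1e2 h12_0 s_def power2_eq_square algebra_simps)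
  \<comment> \<open>Along \<open>Y\<close> the vector \<open>w\<close> changes only its length, by
    the Gauss and Codazzi equations; the unit vector \<open>b\<close> is therefore constant along
    \<open>Y\<close>.\<close>
  have D2w: "vd Y w x = g x *\<^sub>R w x" for x
  proof -
    have ga: "vd Y g x = 1 + h11 x * h22 x + (g x)\<^sup>2" using gauss[of x] vdc[OF k0] by (simp add: h12_0 k0)
    have "vd Y w x = e2 x + (vd Y h11 x *\<^sub>R n x + h11 x *\<^sub>R vd Y n x) - (vd Y g x *\<^sub>R e2 x + g x *\<^sub>R vd Y e2 x)"
      unfolding w_def[abs_def] by (simp add: vd_simps sm sme smh)
    also have "\<dots> = g x *\<^sub>R w x"
      unfolding ga gu D2n D2e2 w_def by (simp add: h12_0 k0 u_def power2_eq_square algebra_simps)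
    finally show ?thesis .
  qed
  define r where "r x = inverse (sqrt (s x))" for x
  have sr: "smooth r" unfolding r_def[abs_def] using s by (intro smooth_inverse smooth_sqrt sw) (auto simp: less_imp_neq[THEN not_sym])
  have r: "r x > 0" "r x * r x * s x = 1" for x using s[of x] by (simp_all add: r_def field_simps)
  have dr: "vd V r x = - (r x / (2 * s x)) * vd V s x" for V x
  proof -
    have "DERIV (\<lambda>t. inverse (sqrt t)) (s x) :> - (r x / (2 * s x))"
      using s[of x] by (auto intro!: derivative_eq_intros simp: r_def field_simps power2_eq_square)
    from dd_compose_real[OF this smooth_differentiable[OF sw(2)]] show ?thesis unfolding vd_def r_def[abs_def] .
  qed
  have ds: "vd X s x = 0" "vd Y s x = 2 * g x * s x" for x
  proof -
    have "s = (\<lambda>x. w x \<bullet> w x)" using ww by auto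
    then have "vd V s x = 2 * (vd V w x \<bullet> w x)" for V by (simp add: vd_inner sw inner_commute)
    then show "vd X s x = 0" "vd Y s x = 2 * g x * s x" by (simp_all add: D1w D2w ww we[simplified inner_commute[of "w _"]])
  qed
  define b where "b x = r x *\<^sub>R w x" for x
  have sb: "smooth b" unfolding b_def[abs_def] by (intro smooth_scaleR sr sw)
  have db: "vd X b x = (r x * s x) *\<^sub>R e1 x" "vd Y b x = 0" for x
  proof -
    have "vd V b x = vd V r x *\<^sub>R w x + r x *\<^sub>R vd V w x" for V unfolding b_def[abs_def] by (simp add: vd_scaleR sr sw)
    then show "vd X b x = (r x * s x) *\<^sub>R e1 x" "vd Y b x = 0"
      using s[of x] by (simp_all add: dr ds D1w D2w scaleR_add_left[symmetric])
  qed
  have de: "vd X e1 x = - (r x * s x) *\<^sub>R b x" for x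
  proof -
    have e: "(r x * s x) *\<^sub>R b x = (r x * r x * s x) *\<^sub>R w x" by (simp add: b_def mult_ac)
    show ?thesis unfolding e1w scaleR_minus_left e r by simp
  qed
  have unit: "e1 x \<bullet> e1 x = 1" "b x \<bullet> b x = 1" "e1 x \<bullet> b x = 0" for x
    using r(2)[of x] we[of x] by (simp_all add: b_def ww ortho inner_commute mult_ac)
  \<comment> \<open>These pairings give the entries of \<open>wedge (e1 x) (b x)\<close>. They are
    constant because \<open>e1\<close> and \<open>b\<close> rotate into each other along
    \<open>X\<close> and do not change along \<open>Y\<close>.\<close>
  define q where "q c d x = (e1 x \<bullet> c) * (b x \<bullet> d) - (b x \<bullet> c) * (e1 x \<bullet> d)" for c d x
  have sq: "smooth (q c d)" for c d unfolding q_def[abs_def] by (intro smooth_intros sme sb)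
  have qx: "q c d x = q c d 0" for c d x
  proof -
    have z: "vd X (q c d) z = 0" "vd Y (q c d) z = 0" for z
      unfolding q_def[abs_def] by (simp_all add: vd_simps sme sb db de e1w algebra_simps)
    have "dd v (q c d) z = 0" for v z
      using dd_decomp[OF smooth_differentiable[OF sq], of v c d z] by (simp add: z)
    then have "(q c d has_derivative (\<lambda>v. 0)) (at z)" for z
      using smooth_has_dd[OF sq, of c d z] by simp
    then have "\<exists>k. \<forall>z\<in>UNIV. q c d z = k" by (intro has_derivative_zero_constant convex_UNIV)
    then show ?thesis by auto
  qed
  have const: "wedge (e1 x) (b x) = wedge (e1 0) (b 0)" for x
  proof -
    have "wedge (e1 x) (b x) $ i $ j = wedge (e1 0) (b 0) $ i $ j" for i j
      using qx[of "axis i 1" "axis j 1" x] by (simp add: wedge_def q_def inner_axis)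
    then show ?thesis by (simp add: vec_eq_iff)
  qed
  show thesis
  proof (rule that)
    show "transpose (wedge (e1 0) (b 0)) = - wedge (e1 0) (b 0)" by (rule transpose_wedge)
    show "rank (wedge (e1 0) (b 0)) = 2" by (rule rank_wedge[OF unit])
    show "\<exists>c. wedge (e1 0) (b 0) *v f x = c *\<^sub>R e1 x" for x
      unfolding const[of x, symmetric] wedge_mult by (auto simp: ortho intro: exI[of _ "b x \<bullet> f x"])
  qed
qed

end

section \<open>Rotational symmetry\<close>

locale embedded_weingarten = embedded_torus + weingarten
begin

text \<open>If the bound fails for \<kappa>, it holds for some \<open>k > \<kappa>\<close> with
  equality at two distinct points, since close pairs are strict already for \<kappa>. The ball of
  curvature \<open>\<Phi> k x0\<close> touches the surface at both points, which is impossible from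
  the same side and from opposite sides.\<close>

lemma supporting_balls:
  assumes pf: "principal_frame f n X Y \<psi>" and u: "\<And>x. sphere_frame.h11 f n X x - sphere_frame.h22 f n Y x = uu x"
    and kap: "\<kappa> > 1"
  shows "0 \<le> (\<psi> (uu x) + \<kappa> * uu x) / 2 * (1 - f x \<bullet> f y) + n x \<bullet> f y"
proof (rule ccontr)
  interpret pf: principal_frame f n X Y \<psi> by (rule pf)
  have pu: "pf.u = uu" using u by (auto simp: pf.u_def)
  define \<Phi> where "\<Phi> \<kappa> x = (\<psi> (uu x) + \<kappa> * uu x) / 2" for \<kappa> x
  have smuu: "smooth uu" using pf.smooth_u by (simp add: pu)
  have peru: "uu (x + lat i j) = uu x" for x i j by (simp add: uu_def aa_def bb_def per_h)
  have contu: "continuous_on S uu" for S by (intro smooth_continuous smuu)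
  have contpsi: "continuous_on S (\<lambda>x. \<psi> (uu x))" for S
    by (rule continuous_on_compose2[OF smooth_continuous[OF psi_smooth, of UNIV] contu]) simp
  have contP: "continuous_on S (\<Phi> \<kappa>)" for S \<kappa>
    unfolding \<Phi>_def[abs_def] by (intro continuous_intros contu contpsi) simp
  define V where "V x = n x - \<Phi> \<kappa> x *\<^sub>R f x" for x
  assume "\<not> 0 \<le> (\<psi> (uu x) + \<kappa> * uu x) / 2 * (1 - f x \<bullet> f y) + n x \<bullet> f y"
  then have neg: "\<Phi> \<kappa> x * (1 - f x \<bullet> f y) + n x \<bullet> f y < 0" by (simp add: \<Phi>_def)
  obtain e where e: "e > 0" "\<And>x y. f x \<noteq> f y \<Longrightarrow> norm (f x - f y) < e \<Longrightarrow> V x \<bullet> f x < V x \<bullet> f y"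
  proof (rule near_diagonal[of V])
    show "continuous_on UNIV V" unfolding V_def[abs_def] by (intro continuous_intros contf contn contP)
    show "V (x + lat i j) = V x" for x i j by (simp add: V_def \<Phi>_def perf pern peru)
    show "V x \<bullet> dd v f x = 0" for x v by (simp add: V_def inner_diff_left ndf gs.fdf)
    show "0 < V x \<bullet> dd v (dd v f) x" if "v \<noteq> 0" for x v
    proof -
      define a b where "a = dd v f x \<bullet> pf.e1 x" and "b = dd v f x \<bullet> pf.e2 x"
      have "V x \<bullet> dd v (dd v f) x = \<Phi> \<kappa> x * (dd v f x \<bullet> dd v f x) - dd v n x \<bullet> dd v f x"
        by (simp add: V_def inner_diff_left f_dd2 n_dd2)
      also have "\<dots> = (\<Phi> \<kappa> x - pf.h11 x) * a\<^sup>2 + (\<Phi> \<kappa> x - pf.h22 x) * b\<^sup>2"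
        unfolding pf.tangent_norm[of v x v] pf.dd_n_inner a_def[symmetric] b_def[symmetric] by (simp add: power2_eq_square algebra_simps)
      also have "\<dots> = (\<kappa> - 1) * uu x / 2 * a\<^sup>2 + (\<kappa> + 1) * uu x / 2 * b\<^sup>2"
      proof -
        have eqs: "\<Phi> \<kappa> x - pf.h11 x = (\<kappa> - 1) * uu x / 2" "\<Phi> \<kappa> x - pf.h22 x = (\<kappa> + 1) * uu x / 2"
          unfolding pf.h_eq pu \<Phi>_def by (simp_all add: field_simps)
        show ?thesis unfolding eqs ..
      qed
      also have "\<dots> > 0"
      proof -
        have "a\<^sup>2 + b\<^sup>2 = dd v f x \<bullet> dd v f x" using pf.tangent_norm[of v x v] by (simp add: a_def b_def power2_eq_square)
        then have "a\<^sup>2 + b\<^sup>2 > 0" using inj[of v x] that by auto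
        then have ab: "a\<^sup>2 > 0 \<or> b\<^sup>2 > 0" using zero_le_power2[of a] zero_le_power2[of b] by linarith
        have "(\<kappa> - 1) * uu x / 2 > 0" "(\<kappa> + 1) * uu x / 2 > 0" using kap no_umbilics[of x] by simp_all
        then show ?thesis using ab
          by (metis add_nonneg_pos add_pos_nonneg less_eq_real_def mult_pos_pos zero_le_mult_iff zero_le_power2)
      qed
      finally show ?thesis .
    qed
  qed blast
  have near: "0 < \<Phi> \<kappa> x * (1 - f x \<bullet> f y) + n x \<bullet> f y" if "f x \<noteq> f y" "norm (f x - f y) < e" for x y
    using e(2)[OF that] by (simp add: V_def inner_diff_left ff nf algebra_simps)
  have rho: "1 - f x \<bullet> f y = (norm (f x - f y))\<^sup>2 / 2" for x y
    by (simp add: power2_norm_eq_inner inner_diff_left inner_diff_right ff inner_commute)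
  have neq: "f x \<noteq> f y"
  proof
    assume "f x = f y"
    then have "n x \<bullet> f y = 0" "f x \<bullet> f y = 1" using nf[of x] ff[of x] by simp_all
    then show False using neg by simp
  qed
  define K where "K = (fund \<times> fund) \<inter> {z. e \<le> norm (f (fst z) - f (snd z))}"
  have "compact K" unfolding K_def
    by (intro compact_Int_closed compact_Times compact_cbox closed_Collect_le continuous_intros continuous_on_compose2[OF contf[of UNIV]]) auto
  \<comment> \<open>\<open>R z\<close> is the smallest factor for which the inequality holds at the
    pair \<open>z\<close>; its maximum over \<open>K\<close> is the critical factor.\<close>
  define R where "R z = (- 2 * (n (fst z) \<bullet> f (snd z)) / (1 - f (fst z) \<bullet> f (snd z)) - \<psi> (uu (fst z))) / uu (fst z)" for z
  have Kpos: "1 - f (fst z) \<bullet> f (snd z) > 0" if "z \<in> K" for z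
    using that e(1) by (auto simp: K_def rho)
  have R: "R z \<le> k \<longleftrightarrow> 0 \<le> \<Phi> k (fst z) * (1 - f (fst z) \<bullet> f (snd z)) + n (fst z) \<bullet> f (snd z)"
    if z: "1 - f (fst z) \<bullet> f (snd z) > 0" for z k
  proof -
    define r c where "r = 1 - f (fst z) \<bullet> f (snd z)" and "c = n (fst z) \<bullet> f (snd z)"
    have r: "r > 0" using z by (simp add: r_def)
    have "R z \<le> k \<longleftrightarrow> - 2 * c / r \<le> k * uu (fst z) + \<psi> (uu (fst z))"
      using no_umbilics[of "fst z"] by (simp add: R_def r_def[symmetric] c_def[symmetric] pos_divide_le_eq diff_le_eq)
    also have "\<dots> \<longleftrightarrow> - 2 * c \<le> (k * uu (fst z) + \<psi> (uu (fst z))) * r" using r by (rule pos_divide_le_eq)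
    also have "\<dots> \<longleftrightarrow> 0 \<le> \<Phi> k (fst z) * r + c" by (simp add: \<Phi>_def field_simps) argo
    finally show ?thesis by (simp add: r_def c_def)
  qed
  obtain i j where i: "x + lat i j \<in> fund" using lattice_reduce by blast
  obtain i' j' where i': "y + lat i' j' \<in> fund" using lattice_reduce by blast
  have xyK: "(x + lat i j, y + lat i' j') \<in> K"
    using i i' near[OF neq] neg by (auto simp: K_def perf not_less[symmetric])
  have "continuous_on K R" unfolding R_def[abs_def]
    using Kpos no_umbilics
    by (intro continuous_intros continuous_on_compose2[OF contf[of UNIV]] continuous_on_compose2[OF contn[of UNIV]]
        continuous_on_compose2[OF contpsi[of UNIV]] continuous_on_compose2[OF contu[of UNIV]]) (auto simp: less_imp_neq[THEN not_sym])
  from continuous_attains_sup[OF \<open>compact K\<close> _ this] xyK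
  obtain z where z: "z \<in> K" "\<And>w. w \<in> K \<Longrightarrow> R w \<le> R z" by blast
  define k where "k = R z"
  have k: "k > \<kappa>"
  proof -
    have "\<not> R (x + lat i j, y + lat i' j') \<le> \<kappa>"
      using R[OF Kpos[OF xyK], of \<kappa>] neg by (simp add: perf pern \<Phi>_def peru)
    then show ?thesis using z(2)[OF xyK] by (simp add: k_def)
  qed
  have k1: "k > 1" using k kap by simp
  have min: "0 \<le> \<Phi> k x * (1 - f x \<bullet> f y) + n x \<bullet> f y" for x y
  proof -
    consider "f x = f y" | "f x \<noteq> f y" "norm (f x - f y) < e" | "e \<le> norm (f x - f y)" by linarith
    then show ?thesis
    proof cases
      case 1
      then have "n x \<bullet> f y = 0" "f x \<bullet> f y = 1" using nf[of x] ff[of x] by simp_all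
      then show ?thesis by simp
    next
      case 2
      have "\<Phi> \<kappa> x \<le> \<Phi> k x" using k no_umbilics[of x] by (simp add: \<Phi>_def)
      then have "\<Phi> \<kappa> x * (1 - f x \<bullet> f y) \<le> \<Phi> k x * (1 - f x \<bullet> f y)" by (rule mult_right_mono) (simp add: rho)
      then show ?thesis using near[OF 2] by linarith
    next
      case 3
      obtain i j where i: "x + lat i j \<in> fund" using lattice_reduce by blast
      obtain i' j' where i': "y + lat i' j' \<in> fund" using lattice_reduce by blast
      have w: "(x + lat i j, y + lat i' j') \<in> K" using i i' 3 by (auto simp: K_def perf)
      then have "R (x + lat i j, y + lat i' j') \<le> k" unfolding k_def by (rule z(2))
      then show ?thesis using R[OF Kpos[OF w], of k] by (simp add: perf pern \<Phi>_def peru)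
    qed
  qed
  define x0 y0 where "x0 = fst z" and "y0 = snd z"
  have zero: "\<Phi> k x0 * (1 - f x0 \<bullet> f y0) + n x0 \<bullet> f y0 = 0"
  proof -
    define r c where "r = 1 - f x0 \<bullet> f y0" and "c = n x0 \<bullet> f y0"
    have r: "r > 0" using Kpos[OF z(1)] by (simp add: r_def x0_def y0_def)
    have "k * uu x0 = - 2 * c / r - \<psi> (uu x0)"
      using no_umbilics[of x0] by (simp add: k_def R_def x0_def[symmetric] y0_def[symmetric] r_def[symmetric] c_def[symmetric])
    then have "2 * \<Phi> k x0 = - 2 * c / r" by (simp add: \<Phi>_def)
    then have "\<Phi> k x0 * r = - c" using r by (simp add: field_simps)
    then show ?thesis by (simp add: r_def c_def)
  qed
  have ne: "f x0 \<noteq> f y0" using z(1) e(1) by (auto simp: K_def x0_def y0_def)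
  define \<phi> where "\<phi> = \<Phi> k x0"
  have sP: "smooth (\<Phi> k)" unfolding \<Phi>_def[abs_def] pu[symmetric]
    by (intro smooth_bounded_linear[OF bounded_linear_divide] smooth_intros pf.smooth_psi_u pf.smooth_u)
  define U where "U = n x0 - \<phi> *\<^sub>R f x0"
  have Uf: "U \<bullet> f y0 = - \<phi>" using zero by (simp add: U_def \<phi>_def inner_diff_left algebra_simps)
  have Ue: "U \<bullet> dd w f y0 = 0" for w
    unfolding U_def \<phi>_def by (rule two_point_min(2)[OF smf smn sP min zero])
  have "U = (U \<bullet> f y0) *\<^sub>R f y0 + (U \<bullet> n y0) *\<^sub>R n y0"
    using pf.expand[of U y0] Ue by (simp add: vd_def)
  then have U: "U = - \<phi> *\<^sub>R f y0 + (U \<bullet> n y0) *\<^sub>R n y0" by (simp only: Uf)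
  have "U \<bullet> U = - \<phi> * (U \<bullet> f y0) + (U \<bullet> n y0) * (U \<bullet> n y0)"
    by (subst (2) U) (simp add: inner_add_right inner_diff_right)
  moreover have "U \<bullet> U = 1 + \<phi> * \<phi>"
    using nf[of x0] by (simp add: U_def inner_diff_left inner_diff_right ff nn inner_commute)
  ultimately have "(U \<bullet> n y0)\<^sup>2 = 1" by (simp add: Uf power2_eq_square)
  \<comment> \<open>\<open>U\<close> has no tangential component at \<open>y0\<close>, and comparing
    lengths leaves two normals: the ball touches from the same side or from the opposite
    one.\<close>
  then consider "U \<bullet> n y0 = 1" | "U \<bullet> n y0 = - 1" by (auto simp: power2_eq_1_iff)
  then show False
  proof cases
    case 1
    then have "n x0 - \<Phi> k x0 *\<^sub>R f x0 = n y0 - \<Phi> k x0 *\<^sub>R f y0" using U by (simp add: U_def \<phi>_def)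
    then show False
      using pf.two_point_contradiction[OF k1, of x0 y0] min zero ne by (simp add: pu \<Phi>_def)
  next
    case 2
    show False
    proof (rule touching_sign)
      show "- \<phi> \<le> (n x0 - \<phi> *\<^sub>R f x0) \<bullet> f z" for z
        using min[of x0 z] by (simp add: \<phi>_def inner_diff_left algebra_simps)
      show "n x0 - \<phi> *\<^sub>R f x0 = - n y0 - \<phi> *\<^sub>R f y0" using U 2 by (simp add: U_def)
    qed
  qed
qed

lemma rotational_symmetry:
  obtains Q where "transpose Q = - Q" "rank Q = 2" "\<And>x. \<exists>v. Q *v f x = dd v f x"
proof -
  obtain X Y where pf: "principal_frame f n X Y \<psi>" and u: "\<And>x. sphere_frame.h11 f n X x - sphere_frame.h22 f n Y x = uu x"
    by (rule principal_frame_exists) blast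
  interpret pf: principal_frame f n X Y \<psi> by (rule pf)
  have pu: "pf.u = uu" using u by (auto simp: pf.u_def)
  have "0 \<le> pf.h11 x * (1 - f x \<bullet> f y) + n x \<bullet> f y" for x y
  proof (rule ccontr)
    define c \<rho> where "c = pf.h11 x * (1 - f x \<bullet> f y) + n x \<bullet> f y" and "\<rho> = 1 - f x \<bullet> f y"
    assume "\<not> ?thesis"
    then have c: "c < 0" by (simp add: c_def)
    have le: "0 \<le> c + d * uu x * \<rho> / 2" if "d > 0" for d
      using supporting_balls[OF pf u, of "1 + d" x y] that by (simp add: c_def \<rho>_def pf.h_eq pu field_simps)
    have pos: "uu x * \<rho> > 0" using le[of 1] c by simp
    \<comment> \<open>With this \<open>d\<close> the nonnegative quantity in \<open>le\<close> would
      be \<open>c / 2\<close>, which is negative.\<close>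
    define d where "d = - c / (uu x * \<rho>)"
    have "d > 0" unfolding d_def using c pos by (intro divide_pos_pos) auto
    moreover have "d * (uu x * \<rho>) = - c" unfolding d_def using pos by (intro nonzero_eq_divide_eq[THEN iffD1]) auto
    then have "d * uu x * \<rho> = - c" by (simp only: mult.assoc)
    ultimately show False using le[of d] c by simp
  qed
  then have "vd X pf.h11 x = 0" for x by (rule pf.vd_h11_zero)
  then obtain Q where Q: "transpose Q = - Q" "rank Q = 2" "\<And>x. \<exists>c. Q *v f x = c *\<^sub>R pf.e1 x"
    by (rule pf.rotation_plane_constant) blast
  have "\<exists>v. Q *v f x = dd v f x" for x
  proof -
    obtain c where "Q *v f x = c *\<^sub>R pf.e1 x" using Q(3) by blast
    then have "Q *v f x = dd (c *\<^sub>R X x) f x" by (simp add: dd_vscale df vd_def)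
    then show ?thesis by blast
  qed
  with Q show thesis by (intro that) blast+
qed

end

section \<open>Lifting the embedding and its principal curvatures to the covering plane\<close>

lemma angular_lat: "angular (x + lat i j) = angular x"
proof -
  have "cis (t + 2 * pi * real_of_int k) = cis t" for t k
    using cis_mult[of t "2 * pi * real_of_int k", symmetric] cis_multiple_2pi[of "real_of_int k"] by simp
  then show ?thesis by (simp add: angular_def lat_def axis_def)
qed

lemma angular_eq: "angular x = angular y \<Longrightarrow> \<exists>i j. y = x + lat i j"
proof -
  assume a: "angular x = angular y"
  have "\<exists>k::int. t = s + 2 * pi * k" if "cis s = cis t" for s t
  proof -
    have "cos (t - s) = 1" using that by (simp add: cos_diff complex_eq_iff flip: power2_eq_square)
    then obtain k :: int where "t - s = of_int k * 2 * pi" using cos_one_2pi_int by blast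
    then show ?thesis by (intro exI[of _ k]) (simp add: algebra_simps)
  qed
  then obtain i j :: int where "y $ 1 = x $ 1 + 2 * pi * i" "y $ 2 = x $ 2 + 2 * pi * j"
    using a by (auto simp: angular_def) metis
  then have "y = x + lat i j" by (simp add: vec_eq_iff forall_2 lat_def axis_def)
  then show ?thesis by blast
qed

lemma angular_torus: "angular x \<in> torus"
  by (simp add: angular_def torus_def)

lemma pd_dd: "pd F i x = dd (axis i 1) (F \<circ> angular) x"
  by (simp add: pd_def dd_def)

lemma embedded_torus_of_embedding:
  assumes F: "smooth_embedding_S3 F" and \<nu>: "unit_normal_field F \<nu>"
  shows "embedded_torus (F \<circ> angular) (\<nu> \<circ> angular)"
proof unfold_locales
  let ?f = "F \<circ> angular" and ?n = "\<nu> \<circ> angular"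
  have S: "F ` torus \<subseteq> sphere 0 1" "torus_smooth F" "\<And>x. inj (frechet_derivative ?f (at x))"
    and hom: "\<exists>G. homeomorphism torus (F ` torus) F G"
    using F by (auto simp: smooth_embedding_S3_def)
  have N: "torus_smooth \<nu>" "\<And>p. p \<in> torus \<Longrightarrow> norm (\<nu> p) = 1 \<and> \<nu> p \<bullet> F p = 0" "\<And>x i. \<nu> (angular x) \<bullet> pd F i x = 0"
    using \<nu> by (auto simp: unit_normal_field_def)
  show sf: "smooth ?f" "smooth ?n" using S(2) N(1) by (simp_all add: torus_smooth_def)
  have df: "?f differentiable (at x)" for x by (rule smooth_differentiable[OF sf(1)])
  show "?f x \<bullet> ?f x = 1" for x using S(1) angular_torus[of x] by (auto simp: norm_eq_1[symmetric])
  show "?n x \<bullet> ?n x = 1" "?n x \<bullet> ?f x = 0" for x using N(2)[OF angular_torus[of x]] by (auto simp: norm_eq_1[symmetric])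
  show "?n x \<bullet> dd v ?f x = 0" for v x
    using N(3)[of x 1] N(3)[of x 2]
    by (subst pt_components[of v]) (simp add: dd_vadd[OF df] dd_vscale[OF df] pd_dd inner_add_right)
  show "v = 0" if "dd v ?f x = 0" for v x
  proof -
    have "dd v ?f x = dd 0 ?f x" using that linear_0[OF dd_linear[OF df]] by simp
    then show ?thesis using S(3)[of x] by (auto simp: dd_def inj_def)
  qed
  show "?f (x + lat i j) = ?f x" "?n (x + lat i j) = ?n x" for x i j by (simp_all add: angular_lat)
  show "\<exists>i j. y = x + lat i j" if "?f x = ?f y" for x y
  proof -
    obtain G where "\<And>p. p \<in> torus \<Longrightarrow> G (F p) = p" using hom by (auto simp: homeomorphism_def)
    then have "angular x = angular y" using that angular_torus by (metis comp_apply)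
    then show ?thesis by (rule angular_eq)
  qed
qed

text \<open>The coordinate derivatives are a triangular combination of the frame derivatives with
  positive diagonal \<open>rr x\<close>, \<open>qq x\<close>, so the equations may be tested in the
  frame. There they form a two by two system, solvable nontrivially exactly when its determinant
  vanishes.\<close>

lemma (in torus_surface) pencil_eigenvalues:
  "(\<exists>v. v \<noteq> 0 \<and> (\<forall>i::2. (dd (axis i 1) n x - t *\<^sub>R dd (axis i 1) f x) \<bullet> dd v f x = 0))
   \<longleftrightarrow> (gs.h11 x - t) * (gs.h22 x - t) = (gs.h12 x)\<^sup>2"
proof -
  have dn: "n differentiable (at x)" by (rule smooth_differentiable[OF smn])
  have comps: "(\<forall>i::2. (dd (axis i 1) n x - t *\<^sub>R dd (axis i 1) f x) \<bullet> dd v f x = 0)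
    \<longleftrightarrow> (gs.h11 x - t) * a + gs.h12 x * b = 0 \<and> gs.h12 x * a + (gs.h22 x - t) * b = 0"
    if v: "dd v f x = a *\<^sub>R gs.e1 x + b *\<^sub>R gs.e2 x" for v a b
  proof -
    let ?A = "(gs.h11 x - t) * a + gs.h12 x * b" and ?B = "gs.h12 x * a + (gs.h22 x - t) * b"
    have A: "(vd gX n x - t *\<^sub>R gs.e1 x) \<bullet> dd v f x = ?A" and B: "(vd gY n x - t *\<^sub>R gs.e2 x) \<bullet> dd v f x = ?B"
      unfolding v gs.D1n gs.D2n by (simp_all add: inner_simps gs.ortho algebra_simps)
    have "(dd p1 n x - t *\<^sub>R dd p1 f x) \<bullet> dd v f x = rr x * ((vd gX n x - t *\<^sub>R gs.e1 x) \<bullet> dd v f x)"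
      unfolding dd_p1[OF dn] dd_p1[OF df] by (simp add: inner_diff_left algebra_simps)
    moreover have "(dd p2 n x - t *\<^sub>R dd p2 f x) \<bullet> dd v f x
       = pp x * ((vd gX n x - t *\<^sub>R gs.e1 x) \<bullet> dd v f x) + qq x * ((vd gY n x - t *\<^sub>R gs.e2 x) \<bullet> dd v f x)"
      unfolding dd_p2[OF dn] dd_p2[OF df] by (simp add: inner_simps algebra_simps)
    ultimately show ?thesis unfolding forall_2 A B using rr_pos(2)[of x] qq_pos(2)[of x] by auto
  qed
  show ?thesis
  proof
    assume "\<exists>v. v \<noteq> 0 \<and> (\<forall>i::2. (dd (axis i 1) n x - t *\<^sub>R dd (axis i 1) f x) \<bullet> dd v f x = 0)"
    then obtain v where v: "v \<noteq> 0" "\<forall>i::2. (dd (axis i 1) n x - t *\<^sub>R dd (axis i 1) f x) \<bullet> dd v f x = 0" by blast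
    define a b where "a = dd v f x \<bullet> gs.e1 x" and "b = dd v f x \<bullet> gs.e2 x"
    have dv: "dd v f x = a *\<^sub>R gs.e1 x + b *\<^sub>R gs.e2 x" unfolding a_def b_def by (rule gs.dd_decomp[OF df])
    have e: "(gs.h11 x - t) * a = - (gs.h12 x * b)" "gs.h12 x * a = - ((gs.h22 x - t) * b)"
      using comps[OF dv] v(2) by (auto simp: add_eq_0_iff)
    have ab: "a \<noteq> 0 \<or> b \<noteq> 0" using dv v(1) inj[of v x] by auto
    have "((gs.h11 x - t) * (gs.h22 x - t) - (gs.h12 x)\<^sup>2) * a = (gs.h22 x - t) * ((gs.h11 x - t) * a) - gs.h12 x * (gs.h12 x * a)"
      by (simp add: power2_eq_square algebra_simps)
    then have 1: "((gs.h11 x - t) * (gs.h22 x - t) - (gs.h12 x)\<^sup>2) * a = 0" unfolding e by (simp add: algebra_simps)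
    have "((gs.h11 x - t) * (gs.h22 x - t) - (gs.h12 x)\<^sup>2) * b = (gs.h11 x - t) * ((gs.h22 x - t) * b) - gs.h12 x * (gs.h12 x * b)"
      by (simp add: power2_eq_square algebra_simps)
    moreover have e': "(gs.h22 x - t) * b = - (gs.h12 x * a)" "gs.h12 x * b = - ((gs.h11 x - t) * a)" using e by simp_all
    ultimately have 2: "((gs.h11 x - t) * (gs.h22 x - t) - (gs.h12 x)\<^sup>2) * b = 0" unfolding e' by (simp add: algebra_simps)
    show "(gs.h11 x - t) * (gs.h22 x - t) = (gs.h12 x)\<^sup>2" using 1 2 ab by auto
  next
    assume d: "(gs.h11 x - t) * (gs.h22 x - t) = (gs.h12 x)\<^sup>2"
    obtain a b where ab: "a \<noteq> 0 \<or> b \<noteq> 0" "(gs.h11 x - t) * a + gs.h12 x * b = 0" "gs.h12 x * a + (gs.h22 x - t) * b = 0"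
    \<comment> \<open>The second row yields a kernel vector unless it is zero; in that case (0, 1)
      solves both rows.\<close>
    proof (cases "gs.h12 x = 0 \<and> gs.h22 x - t = 0")
      case True
      then show thesis by (intro that[of 0 1]) auto
    next
      case False
      then show thesis using d by (intro that[of "gs.h22 x - t" "- gs.h12 x"]) (auto simp: power2_eq_square algebra_simps)
    qed
    define v where "v = a *\<^sub>R gX x + b *\<^sub>R gY x"
    have dv: "dd v f x = a *\<^sub>R gs.e1 x + b *\<^sub>R gs.e2 x" by (simp add: v_def dd_vadd dd_vscale df vd_def)
    have "v \<noteq> 0"
    proof
      assume "v = 0"
      then have "dd v f x = 0" using linear_0[OF dd_linear[OF df]] by simp
      then have "dd v f x \<bullet> gs.e1 x = 0" "dd v f x \<bullet> gs.e2 x = 0" by simp_all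
      then show False using ab(1) unfolding dv by (simp add: inner_simps gs.ortho)
    qed
    then show "\<exists>v. v \<noteq> 0 \<and> (\<forall>i::2. (dd (axis i 1) n x - t *\<^sub>R dd (axis i 1) f x) \<bullet> dd v f x = 0)"
      using comps[OF dv] ab(2,3) by blast
  qed
qed

text \<open>The discriminant is a sum of squares, so both roots are real, and the equality of sets
  determines the ordered pair even when the roots coincide.\<close>

lemma root_pair:
  fixes h k b \<kappa>1 \<kappa>2 :: real
  assumes "{t. (h - t) * (k - t) = b\<^sup>2} = {\<kappa>1, \<kappa>2}" "\<kappa>1 \<ge> \<kappa>2"
  shows "\<kappa>1 + \<kappa>2 = h + k" "\<kappa>1 - \<kappa>2 = sqrt ((h - k)\<^sup>2 + (2 * b)\<^sup>2)"
proof -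
  define U where "U = sqrt ((h - k)\<^sup>2 + (2 * b)\<^sup>2)"
  have U: "U\<^sup>2 = (h - k)\<^sup>2 + (2 * b)\<^sup>2" "U \<ge> 0" by (simp_all add: U_def)
  have roots: "(h - t) * (k - t) = b\<^sup>2 \<longleftrightarrow> t = (h + k + U) / 2 \<or> t = (h + k - U) / 2" for t
  proof -
    have "(h - t) * (k - t) = b\<^sup>2 \<longleftrightarrow> (h - t) * (k - t) - b\<^sup>2 = 0" by simp
    also have "(h - t) * (k - t) - b\<^sup>2 = ((2 * t - (h + k))\<^sup>2 - U\<^sup>2) / 4" unfolding U by (simp add: power2_eq_square field_simps)
    also have "\<dots> = (t - (h + k + U) / 2) * (t - (h + k - U) / 2)" by (simp add: power2_eq_square field_simps)
    finally show ?thesis by simp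
  qed
  have "{\<kappa>1, \<kappa>2} = {(h + k + U) / 2, (h + k - U) / 2}" unfolding assms(1)[symmetric] roots by blast
  then have "\<kappa>1 = (h + k + U) / 2 \<and> \<kappa>2 = (h + k - U) / 2 \<or> \<kappa>1 = (h + k - U) / 2 \<and> \<kappa>2 = (h + k + U) / 2"
    by (auto simp: doubleton_eq_iff)
  then have "\<kappa>1 = (h + k + U) / 2 \<and> \<kappa>2 = (h + k - U) / 2" using assms(2) U(2) by auto
  then have "\<kappa>1 + \<kappa>2 = h + k \<and> \<kappa>1 - \<kappa>2 = U" by (simp add: field_simps)
  then show "\<kappa>1 + \<kappa>2 = h + k" "\<kappa>1 - \<kappa>2 = sqrt ((h - k)\<^sup>2 + (2 * b)\<^sup>2)" unfolding U_def by blast+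
qed

text \<open>Tested in the coordinate directions, the matrix equation becomes one for derivatives of
  the lifts, which can be expressed in any frame.\<close>

lemma principal_curvatures_pencil:
  assumes df: "F \<circ> angular differentiable (at x)"
  shows "principal_curvatures F \<nu> x = {t. \<exists>v. v \<noteq> 0 \<and>
    (\<forall>i::2. (dd (axis i 1) (\<nu> \<circ> angular) x - t *\<^sub>R dd (axis i 1) (F \<circ> angular) x) \<bullet> dd v (F \<circ> angular) x = 0)}"
proof -
  let ?f = "F \<circ> angular" and ?n = "\<nu> \<circ> angular"
  have dv: "dd v ?f x = v $ 1 *\<^sub>R dd p1 ?f x + v $ 2 *\<^sub>R dd p2 ?f x" for v
    by (subst pt_components[of v]) (simp only: dd_vadd dd_vscale df)
  have "(second_ff F \<nu> x *v v) $ i = dd (axis i 1) ?n x \<bullet> dd v ?f x" "(first_ff F x *v v) $ i = dd (axis i 1) ?f x \<bullet> dd v ?f x" for v i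
    by (simp_all add: dv[of v] matrix_vector_mult_def second_ff_def first_ff_def pd_dd sum_2 inner_add_right mult.commute)
  then have "second_ff F \<nu> x *v v = t *\<^sub>R (first_ff F x *v v) \<longleftrightarrow>
      (\<forall>i::2. (dd (axis i 1) ?n x - t *\<^sub>R dd (axis i 1) ?f x) \<bullet> dd v ?f x = 0)" for v t
    by (simp add: vec_eq_iff inner_diff_left)
  then show ?thesis by (simp add: principal_curvatures_def)
qed

theorem theorem1:
  fixes \<psi> :: "real \<Rightarrow> real"
    and F \<nu> :: "complex \<times> complex \<Rightarrow> real ^ 4"
    and \<kappa>\<^sub>1 \<kappa>\<^sub>2 :: "complex \<times> complex \<Rightarrow> real"
  assumes "smooth \<psi>"
    and "\<And>s. \<psi> (- s) = \<psi> s"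
    and "\<And>s. s > 0 \<Longrightarrow> 0 \<le> s * deriv \<psi> s \<and> s * deriv \<psi> s < min (\<psi> s) s"
    and "\<And>s. s \<ge> 0 \<Longrightarrow>
           0 \<le> s * deriv (deriv \<psi>) s \<and> s * deriv (deriv \<psi>) s \<le> 1 - (deriv \<psi> s)\<^sup>2"
    and "smooth_embedding_S3 F"
    and "unit_normal_field F \<nu>"
    and "\<And>x. principal_curvatures F \<nu> x = {\<kappa>\<^sub>1 (angular x), \<kappa>\<^sub>2 (angular x)}"
    and "\<And>p. p \<in> torus \<Longrightarrow> \<kappa>\<^sub>1 p \<ge> \<kappa>\<^sub>2 p"
    and "\<And>p. p \<in> torus \<Longrightarrow> \<kappa>\<^sub>1 p + \<kappa>\<^sub>2 p = \<psi> (\<kappa>\<^sub>1 p - \<kappa>\<^sub>2 p)"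
  shows "\<exists>Q :: real ^ 4 ^ 4. transpose Q = - Q \<and> rank Q = 2 \<and>
           (\<forall>x. Q *v F (angular x) \<in> span {pd F 1 x, pd F 2 x})"
proof -
  let ?f = "F \<circ> angular" and ?n = "\<nu> \<circ> angular"
  interpret E: embedded_torus ?f ?n by (rule embedded_torus_of_embedding[OF assms(5,6)])
  have roots: "{t. (E.gs.h11 x - t) * (E.gs.h22 x - t) = (E.gs.h12 x)\<^sup>2} = {\<kappa>\<^sub>1 (angular x), \<kappa>\<^sub>2 (angular x)}" for x
    using assms(7)[of x] unfolding principal_curvatures_pencil[OF E.df] E.pencil_eigenvalues .
  interpret embedded_weingarten ?f ?n \<psi>
  proof unfold_locales
    fix x
    note root_pair[OF roots assms(8)[OF angular_torus], of x]
    then show "E.gs.h11 x + E.gs.h22 x = \<psi> (sqrt ((E.gs.h11 x - E.gs.h22 x)\<^sup>2 + (2 * E.gs.h12 x)\<^sup>2))"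
      using assms(9)[OF angular_torus[of x]] by simp
  qed (use assms(1-4) in auto)
  obtain Q where Q: "transpose Q = - Q" "rank Q = 2" "\<And>x. \<exists>v. Q *v ?f x = dd v ?f x"
    by (rule rotational_symmetry) blast
  have "Q *v F (angular x) \<in> span {pd F 1 x, pd F 2 x}" for x
  proof -
    obtain v where "Q *v ?f x = dd v ?f x" using Q(3) by blast
    also have "\<dots> = v $ 1 *\<^sub>R dd p1 ?f x + v $ 2 *\<^sub>R dd p2 ?f x"
      by (subst pt_components[of v]) (simp only: dd_vadd dd_vscale E.df)
    finally have "Q *v F (angular x) = v $ 1 *\<^sub>R pd F 1 x + v $ 2 *\<^sub>R pd F 2 x" by (simp add: pd_dd)
    then show ?thesis by (simp add: span_add span_base span_mul)
  qed
  with Q show ?thesis by blast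
qed

end
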